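(* Let $f$ be a meromorphic function on $\mathbb{C}$ of finite order $\sigma$ such that $f\notin\ker\mathcal{D}_{\mathrm{W}}$, let $q$ be a positive integer, and let $y_1,\ldots,y_q$ be $q$ distinct complex numbers. Then for every $\varepsilon>0$, $$(q-1)T(r,f)\le\widetilde{N_{\mathrm{W}}}(r,f)+\sum_{n=1}^q\widetilde{N_{\mathrm{W}}}\left(r,\frac1{f-y_n}\right)+O(r^{\sigma-\frac12+\varepsilon})+O(\ln r)$$ as $r\to\infty$.
   Context: The Wilson operator $\mathcal{D}_{\mathrm{W}}$: for $x\ne0$ and $z$ with $z^2=x$, $$(\mathcal{D}_{\mathrm{W}}f)(x):=\frac{f((z+\frac i2)^2)-f((z-\frac i2)^2)}{2iz},$$ which does not depend on the choice of $z$; at $x=0$ the value is the limit as $x\to0$, which is $f'(-\frac14)$ if $f$ is differentiable at $-\frac14$. If $f$ is meromorphic on $\mathbb{C}$, so is $\mathcal{D}_{\mathrm{W}}f$. $\ker\mathcal{D}_{\mathrm{W}}$ is the set of functions $f$ with $\mathcal{D}_{\mathrm{W}}f\equiv0$. Fix a branch $\sqrt{\cdot}$ of the square root with the imaginary axis (in the plane of $z=\sqrt x$) as branch cut: for $x\notin(-\infty,0]$ the values $\sqrt x$ lie in one fixed open half-plane bounded by the imaginary axis, and $\sqrt{-t^2}=it$ for $t\ge0$. Put $x^+:=(\sqrt x+\frac i2)^2$. Wilson counting functions: for a meromorphic $f\notin\ker\mathcal{D}_{\mathrm{W}}$ and $r\ge0$, let $S_r:=\{x:|x|\le r,\ \frac1f(x)=0\}$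 (the set of poles of $f$ in the closed disk) and $$\widetilde{n_{\mathrm{W}}}(r,f):=\sum_{x\in S_r}\max\left\{0,\ \text{order of pole of } f \text{ at } x-\text{order of zero of }\mathcal{D}_{\mathrm{W}}(\tfrac1f)\text{ at }x^+\right\}$$ (the order of zero being $0$ at a point that is not a zero); for $r>0$, $$\widetilde{N_{\mathrm{W}}}(r,f):=\int_0^r\frac{\widetilde{n_{\mathrm{W}}}(t,f)-\widetilde{n_{\mathrm{W}}}(0,f)}{t}dt+\widetilde{n_{\mathrm{W}}}(0,f)\ln r.$$ $T(r,f)$ is the Nevanlinna characteristic $T(r,f)=m(r,f)+N(r,f)$, with $m$ the proximity function and $N$ the integrated counting function of poles; the order of $f$ is $\limsup_{r\to\infty}\frac{\ln^+T(r,f)}{\ln r}$. *)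

theory Defs
  imports "HOL-Complex_Analysis.Complex_Analysis" "HOL-Library.Landau_Symbols"
begin

text \<open>
  A meromorphic function on the plane is a function with \<^term>\<open>f meromorphic_on UNIV\<close>; its values
  on a sparse set (in particular at its poles) are arbitrary. For radii \<open>r > 0\<close>, everything below
  depends on such a function only up to its values on a sparse set.
\<close>

definition wilson_quot :: "(complex \<Rightarrow> complex) \<Rightarrow> complex \<Rightarrow> complex" where
  "wilson_quot f z = (f ((z + \<i> / 2)\<^sup>2) - f ((z - \<i> / 2)\<^sup>2)) / (2 * \<i> * z)"

text \<open>
  The quotient is even in \<open>z\<close>, so any square root may be used.
  The function \<^const>\<open>remove_sings\<close> supplies the limit at \<open>0\<close> and at the other removable
  singularities of the quotient (and the value \<open>0\<close> at the poles), so that \<open>wilson f\<close> is identically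
  \<open>0\<close> in the sense of meromorphic functions iff it vanishes at every point. Where \<open>f\<close> is
  continuous at both nodes the value is the quotient itself, see \<open>wilson_eq\<close>.
\<close>

definition wilson :: "(complex \<Rightarrow> complex) \<Rightarrow> complex \<Rightarrow> complex" where
  "wilson f = remove_sings (\<lambda>x. wilson_quot f (csqrt x))"

definition wilson_ker :: "(complex \<Rightarrow> complex) set" where
  "wilson_ker = {f. \<forall>x. wilson f x = 0}"

lemma wilson_quot_uminus: "wilson_quot f (- z) = wilson_quot f z"
proof -
  have "(- z + \<i> / 2)\<^sup>2 = (z - \<i> / 2)\<^sup>2" "(- z - \<i> / 2)\<^sup>2 = (z + \<i> / 2)\<^sup>2"
    by (simp_all add: power2_eq_square algebra_simps)
  then show ?thesis
    unfolding wilson_quot_def by (simp add: divide_simps del: power2_minus)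
qed

lemma wilson_quot_square_cong:
  assumes "z\<^sup>2 = w\<^sup>2"
  shows "wilson_quot f z = wilson_quot f w"
  using assms wilson_quot_uminus[of f w] by (auto simp: power2_eq_iff)

lemma wilson_eq:
  assumes "z \<noteq> 0" and "isCont f ((z + \<i> / 2)\<^sup>2)" and "isCont f ((z - \<i> / 2)\<^sup>2)"
  shows "wilson f (z\<^sup>2) = wilson_quot f z"
proof -
  obtain s where s: "isCont s (z\<^sup>2)" "s (z\<^sup>2) = z" "\<And>x. (s x)\<^sup>2 = x"
  proof (cases "z\<^sup>2 \<in> \<real>\<^sub>\<le>\<^sub>0")
    case False
    have c: "isCont csqrt (z\<^sup>2)"
      using False by (rule continuous_at_csqrt)
    have "csqrt (z\<^sup>2) = z \<or> csqrt (z\<^sup>2) = - z"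
      by (metis power2_csqrt power2_eq_iff)
    then show ?thesis
      using that[of csqrt] that[of "\<lambda>x. - csqrt x"] c by (auto intro: continuous_intros)
  next
    case True
    have "z\<^sup>2 \<noteq> 0"
      using \<open>z \<noteq> 0\<close> by simp
    then have "Re (z\<^sup>2) \<noteq> 0 \<or> Im (z\<^sup>2) \<noteq> 0"
      by (metis complex_eq_iff zero_complex.sel)
    then have "- (z\<^sup>2) \<notin> \<real>\<^sub>\<le>\<^sub>0"
      using True by (auto simp: complex_nonpos_Reals_iff)
    then have "isCont csqrt (- (z\<^sup>2))"
      by (rule continuous_at_csqrt)
    then have "isCont (\<lambda>x. csqrt (- x)) (z\<^sup>2)"
      using isCont_o2[where f = uminus and g = csqrt and a = "z\<^sup>2"] by simp
    then have c: "isCont (\<lambda>x. \<i> * csqrt (- x)) (z\<^sup>2)"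
      by (intro continuous_mult continuous_const)
    have sq: "(\<i> * csqrt (- x))\<^sup>2 = x" for x
      by (simp add: power_mult_distrib)
    have "\<i> * csqrt (- (z\<^sup>2)) = z \<or> \<i> * csqrt (- (z\<^sup>2)) = - z"
      using sq by (metis power2_eq_iff)
    then show ?thesis
      using that[of "\<lambda>x. \<i> * csqrt (- x)"] that[of "\<lambda>x. - (\<i> * csqrt (- x))"] c sq
      by (auto simp del: mult_minus_right intro!: continuous_minus)
  qed
  have "isCont (\<lambda>x. f ((s x + \<i> / 2)\<^sup>2)) (z\<^sup>2)"
    by (rule isCont_o2[where g = f]) (use assms(2) s in \<open>auto intro!: continuous_intros\<close>)
  moreover have "isCont (\<lambda>x. f ((s x - \<i> / 2)\<^sup>2)) (z\<^sup>2)"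
    by (rule isCont_o2[where g = f]) (use assms(3) s in \<open>auto intro!: continuous_intros\<close>)
  ultimately have "isCont (\<lambda>x. wilson_quot f (s x)) (z\<^sup>2)"
    unfolding wilson_quot_def using assms(1) s by (intro continuous_intros) auto
  then have "(\<lambda>x. wilson_quot f (s x)) \<midarrow>z\<^sup>2\<rightarrow> wilson_quot f z"
    using s(2) by (simp add: isCont_def)
  moreover have "(\<lambda>x. wilson_quot f (s x)) = (\<lambda>x. wilson_quot f (csqrt x))"
    using s(3) by (intro ext wilson_quot_square_cong) simp
  ultimately have "(\<lambda>x. wilson_quot f (csqrt x)) \<midarrow>z\<^sup>2\<rightarrow> wilson_quot f z"
    by simp
  then show ?thesis
    unfolding wilson_def by (rule remove_sings_eqI)
qed

lemma wilson_0:
  assumes "f field_differentiable at (- 1 / 4)"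
  shows "wilson f 0 = deriv f (- 1 / 4)"
proof -
  let ?a = "- 1 / 4 :: complex"
  obtain g where g: "\<And>w. f w - f ?a = g w * (w - ?a)" "isCont g ?a" "g ?a = deriv f ?a"
    using assms by (auto simp: DERIV_deriv_iff_field_differentiable[symmetric] CARAT_DERIV)
  have sq: "(z + \<i> / 2)\<^sup>2 = ?a + (z\<^sup>2 + \<i> * z)" "(z - \<i> / 2)\<^sup>2 = ?a + (z\<^sup>2 - \<i> * z)" for z
    by (simp_all add: power2_eq_square algebra_simps)
  have *: "wilson_quot f z = g ((z + \<i> / 2)\<^sup>2) * (1 - \<i> * z) / 2 + g ((z - \<i> / 2)\<^sup>2) * (1 + \<i> * z) / 2"
    if "z \<noteq> 0" for z
  proof -
    have "f ((z + \<i> / 2)\<^sup>2) - f ((z - \<i> / 2)\<^sup>2)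
        = g ((z + \<i> / 2)\<^sup>2) * (z\<^sup>2 + \<i> * z) - g ((z - \<i> / 2)\<^sup>2) * (z\<^sup>2 - \<i> * z)"
      using g(1)[of "(z + \<i> / 2)\<^sup>2"] g(1)[of "(z - \<i> / 2)\<^sup>2"] by (simp add: sq algebra_simps)
    moreover have "(A * (z\<^sup>2 + \<i> * z) - B * (z\<^sup>2 - \<i> * z)) / (2 * \<i> * z)
        = A * (1 - \<i> * z) / 2 + B * (1 + \<i> * z) / 2" for A B
      using that by (simp add: field_simps power2_eq_square)
    ultimately show ?thesis
      by (simp add: wilson_quot_def)
  qed
  have "((\<lambda>x. sqrt (cmod x)) \<longlongrightarrow> sqrt (cmod 0)) (at (0 :: complex))"
    by (intro tendsto_intros)
  then have "(csqrt \<longlongrightarrow> 0) (at 0)"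
    by (intro tendsto_norm_zero_cancel[where f = csqrt]) simp
  then have c: "isCont csqrt 0"
    by (simp add: isCont_def)
  have "isCont (\<lambda>x. g ((csqrt x + \<i> / 2)\<^sup>2)) 0"
    by (rule isCont_o2[where g = g])
      (use g(2) c in \<open>auto intro!: continuous_intros simp: power2_eq_square\<close>)
  moreover have "isCont (\<lambda>x. g ((csqrt x - \<i> / 2)\<^sup>2)) 0"
    by (rule isCont_o2[where g = g])
      (use g(2) c in \<open>auto intro!: continuous_intros simp: power2_eq_square\<close>)
  ultimately have "isCont (\<lambda>x. g ((csqrt x + \<i> / 2)\<^sup>2) * (1 - \<i> * csqrt x) / 2
      + g ((csqrt x - \<i> / 2)\<^sup>2) * (1 + \<i> * csqrt x) / 2) 0"
    using c by (intro continuous_intros) auto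
  then have "(\<lambda>x. g ((csqrt x + \<i> / 2)\<^sup>2) * (1 - \<i> * csqrt x) / 2
      + g ((csqrt x - \<i> / 2)\<^sup>2) * (1 + \<i> * csqrt x) / 2) \<midarrow>0\<rightarrow> deriv f ?a"
    using g(3) by (simp add: isCont_def power2_eq_square)
  then have "(\<lambda>x. wilson_quot f (csqrt x)) \<midarrow>0\<rightarrow> deriv f ?a"
    by (rule Lim_transform_eventually) (auto simp: eventually_at_filter *)
  then show ?thesis
    unfolding wilson_def by (rule remove_sings_eqI)
qed

text \<open>The fixed half-plane may be the right one (as for \<^const>\<open>csqrt\<close>) or the left one.\<close>

definition wilson_branch :: "(complex \<Rightarrow> complex) \<Rightarrow> bool" where
  "wilson_branch s \<longleftrightarrow>
     (\<forall>x. (s x)\<^sup>2 = x) \<and>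
     (\<forall>t::real. t \<ge> 0 \<longrightarrow> s (of_real (- (t\<^sup>2))) = \<i> * of_real t) \<and>
     ((\<forall>x. x \<notin> \<real>\<^sub>\<le>\<^sub>0 \<longrightarrow> Re (s x) > 0) \<or> (\<forall>x. x \<notin> \<real>\<^sub>\<le>\<^sub>0 \<longrightarrow> Re (s x) < 0))"

definition wilson_plus :: "(complex \<Rightarrow> complex) \<Rightarrow> complex \<Rightarrow> complex" where
  "wilson_plus s x = (s x + \<i> / 2)\<^sup>2"

lemma wilson_branch_csqrt: "wilson_branch csqrt"
proof -
  have "csqrt (of_real (- (t\<^sup>2))) = \<i> * of_real t" if "t \<ge> 0" for t
    using that by (subst csqrt_of_real_nonpos) (auto simp: real_sqrt_abs)
  moreover have "Re (csqrt x) > 0" if "x \<notin> \<real>\<^sub>\<le>\<^sub>0" for x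
  proof (rule ccontr)
    assume "\<not> Re (csqrt x) > 0"
    then have "Re (csqrt x) = 0"
      using Re_csqrt[of x] by linarith
    then have "Re ((csqrt x)\<^sup>2) \<le> 0" "Im ((csqrt x)\<^sup>2) = 0"
      by (simp_all add: Re_power2 Im_power2 del: power2_csqrt)
    with that show False
      by (simp add: complex_nonpos_Reals_iff)
  qed
  ultimately show ?thesis
    by (simp add: wilson_branch_def)
qed

text \<open>\<open>ln\<^sup>+\<close>; the maximum is taken inside so that \<open>ln\<^sup>+ 0 = 0\<close> whatever \<^term>\<open>ln 0\<close> is.\<close>

definition ln_plus :: "real \<Rightarrow> real" where
  "ln_plus x = ln (max 1 x)"

definition proximity :: "real \<Rightarrow> (complex \<Rightarrow> complex) \<Rightarrow> real" where
  "proximity r f = 1 / (2 * pi) * integral {0..2 * pi} (\<lambda>\<theta>. ln_plus (cmod (f (of_real r * cis \<theta>))))"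

definition pole_order :: "(complex \<Rightarrow> complex) \<Rightarrow> complex \<Rightarrow> int" where
  "pole_order f x = (if is_pole f x then - zorder f x else 0)"

text \<open>
  \<^const>\<open>zorder\<close> is negative at a pole; the maximum makes the order of zero \<open>0\<close> there.
\<close>

definition zero_order :: "(complex \<Rightarrow> complex) \<Rightarrow> complex \<Rightarrow> int" where
  "zero_order f x = max 0 (zorder f x)"

definition poles_upto :: "real \<Rightarrow> (complex \<Rightarrow> complex) \<Rightarrow> complex set" where
  "poles_upto r f = {x. cmod x \<le> r \<and> is_pole f x}"

definition integrated_count :: "(real \<Rightarrow> real) \<Rightarrow> real \<Rightarrow> real" where
  "integrated_count n r = integral {0..r} (\<lambda>t. (n t - n 0) / t) + n 0 * ln r"

definition pole_count :: "real \<Rightarrow> (complex \<Rightarrow> complex) \<Rightarrow> real" where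
  "pole_count r f = of_int (\<Sum>x\<in>poles_upto r f. pole_order f x)"

definition nevanlinna_N :: "real \<Rightarrow> (complex \<Rightarrow> complex) \<Rightarrow> real" where
  "nevanlinna_N r f = integrated_count (\<lambda>t. pole_count t f) r"

definition nevanlinna_T :: "real \<Rightarrow> (complex \<Rightarrow> complex) \<Rightarrow> real" where
  "nevanlinna_T r f = proximity r f + nevanlinna_N r f"

definition nevanlinna_order :: "(complex \<Rightarrow> complex) \<Rightarrow> ereal" where
  "nevanlinna_order f = Limsup at_top (\<lambda>r. ereal (ln_plus (nevanlinna_T r f) / ln r))"

text \<open>\<open>s\<close> is the branch of the square root.\<close>

definition wilson_n :: "(complex \<Rightarrow> complex) \<Rightarrow> real \<Rightarrow> (complex \<Rightarrow> complex) \<Rightarrow> real" where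
  "wilson_n s r f = of_int (\<Sum>x\<in>poles_upto r f.
     max 0 (pole_order f x - zero_order (wilson (\<lambda>w. 1 / f w)) (wilson_plus s x)))"

definition wilson_N :: "(complex \<Rightarrow> complex) \<Rightarrow> real \<Rightarrow> (complex \<Rightarrow> complex) \<Rightarrow> real" where
  "wilson_N s r f = integrated_count (\<lambda>t. wilson_n s t f) r"

end

theory Submission
  imports Defs
begin

text \<open>
  Write \<open>D = wilson f\<close>. Since \<open>1 / (f - y n) = (D / (f - y n)) / D\<close> near the value \<open>y n\<close>, integrating over
  circles gives the classical estimate
  \<open>(q - 1) T(r, f) \<le> (\<Sum>n. N(r, 1 / (f - y n))) + N(r, D) - N(r, 1 / D) - N(r, f)\<close> up to proximity terms
  \<open>m(r, D / (f - y n))\<close>. In the variable \<open>z = \<surd>x\<close> these are logarithmic differences for the shifts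
  \<open>z \<plusminus> \<i> / 2\<close>. They are bounded by factoring \<open>f - y n\<close> on a disc into its zeros and poles and an exponential
  \<open>exp g\<close>: Schwarz's integral bounds \<open>g'\<close>, and the zeros and poles contribute averages of
  \<open>norm (z - c) powr - \<alpha>\<close> with \<open>\<alpha>\<close> close to \<open>1\<close>.

  The counting terms are compared point by point: if \<open>d\<close> is the order of \<open>D\<close> at \<open>x\<^sup>+\<close> then
  \<open>- d + (\<Sum>n. min (order of f - y n at x) d\<^sup>+)\<close> is at most the order of the pole of \<open>f\<close> at \<open>x\<^sup>+\<^sup>+\<close> plus the
  Wilson weight of \<open>f\<close> at \<open>x\<close>. Summing against \<open>ln (r / norm x)\<close> costs \<open>O(norm x powr (- 1 / 2))\<close> for each
  shift.
\<close>

subsection \<open>Circle means\<close>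

text \<open>The obstacle is a zero or pole of \<open>f - y n\<close> close to, or on, the circle of
  integration, where a logarithmic difference is unbounded. A difference of logarithms is therefore
  dominated by powers \<open>norm (z - c) powr - \<alpha>\<close> with \<alpha> < 1, whose mean over
  the half circle is bounded uniformly in the centre \<open>c\<close>. Because of this uniformity
  the final estimate holds for every large \<open>r\<close>, with no exceptional set of radii. For
  \<alpha> = 1 the mean can diverge, and part of \<epsilon> pays for staying below 1. The saving of
  1/2 in the exponent is a matter of scale: on \<open>norm x = r\<close> the shift moves
  \<open>x\<close> by a distance of order \<open>sqrt r\<close>, so both the exponential factor and
  the scaled powers gain a factor close to \<open>1 / sqrt r\<close>. The bounds at radius
  \<open>r\<close> involve the characteristic at \<open>4 * r\<close> and \<open>8 * r\<close>;
  finite order is what makes these comparable with a power of \<open>r\<close>. The term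
  \<open>O(ln r)\<close> absorbs constants and the finitely many points near 0, where the shifts
  need not be small compared with \<open>x\<close>. The coefficient is \<open>q - 1\<close> because
  \<open>D\<close> itself is estimated by \<open>f * (D / f)\<close>, which costs one proximity term
  of \<open>f\<close>.\<close>

definition cint :: "(real \<Rightarrow> real) \<Rightarrow> bool" where
  "cint u \<longleftrightarrow> u absolutely_integrable_on {0..2*pi}"

definition cavg :: "(real \<Rightarrow> real) \<Rightarrow> real" where
  "cavg u = integral {0..2*pi} u / (2*pi)"

lemma cint_integrable: "cint u \<Longrightarrow> u integrable_on {0..2*pi}"
  unfolding cint_def by (simp add: absolutely_integrable_on_def)

lemma cint_const [intro, simp]: "cint (\<lambda>_. c)"
  unfolding cint_def by (auto intro!: absolutely_integrable_on_const)

lemma cint_add [intro]: "cint u \<Longrightarrow> cint v \<Longrightarrow> cint (\<lambda>t. u t + v t)"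
  unfolding cint_def by (rule set_integral_add)

lemma cint_diff [intro]: "cint u \<Longrightarrow> cint v \<Longrightarrow> cint (\<lambda>t. u t - v t)"
  unfolding cint_def by (rule set_integral_diff)

lemma cint_cmult [intro]: "cint u \<Longrightarrow> cint (\<lambda>t. c * u t)"
  unfolding cint_def by (metis set_integrable_mult_right)

lemma cint_abs [intro]: "cint u \<Longrightarrow> cint (\<lambda>t. \<bar>u t\<bar>)"
  unfolding cint_def by (rule set_integrable_abs)

text \<open>Closure under \<open>max\<close> is the reason why \<open>cint\<close> demands absolute
  integrability: \<open>ln_plus\<close> is a maximum of 0 and \<open>ln\<close>, and plain gauge
  integrability would not pass to it.\<close>

lemma cint_max [intro]: "cint u \<Longrightarrow> cint v \<Longrightarrow> cint (\<lambda>t. max (u t) (v t))"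
  unfolding cint_def by (rule absolutely_integrable_max_1)

lemma cint_sum [intro]: "(\<And>a. a \<in> A \<Longrightarrow> cint (u a)) \<Longrightarrow> cint (\<lambda>t. \<Sum>a\<in>A. u a t)"
  by (induction A rule: infinite_finite_induct) auto

text \<open>Identities between meromorphic functions fail at finitely many parameters of a circle,
  where the values are arbitrary; this and \<open>cavg_spike\<close> discard them.\<close>

lemma cint_spike: "cint u \<Longrightarrow> finite B \<Longrightarrow> (\<And>t. t \<in> {0..2*pi} - B \<Longrightarrow> v t = u t) \<Longrightarrow> cint v"
  unfolding cint_def by (metis absolutely_integrable_spike negligible_finite)

lemma cavg_spike: "finite B \<Longrightarrow> (\<And>t. t \<in> {0..2*pi} - B \<Longrightarrow> v t = u t) \<Longrightarrow> cavg v = cavg u"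
  unfolding cavg_def by (subst integral_spike[of B _ u v]) auto

lemma cint_continuous: "continuous_on {0..2*pi} u \<Longrightarrow> cint u"
  unfolding cint_def by (rule absolutely_integrable_continuous_real)

lemma cavg_const [simp]: "cavg (\<lambda>_. c) = c"
  by (simp add: cavg_def)

lemma cavg_add: "cint u \<Longrightarrow> cint v \<Longrightarrow> cavg (\<lambda>t. u t + v t) = cavg u + cavg v"
  by (simp add: cavg_def integral_add cint_integrable add_divide_distrib)

lemma cavg_diff: "cint u \<Longrightarrow> cint v \<Longrightarrow> cavg (\<lambda>t. u t - v t) = cavg u - cavg v"
  by (simp add: cavg_def integral_diff cint_integrable diff_divide_distrib)

lemma cavg_cmult: "cavg (\<lambda>t. c * u t) = c * cavg u"
  by (simp add: cavg_def)

lemma cavg_sum: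
  "(\<And>a. a \<in> A \<Longrightarrow> cint (u a)) \<Longrightarrow> cavg (\<lambda>t. \<Sum>a\<in>A. u a t) = (\<Sum>a\<in>A. cavg (u a))"
  by (induction A rule: infinite_finite_induct) (auto simp: cavg_add cint_sum)

lemma cavg_mono:
  assumes "cint u" "cint v" "finite B" "\<And>t. t \<in> {0..2*pi} - B \<Longrightarrow> u t \<le> v t"
  shows "cavg u \<le> cavg v"
proof -
  let ?v = "\<lambda>t. if t \<in> B then u t else v t"
  have "cint ?v"
    by (rule cint_spike[OF assms(2,3)]) auto
  then have "integral {0..2*pi} u \<le> integral {0..2*pi} ?v"
    using assms by (intro integral_le) (auto simp: cint_integrable)
  also have "\<dots> = integral {0..2*pi} v"
    by (rule integral_spike[of B]) (use assms in auto)
  finally show ?thesis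
    by (simp add: cavg_def divide_right_mono)
qed

lemma cint_bounded_by:
  assumes "u \<in> borel_measurable borel" "cint v" "finite B" "\<And>t. t \<in> {0..2*pi} - B \<Longrightarrow> \<bar>u t\<bar> \<le> v t"
  shows "cint u"
proof -
  let ?v = "\<lambda>t. if t \<in> B then \<bar>u t\<bar> else v t"
  have "cint ?v"
    by (rule cint_spike[OF assms(2,3)]) auto
  moreover have "u \<in> borel_measurable (lebesgue_on {0..2*pi})"
    using assms(1) by (metis measurable_completion measurable_lborel2 measurable_restrict_space1)
  ultimately show ?thesis
    unfolding cint_def
    by (intro measurable_bounded_by_integrable_imp_absolutely_integrable[where g = ?v])
      (use assms in \<open>auto simp: absolutely_integrable_on_def\<close>)
qed

section \<open>Chords of the half circle and means of negative powers of a distance\<close>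

lemma sin_ge_quarter:
  fixes x :: real
  assumes "0 \<le> x" "x \<le> pi / 2"
  shows "x / 4 \<le> sin x"
proof (cases "x \<le> pi / 6")
  case True
  have "sin 0 - 0 / 4 \<le> sin x - x / 4"
  proof (rule DERIV_nonneg_imp_nondecreasing[OF assms(1), of "\<lambda>x. sin x - x / 4"])
    fix t assume t: "0 \<le> t" "t \<le> x"
    have "cos t \<ge> cos (pi / 3)"
      using t True by (intro cos_monotone_0_pi_le) auto
    then have "cos t - 1 / 4 \<ge> 0"
      by (simp add: cos_60)
    moreover have "((\<lambda>x. sin x - x / 4) has_real_derivative cos t - 1 / 4) (at t)"
      by (auto intro!: derivative_eq_intros)
    ultimately show "\<exists>y. ((\<lambda>x. sin x - x / 4) has_real_derivative y) (at t) \<and> 0 \<le> y"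
      by blast
  qed
  then show ?thesis by simp
next
  case False
  have "sin (pi / 6) \<le> sin x"
    using False assms by (intro sin_monotone_2pi_le) auto
  then have "1 / 2 \<le> sin x"
    by (simp add: sin_30)
  moreover have "x / 4 \<le> 1 / 2"
    using assms pi_less_4 by simp
  ultimately show ?thesis by simp
qed

lemma norm_cis_diff: "norm (cis a - cis b) = 2 * \<bar>sin ((a - b) / 2)\<bar>"
proof -
  have c: "cos (a - b) = 1 - 2 * (sin ((a - b) / 2))\<^sup>2"
    using cos_double_sin[of "(a - b) / 2"] unfolding mult_2 by simp
  have "(norm (cis a - cis b))\<^sup>2 = (cos a - cos b)\<^sup>2 + (sin a - sin b)\<^sup>2"
    by (simp add: cmod_power2)
  also have "\<dots> = ((sin a)\<^sup>2 + (cos a)\<^sup>2) + ((sin b)\<^sup>2 + (cos b)\<^sup>2) - 2 * cos (a - b)"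
    by (simp add: cos_diff power2_eq_square algebra_simps del: sin_cos_squared_add sin_cos_squared_add2)
  also have "\<dots> = 2 - 2 * cos (a - b)"
    by simp
  also have "\<dots> = (2 * \<bar>sin ((a - b) / 2)\<bar>)\<^sup>2"
    unfolding c by (simp add: power_mult_distrib)
  finally show ?thesis
    by (rule power2_eq_imp_eq) auto
qed

text \<open>Halving the angles is essential: the quarter difference lies in
  \<open>[0, pi / 2]\<close>, where the sine is bounded below by a line. On the full circle the
  parameters 0 and \<open>2*pi\<close> give the same point, and no such bound holds.\<close>

lemma norm_cis_half_diff_ge:
  assumes "a \<in> {0..2*pi}" "b \<in> {0..2*pi}"
  shows "\<bar>a - b\<bar> / 8 \<le> norm (cis (a / 2) - cis (b / 2))"
proof -
  define x where "x = \<bar>a - b\<bar> / 4"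
  have "0 \<le> x" "x \<le> pi / 2"
    using assms by (auto simp: x_def)
  then have "x / 4 \<le> sin x"
    by (rule sin_ge_quarter)
  moreover have "sin x \<ge> 0"
    using calculation \<open>0 \<le> x\<close> by linarith
  moreover have "(a / 2 - b / 2) / 2 = x \<or> (a / 2 - b / 2) / 2 = - x"
    by (cases "a \<le> b") (auto simp: x_def field_simps)
  then have "\<bar>sin ((a / 2 - b / 2) / 2)\<bar> = \<bar>sin x\<bar>"
    by (metis abs_minus_cancel sin_minus)
  ultimately show ?thesis
    unfolding norm_cis_diff by (simp add: x_def)
qed

lemma has_integral_abs_powr:
  fixes a c :: real
  assumes "a > -1" "c \<in> {0..d}"
  shows "((\<lambda>t. \<bar>t - c\<bar> powr a) has_integral (c powr (a + 1) + (d - c) powr (a + 1)) / (a + 1)) {0..d}"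
proof -
  have 1: "((\<lambda>x. x powr a) has_integral (c powr (a + 1) / (a + 1))) (cbox 0 c)"
    using has_integral_powr_from_0[of a c] assms by auto
  have "((\<lambda>x. (-1 * x + c) powr a) has_integral (c powr (a + 1) / (a + 1))) {0..c}"
    using has_integral_affinity[OF 1, of "-1" c] assms by (simp add: image_affinity_atLeastAtMost_diff)
  then have A: "((\<lambda>t. \<bar>t - c\<bar> powr a) has_integral (c powr (a + 1) / (a + 1))) {0..c}"
    by (rule has_integral_eq[rotated]) (auto simp: abs_if)
  have 2: "((\<lambda>x. x powr a) has_integral ((d - c) powr (a + 1) / (a + 1))) (cbox 0 (d - c))"
    using has_integral_powr_from_0[of a "d - c"] assms by auto
  have "((\<lambda>x. (1 * x + (- c)) powr a) has_integral ((d - c) powr (a + 1) / (a + 1))) {c..d}"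
    using has_integral_affinity[OF 2, of "1" "-c"] assms by simp
  then have B: "((\<lambda>t. \<bar>t - c\<bar> powr a) has_integral ((d - c) powr (a + 1) / (a + 1))) {c..d}"
    by (rule has_integral_eq[rotated]) (auto simp: abs_if)
  show ?thesis
    using has_integral_combine[OF _ _ A B] assms by (simp add: add_divide_distrib)
qed

text \<open>Replacing \<open>c\<close> by the nearest point of the half circle at most doubles the distance, and on a half
  circle chords are comparable with differences of the argument.\<close>

lemma nearest_on_half_circle:
  fixes c :: complex
  obtains t0 where "t0 \<in> {0..2*pi}"
    "\<And>t. t \<in> {0..2*pi} \<Longrightarrow> \<bar>t - t0\<bar> / 16 \<le> norm (cis (t / 2) - c)"
proof -
  have "continuous_on {0..2*pi} (\<lambda>t. norm (cis (t / 2) - c))"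
    by (intro continuous_intros) auto
  then obtain t0 where t0: "t0 \<in> {0..2*pi}"
      "\<And>t. t \<in> {0..2*pi} \<Longrightarrow> norm (cis (t0 / 2) - c) \<le> norm (cis (t / 2) - c)"
    using continuous_attains_inf[of "{0..2*pi}" "\<lambda>t. norm (cis (t / 2) - c)"] by fastforce
  have "\<bar>t - t0\<bar> / 16 \<le> norm (cis (t / 2) - c)" if t: "t \<in> {0..2*pi}" for t
  proof -
    have "\<bar>t - t0\<bar> / 8 \<le> norm (cis (t / 2) - cis (t0 / 2))"
      using t t0(1) by (rule norm_cis_half_diff_ge)
    also have "\<dots> \<le> norm (cis (t / 2) - c) + norm (cis (t0 / 2) - c)"
      by (metis norm_triangle_ineq4 add_diff_cancel_right' diff_add_cancel diff_diff_eq2)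
    also have "\<dots> \<le> 2 * norm (cis (t / 2) - c)"
      using t0(2)[OF t] by simp
    finally show ?thesis by simp
  qed
  with t0(1) that show ?thesis by blast
qed

text \<open>The point is that \<open>K\<close> depends on \<open>\<alpha>\<close> only, so that one
  constant serves all zeros and poles wherever they lie. It bounds the mean of
  \<open>16 powr \<alpha> * \<bar>t - t0\<bar> powr - \<alpha>\<close>, each side of
  \<open>t0\<close> contributing at most
  \<open>(2 * pi) powr (1 - \<alpha>) / (1 - \<alpha>)\<close> to the integral.\<close>

lemma negpow_half_circle:
  fixes \<alpha> :: real
  assumes "0 < \<alpha>" "\<alpha> < 1"
  obtains K where "K > 0"
    "\<And>c. cint (\<lambda>t. norm (cis (t / 2) - c) powr - \<alpha>)"
    "\<And>c. cavg (\<lambda>t. norm (cis (t / 2) - c) powr - \<alpha>) \<le> K"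
proof -
  define K where "K = 16 powr \<alpha> * (2 * (2 * pi) powr (1 - \<alpha>) / (1 - \<alpha>)) / (2 * pi)"
  have "K > 0"
    using assms by (auto simp: K_def)
  moreover have "cint (\<lambda>t. norm (cis (t / 2) - c) powr - \<alpha>) \<and>
    cavg (\<lambda>t. norm (cis (t / 2) - c) powr - \<alpha>) \<le> K" for c :: complex
  proof -
    obtain t0 where t0: "t0 \<in> {0..2*pi}"
      and le: "\<And>t. t \<in> {0..2*pi} \<Longrightarrow> \<bar>t - t0\<bar> / 16 \<le> norm (cis (t / 2) - c)"
      using nearest_on_half_circle[of c] by blast
    let ?v = "\<lambda>t. 16 powr \<alpha> * \<bar>t - t0\<bar> powr - \<alpha>"
    have hi: "((\<lambda>t. \<bar>t - t0\<bar> powr - \<alpha>) has_integral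
        (t0 powr (- \<alpha> + 1) + (2*pi - t0) powr (- \<alpha> + 1)) / (- \<alpha> + 1)) {0..2*pi}"
      using assms t0 by (intro has_integral_abs_powr) auto
    then have int: "cint (\<lambda>t. \<bar>t - t0\<bar> powr - \<alpha>)"
      unfolding cint_def
      by (intro nonnegative_absolutely_integrable_1) (auto simp: has_integral_integrable)
    then have int': "cint ?v"
      by (rule cint_cmult)
    have pt: "norm (cis (t / 2) - c) powr - \<alpha> \<le> ?v t" if "t \<in> {0..2*pi} - {t0}" for t
    proof -
      have "norm (cis (t / 2) - c) powr - \<alpha> \<le> (\<bar>t - t0\<bar> / 16) powr - \<alpha>"
        using that le[of t] assms by (intro powr_mono2') auto
      also have "\<dots> = ?v t"
        using that by (simp add: powr_divide powr_minus field_simps)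
      finally show ?thesis .
    qed
    have c: "cint (\<lambda>t. norm (cis (t / 2) - c) powr - \<alpha>)"
    proof (rule cint_bounded_by[OF _ int', of _ "{t0}"])
      have "continuous_on UNIV (\<lambda>t. norm (cis (t / 2) - c))"
        by (intro continuous_intros) auto
      then show "(\<lambda>t. norm (cis (t / 2) - c) powr - \<alpha>) \<in> borel_measurable borel"
        by (intro powr_real_measurable borel_measurable_continuous_onI) auto
    qed (use pt in auto)
    have "cavg (\<lambda>t. norm (cis (t / 2) - c) powr - \<alpha>) \<le> cavg ?v"
      by (rule cavg_mono[OF c int', of "{t0}"]) (use pt in auto)
    also have "\<dots> = 16 powr \<alpha> * ((t0 powr (1 - \<alpha>) + (2*pi - t0) powr (1 - \<alpha>)) / (1 - \<alpha>)) / (2 * pi)"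
      using integral_unique[OF hi] by (simp add: cavg_def add.commute)
    also have "\<dots> \<le> K"
    proof -
      have "t0 powr (1 - \<alpha>) \<le> (2*pi) powr (1 - \<alpha>)" "(2*pi - t0) powr (1 - \<alpha>) \<le> (2*pi) powr (1 - \<alpha>)"
        using t0 assms by (auto intro!: powr_mono2)
      then show ?thesis
        unfolding K_def using assms by (intro divide_right_mono mult_left_mono) auto
    qed
    finally show ?thesis using c by blast
  qed
  ultimately show ?thesis using that by blast
qed

section \<open>Cauchy's formula on circles around the origin\<close>

lemma circle_has_integral_iff:
  assumes "R > 0"
  shows "(f has_contour_integral I) (circlepath 0 R) \<longleftrightarrow>
    ((\<lambda>t. f (of_real R * cis t) * of_real R * \<i> * cis t) has_integral I) {0..2*pi}"
  unfolding circlepath_def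
  by (subst has_contour_integral_part_circlepath_iff) (simp_all add: mult_ac)

lemma cint_Re_circle:
  assumes "g holomorphic_on ball 0 R'" "0 < R" "R < R'"
  shows "continuous_on {0..2*pi} (\<lambda>t. g (of_real R * cis t))" "cint (\<lambda>t. Re (g (of_real R * cis t)))"
proof -
  have "continuous_on (ball 0 R') g"
    using assms by (simp add: holomorphic_on_imp_continuous_on)
  then show *: "continuous_on {0..2*pi} (\<lambda>t. g (of_real R * cis t))"
    by (rule continuous_on_compose2) (use assms in \<open>auto intro!: continuous_intros simp: norm_mult\<close>)
  show "cint (\<lambda>t. Re (g (of_real R * cis t)))"
    by (intro cint_continuous continuous_intros *)
qed

lemma cavg_Re_holomorphic:
  assumes "g holomorphic_on ball 0 R'" "0 < R" "R < R'"
  shows "cavg (\<lambda>t. Re (g (of_real R * cis t))) = Re (g 0)"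
proof -
  have "((\<lambda>u. g u / (u - 0)) has_contour_integral 2 * of_real pi * \<i> * g 0) (circlepath 0 R)"
  proof (rule Cauchy_integral_circlepath)
    show "continuous_on (cball 0 R) g" "g holomorphic_on ball 0 R"
      using assms by (auto intro: holomorphic_on_subset holomorphic_on_imp_continuous_on continuous_on_subset)
  qed (use assms in auto)
  then have "((\<lambda>t. g (of_real R * cis t) / (of_real R * cis t - 0) * of_real R * \<i> * cis t)
      has_integral 2 * of_real pi * \<i> * g 0) {0..2*pi}"
    by (subst (asm) circle_has_integral_iff[OF assms(2)])
  then have "((\<lambda>t. \<i> * g (of_real R * cis t)) has_integral 2 * of_real pi * \<i> * g 0) {0..2*pi}"
    by (rule has_integral_eq[rotated]) (use assms in \<open>auto simp: field_simps\<close>)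
  then have "((\<lambda>t. (- \<i>) * (\<i> * g (of_real R * cis t))) has_integral - \<i> * (2 * of_real pi * \<i> * g 0)) {0..2*pi}"
    by (rule has_integral_mult_right)
  moreover have "(- \<i>) * (\<i> * w) = w" "- \<i> * (2 * of_real pi * \<i> * w) = 2 * of_real pi * w" for w
    by (simp_all add: complex_eq_iff)
  ultimately have "((\<lambda>t. g (of_real R * cis t)) has_integral 2 * of_real pi * g 0) {0..2*pi}"
    by (simp only:)
  then have "((\<lambda>t. Re (g (of_real R * cis t))) has_integral Re (2 * of_real pi * g 0)) {0..2*pi}"
    using has_integral_linear[OF _ bounded_linear_Re] by (force simp: o_def)
  then show ?thesis
    by (simp add: cavg_def integral_unique)
qed

text \<open>Differentiated Schwarz integral: on the circle the conjugate of \<open>g\<close> times the Cauchy kernel is the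
  conjugate of a holomorphic form, so Cauchy's formula needs only the real part of \<open>g\<close>.\<close>

lemma deriv_bound_cavg_Re:
  assumes g: "g holomorphic_on ball 0 R'" and R: "0 < R" "R < R'" and z: "norm z < R"
  shows "norm (deriv g z) \<le> 2 * R / (R - norm z)\<^sup>2 * cavg (\<lambda>t. \<bar>Re (g (of_real R * cis t))\<bar>)"
proof -
  let ?\<zeta> = "\<lambda>t. of_real R * cis t"
  have cb: "continuous_on (cball 0 R) g" "g holomorphic_on ball 0 R"
    using assms by (auto intro: holomorphic_on_subset holomorphic_on_imp_continuous_on continuous_on_subset)
  have "(\<lambda>u. g u / (u - z)\<^sup>2) contour_integrable_on (circlepath 0 R)"
    and D: "(g has_field_derivative (1 / (2 * of_real pi * \<i>) *
        contour_integral (circlepath 0 R) (\<lambda>u. g u / (u - z)^2))) (at z)"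
    using Cauchy_derivative_integral_circlepath[OF cb, of z] z by auto
  moreover have "contour_integral (circlepath 0 R) (\<lambda>u. g u / (u - z)^2) = 2 * of_real pi * \<i> * deriv g z"
    using DERIV_imp_deriv[OF D] by simp
  ultimately have "((\<lambda>u. g u / (u - z)\<^sup>2) has_contour_integral 2 * of_real pi * \<i> * deriv g z) (circlepath 0 R)"
    by (metis has_contour_integral_integral)
  then have "((\<lambda>t. g (?\<zeta> t) / (?\<zeta> t - z)\<^sup>2 * of_real R * \<i> * cis t) has_integral 2 * of_real pi * \<i> * deriv g z) {0..2*pi}"
    by (subst (asm) circle_has_integral_iff[OF R(1)])
  from has_integral_mult_right[OF this, of "- \<i>"]
  have 1: "((\<lambda>t. g (?\<zeta> t) * ?\<zeta> t / (?\<zeta> t - z)\<^sup>2) has_integral 2 * of_real pi * deriv g z) {0..2*pi}"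
    by (simp add: mult_ac)
  \<comment> \<open>The reflected kernel has its pole at \<open>R\<^sup>2 / cnj z\<close>, outside
    the closed disc; \<open>R''\<close> is a radius beyond \<open>R\<close> that avoids it and stays
    in the domain of \<open>g\<close>.\<close>
  define R'' where "R'' = (if z = 0 then R' else min R' (R\<^sup>2 / norm z))"
  have R'': "R < R''" "R'' \<le> R'"
    using R z by (auto simp: R''_def field_simps power2_eq_square)
  have nz: "of_real (R\<^sup>2) - cnj z * u \<noteq> 0" if "u \<in> ball 0 R''" for u
  proof
    assume "of_real (R\<^sup>2) - cnj z * u = 0"
    then have eq: "of_real (R\<^sup>2) = cnj z * u"
      by simp
    then have "z \<noteq> 0"
      using R by auto
    have "R\<^sup>2 = norm z * norm u"
      using arg_cong[OF eq, of norm] R by (simp add: norm_mult del: of_real_power)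
    moreover have "norm u < R\<^sup>2 / norm z"
      using that \<open>z \<noteq> 0\<close> by (simp add: R''_def)
    ultimately show False
      using \<open>z \<noteq> 0\<close> by (simp add: field_simps)
  qed
  have "((\<lambda>u. g u * (of_real (R\<^sup>2) / (of_real (R\<^sup>2) - cnj z * u)\<^sup>2)) has_contour_integral 0) (circlepath 0 R)"
  proof (rule Cauchy_theorem_disc_simple)
    show "(\<lambda>u. g u * (of_real (R\<^sup>2) / (of_real (R\<^sup>2) - cnj z * u)\<^sup>2)) holomorphic_on ball 0 R''"
      using nz R'' by (intro holomorphic_intros holomorphic_on_subset[OF g]) auto
    show "path_image (circlepath 0 R) \<subseteq> ball 0 R''"
      using R R'' by (auto simp: path_image_circlepath)
  qed auto
  then have "((\<lambda>t. g (?\<zeta> t) * (of_real (R\<^sup>2) / (of_real (R\<^sup>2) - cnj z * ?\<zeta> t)\<^sup>2) * of_real R * \<i> * cis t) has_integral 0) {0..2*pi}"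
    by (subst (asm) circle_has_integral_iff[OF R(1)])
  from has_integral_mult_right[OF this, of "- \<i>"]
  have "((\<lambda>t. g (?\<zeta> t) * (of_real (R\<^sup>2) * ?\<zeta> t / (of_real (R\<^sup>2) - cnj z * ?\<zeta> t)\<^sup>2)) has_integral 0) {0..2*pi}"
    by (simp add: mult_ac)
  then have "((\<lambda>t. cnj (g (?\<zeta> t) * (of_real (R\<^sup>2) * ?\<zeta> t / (of_real (R\<^sup>2) - cnj z * ?\<zeta> t)\<^sup>2))) has_integral cnj 0) {0..2*pi}"
    by (subst (asm) has_integral_cnj[symmetric]) (simp add: o_def)
  \<comment> \<open>On the circle the conjugate of \<zeta> equals
    \<open>R\<^sup>2 / \<zeta>\<close>, which turns the conjugated kernel back into Cauchy's
    kernel.\<close>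
  moreover have "cnj (of_real (R\<^sup>2) * ?\<zeta> t / (of_real (R\<^sup>2) - cnj z * ?\<zeta> t)\<^sup>2) = ?\<zeta> t / (?\<zeta> t - z)\<^sup>2" for t
  proof -
    have c: "cis t * cis (- t) = 1"
      by (simp add: cis_mult)
    define w where "w = of_real R * cis (- t)"
    have w: "w \<noteq> 0" "of_real (R\<^sup>2) = w * ?\<zeta> t"
      using R c by (auto simp: w_def power2_eq_square mult_ac)
    have "cnj (of_real (R\<^sup>2) * ?\<zeta> t / (of_real (R\<^sup>2) - cnj z * ?\<zeta> t)\<^sup>2) =
        of_real (R\<^sup>2) * w / (of_real (R\<^sup>2) - z * w)\<^sup>2"
      by (simp add: w_def cis_cnj)
    also have "\<dots> = (w\<^sup>2 * ?\<zeta> t) / (w\<^sup>2 * (?\<zeta> t - z)\<^sup>2)"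
      unfolding w(2) by (simp add: algebra_simps power2_eq_square)
    finally show ?thesis
      using w(1) by simp
  qed
  ultimately have 2: "((\<lambda>t. cnj (g (?\<zeta> t)) * (?\<zeta> t / (?\<zeta> t - z)\<^sup>2)) has_integral 0) {0..2*pi}"
    by (simp only: complex_cnj_mult complex_cnj_zero)
  \<comment> \<open>Adding the vanishing integral of the conjugate of \<open>g\<close> against the
    same kernel replaces \<open>g\<close> by \<open>2 * Re g\<close>.\<close>
  have eq: "x * a / b + cnj x * (a / b) = of_real (2 * Re x) * (a / b)" for x a b :: complex
    by (metis complex_add_cnj distrib_right times_divide_eq_right)
  have I: "((\<lambda>t. of_real (2 * Re (g (?\<zeta> t))) * (?\<zeta> t / (?\<zeta> t - z)\<^sup>2)) has_integral 2 * of_real pi * deriv g z) {0..2*pi}"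
    using has_integral_add[OF 1 2] unfolding eq by simp
  have ub: "norm (of_real (2 * Re (g (?\<zeta> t))) * (?\<zeta> t / (?\<zeta> t - z)\<^sup>2)) \<le>
      2 * R / (R - norm z)\<^sup>2 * \<bar>Re (g (?\<zeta> t))\<bar>" for t
  proof -
    have "R - norm z \<le> norm (?\<zeta> t - z)"
      using norm_triangle_ineq2[of "?\<zeta> t" z] R by (simp add: norm_mult)
    then have "(R - norm z)\<^sup>2 \<le> (norm (?\<zeta> t - z))\<^sup>2"
      using z by (intro power_mono) auto
    then have "2 * \<bar>Re (g (?\<zeta> t))\<bar> * (R / (norm (?\<zeta> t - z))\<^sup>2) \<le> 2 * \<bar>Re (g (?\<zeta> t))\<bar> * (R / (R - norm z)\<^sup>2)"
      using z R by (intro mult_left_mono divide_left_mono mult_pos_pos) (auto simp: zero_less_power2)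
    then show ?thesis
      using R by (simp add: norm_mult norm_divide norm_power mult_ac)
  qed
  have c: "cint (\<lambda>t. 2 * R / (R - norm z)\<^sup>2 * \<bar>Re (g (?\<zeta> t))\<bar>)"
    by (intro cint_cmult cint_abs cint_Re_circle[OF g R])
  have "2 * pi * norm (deriv g z) = norm (integral {0..2*pi} (\<lambda>t. of_real (2 * Re (g (?\<zeta> t))) * (?\<zeta> t / (?\<zeta> t - z)\<^sup>2)))"
    using integral_unique[OF I] by (simp add: norm_mult)
  also have "\<dots> \<le> integral {0..2*pi} (\<lambda>t. 2 * R / (R - norm z)\<^sup>2 * \<bar>Re (g (?\<zeta> t))\<bar>)"
    by (rule integral_norm_bound_integral) (use I ub cint_integrable[OF c] in \<open>auto simp: has_integral_integrable\<close>)
  also have "\<dots> = 2 * pi * (2 * R / (R - norm z)\<^sup>2 * cavg (\<lambda>t. \<bar>Re (g (?\<zeta> t))\<bar>))"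
    unfolding cavg_cmult[symmetric] by (simp add: cavg_def)
  finally show ?thesis
    by (rule mult_left_le_imp_le) simp
qed

section \<open>Finite exceptional sets and the mean of the logarithm of a distance\<close>

lemma finite_circle_vimage:
  assumes "r > 0" "finite B"
  shows "finite {t \<in> {0..2*pi}. of_real r * cis t \<in> B}"
proof -
  have "inj_on (\<lambda>t. of_real r * cis t) {0..<2*pi}"
  proof (rule inj_onI)
    fix a b :: real assume ab: "a \<in> {0..<2*pi}" "b \<in> {0..<2*pi}" "of_real r * cis a = of_real r * cis b"
    then have "sin a = sin b \<and> cos a = cos b"
      using assms by (auto simp: complex_eq_iff)
    then obtain n :: int where n: "a = b + 2 * pi * n"
      using sin_cos_eq_iff by blast
    then have "2*pi * real_of_int n < 2*pi * 1" "2*pi * (-1) < 2*pi * real_of_int n"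
      using ab(1,2) by (simp only: atLeastLessThan_iff, linarith)+
    moreover have p: "2*pi > 0"
      by simp
    ultimately have "real_of_int n < 1" "-1 < real_of_int n"
      using mult_less_cancel_left_pos[OF p] by blast+
    then have "n = 0" by simp
    with n show "a = b" by simp
  qed
  then have "finite ((\<lambda>t. of_real r * cis t) -` B \<inter> {0..<2*pi})"
    by (intro finite_vimage_IntI assms)
  \<comment> \<open>The parametrization is injective only on the half-open interval, so the endpoint
    is added by hand.\<close>
  then have "finite (insert (2*pi) ((\<lambda>t. of_real r * cis t) -` B \<inter> {0..<2*pi}))"
    by simp
  then show ?thesis
    by (rule rev_finite_subset) auto
qed

text \<open>Factoring a difference of squares carries distances on the full circle over to the half
  circle, where \<open>negpow_half_circle\<close> applies.\<close>

lemma csqrt_cis_dist: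
  "norm (cis t - c) = norm (cis (t / 2) - csqrt c) * norm (cis (t / 2) - (- csqrt c))"
proof -
  have "cis t = (cis (t / 2))\<^sup>2" "c = (csqrt c)\<^sup>2"
    by (simp add: power2_eq_square cis_mult) simp
  then show ?thesis
    by (metis diff_minus_eq_add mult.commute norm_mult square_diff_square_factored power2_eq_square)
qed

text \<open>The exponent 1/4 is chosen for the factorization \<open>csqrt_cis_dist\<close>: the
  quarter power of a product of two distances is at most the sum of their half powers, and exponent
  1/2 is integrable. At 0 both sides vanish, as \<open>ln 0 = 0\<close> and
  \<open>0 powr a = 0\<close>.\<close>

lemma abs_ln_le: "x \<ge> 0 \<Longrightarrow> \<bar>ln x\<bar> \<le> x + 4 * x powr (- (1 / 4))" for x :: real
proof (cases "x = 0")
  case False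
  assume "x \<ge> 0"
  with False have x: "x > 0" by simp
  have "ln x \<le> x"
    using ln_bound x by blast
  moreover have "ln (x powr (- (1 / 4))) \<le> x powr (- (1 / 4))"
    using x by (intro ln_bound) auto
  then have "- ln x \<le> 4 * x powr (- (1 / 4))"
    using x by (simp add: ln_powr)
  moreover have "0 \<le> x powr (- (1 / 4))" by simp
  ultimately show ?thesis using x unfolding abs_le_iff by linarith
qed auto

lemma cint_quarter_power: "cint (\<lambda>t. norm (cis t - c) powr (- (1 / 4)))"
proof -
  obtain K where K: "\<And>c. cint (\<lambda>t. norm (cis (t / 2) - c) powr - (1/2))"
    by (rule negpow_half_circle[of "1/2"]) auto
  have c: "continuous_on UNIV (\<lambda>t. norm (cis t - c))"
    by (intro continuous_intros)
  show ?thesis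
  proof (rule cint_bounded_by[where B = "{}"])
    show "cint (\<lambda>t. norm (cis (t / 2) - csqrt c) powr - (1/2) + norm (cis (t / 2) - (- csqrt c)) powr - (1/2))"
      by (intro cint_add K)
    show "(\<lambda>t. norm (cis t - c) powr (- (1 / 4))) \<in> borel_measurable borel"
      using c by (intro powr_real_measurable borel_measurable_continuous_onI) auto
    have "(a * b) powr (- (1 / 4)) \<le> a powr (- (1/2)) + b powr (- (1/2))" if "a \<ge> 0" "b \<ge> 0" for a b :: real
    proof -
      have sq: "x powr (- (1/2)) = (x powr (- (1/4)))\<^sup>2" for x :: real
        by (simp add: power2_eq_square flip: powr_add)
      have "2 * (a powr (- (1/4)) * b powr (- (1/4))) \<le> (a powr (- (1/4)))\<^sup>2 + (b powr (- (1/4)))\<^sup>2"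
        using sum_squares_bound[of "a powr (- (1/4))" "b powr (- (1/4))"] by (simp add: mult.assoc)
      moreover have "0 \<le> a powr (- (1/4)) * b powr (- (1/4))" by simp
      ultimately have "a powr (- (1/4)) * b powr (- (1/4)) \<le> a powr (- (1/2)) + b powr (- (1/2))"
        unfolding sq by linarith
      then show ?thesis
        using that by (simp add: powr_mult)
    qed
    then show "\<bar>norm (cis t - c) powr (- (1 / 4))\<bar> \<le>
        norm (cis (t / 2) - csqrt c) powr - (1/2) + norm (cis (t / 2) - (- csqrt c)) powr - (1/2)" for t
      unfolding csqrt_cis_dist[of t c] by simp
  qed auto
qed

lemma cint_ln_circle: "cint (\<lambda>t. ln (norm (cis t - c)))"
proof (rule cint_bounded_by[where B = "{}"])
  show "cint (\<lambda>t. (1 + norm c) + 4 * norm (cis t - c) powr (- (1 / 4)))"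
    by (intro cint_add cint_cmult cint_quarter_power cint_const)
  have c: "continuous_on UNIV (\<lambda>t. norm (cis t - c))"
    by (intro continuous_intros)
  then show "(\<lambda>t. ln (norm (cis t - c))) \<in> borel_measurable borel"
    by (intro borel_measurable_ln borel_measurable_continuous_onI)
  show "\<bar>ln (norm (cis t - c))\<bar> \<le> (1 + norm c) + 4 * norm (cis t - c) powr (- (1 / 4))" for t
    using abs_ln_le[of "norm (cis t - c)"] norm_triangle_ineq4[of "cis t" c] by auto
qed auto

text \<open>On the unit circle \<open>norm (cis t - c) = norm (1 - cnj c * cis t)\<close>. The
  right-hand side is the modulus of a function with value 1 at 0 and positive real part on a larger
  disc, so the mean value property applies to its principal logarithm.\<close>

lemma cavg_ln_circle_inside:
  assumes "norm c < 1"
  shows "cavg (\<lambda>t. ln (norm (cis t - c))) = 0"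
proof -
  define R' where "R' = (if c = 0 then 2 else 1 / norm c)"
  have R': "1 < R'"
    using assms by (auto simp: R'_def field_simps)
  have small: "norm (cnj c * u) < 1" if "u \<in> ball 0 R'" for u :: complex
    using that by (auto simp: R'_def norm_mult field_simps split: if_splits)
  have "(\<lambda>u. Ln (1 - cnj c * u)) holomorphic_on ball 0 R'"
  proof (intro holomorphic_intros)
    fix u :: complex assume "u \<in> ball 0 R'"
    then have "\<bar>Re (cnj c * u)\<bar> < 1"
      using small abs_Re_le_cmod order_le_less_trans by blast
    then show "1 - cnj c * u \<notin> \<real>\<^sub>\<le>\<^sub>0"
      by (auto simp: complex_nonpos_Reals_iff)
  qed
  from cavg_Re_holomorphic[OF this, of 1] R'
  have "cavg (\<lambda>t. Re (Ln (1 - cnj c * cis t))) = 0"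
    by simp
  moreover have "Re (Ln (1 - cnj c * cis t)) = ln (norm (cis t - c))" for t
  proof -
    have "1 - cnj c * cis t \<noteq> 0"
      using small[of "cis t"] R' by (metis dist_0_norm eq_iff_diff_eq_0 mem_ball norm_cis norm_one order_less_irrefl)
    moreover have "norm (1 - cnj c * cis t) = norm (cis t - c)"
    proof -
      have "norm (1 - cnj c * cis t) = norm (cnj (1 - cnj c * cis t))"
        by (simp only: complex_mod_cnj)
      also have "cnj (1 - cnj c * cis t) = cis (- t) * (cis t - c)"
        by (simp add: algebra_simps cis_mult cis_cnj)
      finally show ?thesis by (simp add: norm_mult)
    qed
    ultimately show ?thesis
      by (simp add: Re_Ln)
  qed
  ultimately show ?thesis by simp
qed

text \<open>The boundary case \<open>norm c = 1\<close>, needed for zeros and poles on the circle of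
  integration, follows by pulling \<open>c\<close> inwards to \<open>\<rho> k * c\<close> and
  dominated convergence.\<close>

lemma cavg_ln_circle:
  assumes "norm c \<le> 1"
  shows "cavg (\<lambda>t. ln (norm (cis t - c))) = 0"
proof -
  define B where "B = {t \<in> {0..2*pi}. of_real 1 * cis t \<in> {c}}"
  have B: "finite B" unfolding B_def by (intro finite_circle_vimage) auto
  define \<rho> where "\<rho> k = 1 - 1 / real (k + 2)" for k
  have \<rho>: "0 \<le> \<rho> k" "\<rho> k < 1" for k by (auto simp: \<rho>_def)
  have \<rho>_lim: "\<rho> \<longlonglongrightarrow> 1"
    unfolding \<rho>_def by real_asymp
  \<comment> \<open>Where \<open>cis t = c\<close>, the values \<open>ln (1 - \<rho> k)\<close> tend
    to minus infinity, so these parameters are taken out.\<close>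
  let ?u = "\<lambda>k t. if t \<in> B then 0 else ln (norm (cis t - of_real (\<rho> k) * c))"
  let ?v = "\<lambda>t. if t \<in> B then 0 else ln (norm (cis t - c))"
  let ?h = "\<lambda>t. if t \<in> B then 0 else 2 + 4 * 2 powr (1/4) * norm (cis t - c) powr (- (1 / 4))"
  have h: "cint ?h"
    by (rule cint_spike[OF _ B, of "\<lambda>t. 2 + 4 * 2 powr (1/4) * norm (cis t - c) powr (- (1 / 4))"])
      (auto intro!: cint_add cint_cmult cint_quarter_power)
  have u: "cint (?u k)" for k
    by (rule cint_spike[OF cint_ln_circle[of "of_real (\<rho> k) * c"] B]) auto
  have "(\<lambda>k. integral {0..2*pi} (?u k)) \<longlonglongrightarrow> integral {0..2*pi} ?v"
  proof (rule dominated_convergence(2))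
    show "?u k integrable_on {0..2*pi}" for k
      using u by (rule cint_integrable)
    show "?h integrable_on {0..2*pi}"
      using h by (rule cint_integrable)
    show "norm (?u k t) \<le> ?h t" if "t \<in> {0..2*pi}" for k t
    proof (cases "t \<in> B")
      case False
      then have ne: "cis t \<noteq> c" using that by (auto simp: B_def)
      \<comment> \<open>The displacement \<open>(1 - \<rho> k) * norm c\<close> is at most
        \<open>1 - \<rho> k * norm c\<close>, which is itself a lower bound for the distance from
        \<open>cis t\<close> to \<open>\<rho> k * c\<close>. Hence that distance is at least half of
        the limiting one, uniformly in \<open>k\<close>, and a majorant results.\<close>
      have "norm (cis t - c) \<le> norm (cis t - of_real (\<rho> k) * c) + norm (of_real (\<rho> k) * c - c)"
        using norm_triangle_ineq[of "cis t - of_real (\<rho> k) * c" "of_real (\<rho> k) * c - c"] by simp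
      also have "norm (of_real (\<rho> k) * c - c) = (1 - \<rho> k) * norm c"
      proof -
        have "of_real (\<rho> k) * c - c = of_real (\<rho> k - 1) * c"
          by (simp add: algebra_simps)
        then show ?thesis
          using \<rho>[of k] by (simp only: norm_mult norm_of_real) simp
      qed
      also have "\<dots> \<le> 1 - \<rho> k * norm c"
        using assms by (simp add: algebra_simps)
      also have "\<dots> \<le> norm (cis t - of_real (\<rho> k) * c)"
        using norm_triangle_ineq2[of "cis t" "of_real (\<rho> k) * c"] \<rho>[of k] by (simp add: norm_mult)
      finally have le: "norm (cis t - c) / 2 \<le> norm (cis t - of_real (\<rho> k) * c)" by simp
      have "\<bar>ln (norm (cis t - of_real (\<rho> k) * c))\<bar> \<le> norm (cis t - of_real (\<rho> k) * c)
          + 4 * norm (cis t - of_real (\<rho> k) * c) powr (- (1 / 4))"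
        by (rule abs_ln_le) simp
      moreover have "norm (cis t - of_real (\<rho> k) * c) \<le> 1 + 1"
        using norm_triangle_ineq4[of "cis t" "of_real (\<rho> k) * c"] \<rho>[of k] assms mult_le_one[of "\<rho> k" "norm c"]
        by (simp add: norm_mult)
      moreover have "norm (cis t - of_real (\<rho> k) * c) powr (- (1 / 4)) \<le> (norm (cis t - c) / 2) powr (- (1 / 4))"
        using le ne by (intro powr_mono2') auto
      moreover have "(norm (cis t - c) / 2) powr (- (1 / 4)) = 2 powr (1/4) * norm (cis t - c) powr (- (1 / 4))"
        by (simp add: powr_divide powr_minus field_simps)
      ultimately show ?thesis using False by simp
    qed auto
    show "(\<lambda>k. ?u k t) \<longlonglongrightarrow> ?v t" if "t \<in> {0..2*pi}" for t
    proof (cases "t \<in> B")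
      case False
      then have ne: "cis t \<noteq> c" using that by (auto simp: B_def)
      have "(\<lambda>k. ln (norm (cis t - of_real (\<rho> k) * c))) \<longlonglongrightarrow> ln (norm (cis t - of_real 1 * c))"
        using ne by (intro tendsto_intros \<rho>_lim) auto
      then show ?thesis using False by simp
    qed auto
  qed
  moreover have "integral {0..2*pi} (?u k) = 0" for k
  proof -
    have "cavg (?u k) = cavg (\<lambda>t. ln (norm (cis t - of_real (\<rho> k) * c)))"
      by (rule cavg_spike[OF B]) auto
    also have "\<dots> = 0"
    proof (rule cavg_ln_circle_inside)
      have "\<rho> k * norm c \<le> \<rho> k"
        using assms \<rho>[of k] by (simp add: mult_left_le)
      then show "norm (of_real (\<rho> k) * c) < 1"
        using \<rho>[of k] by (simp add: norm_mult)
    qed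
    finally show ?thesis by (simp add: cavg_def)
  qed
  ultimately have "integral {0..2*pi} ?v = 0"
    using LIMSEQ_unique[OF _ tendsto_const] by auto
  then have "cavg ?v = 0" by (simp add: cavg_def)
  moreover have "cavg ?v = cavg (\<lambda>t. ln (norm (cis t - c)))"
    by (rule cavg_spike[OF B]) auto
  ultimately show ?thesis by simp
qed

subsection \<open>Factorization on discs and Jensen's formula\<close>

text \<open>The condition is stated on punctured neighbourhoods because the values on a sparse set
  are arbitrary. It says that \<open>h\<close> is a nonzero element of the field of meromorphic
  functions, the setting in which \<open>zorder\<close> behaves additively.\<close>

definition nzmero :: "(complex \<Rightarrow> complex) \<Rightarrow> bool" where
  "nzmero h \<longleftrightarrow> h meromorphic_on UNIV \<and> (\<forall>z. eventually (\<lambda>w. h w \<noteq> 0) (at z))"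

lemma nzmero_at:
  assumes "nzmero h"
  shows "h meromorphic_on {z}" "isolated_singularity_at h z" "not_essential h z"
    "eventually (\<lambda>w. h w \<noteq> 0) (at z)" "frequently (\<lambda>w. h w \<noteq> 0) (at z)"
proof -
  show *: "h meromorphic_on {z}" "eventually (\<lambda>w. h w \<noteq> 0) (at z)"
    using assms by (auto simp: nzmero_def intro: meromorphic_on_subset)
  then show "isolated_singularity_at h z" "not_essential h z" "frequently (\<lambda>w. h w \<noteq> 0) (at z)"
    by (simp_all add: meromorphic_at_iff eventually_frequently)
qed

text \<open>The identity theorem: nonvanishing near one point spreads over the connected
  plane.\<close>

lemma nzmeroI:
  assumes "h meromorphic_on UNIV" "frequently (\<lambda>w. h w \<noteq> 0) (at z)"
  shows "nzmero h"
proof -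
  have "\<not> eventually (\<lambda>w. h w = 0) (cosparse UNIV)"
    using assms(2) by (auto simp: eventually_cosparse_open_eq frequently_def)
  then have "eventually (\<lambda>w. h w \<noteq> 0) (cosparse UNIV)"
    using meromorphic_imp_constant_or_avoid[OF assms(1), of 0] by auto
  then show ?thesis
    using assms(1) by (auto simp: nzmero_def eventually_cosparse_open_eq)
qed

lemma nzmero_divide:
  assumes "nzmero f" "nzmero g"
  shows "nzmero (\<lambda>x. f x / g x)"
proof -
  have "eventually (\<lambda>x. f x / g x \<noteq> 0) (at z)" for z
    using nzmero_at(4)[OF assms(1), of z] nzmero_at(4)[OF assms(2), of z] by eventually_elim simp
  then show ?thesis
    using assms by (auto simp: nzmero_def intro!: meromorphic_intros)
qed

lemma finite_cball_cosparse:
  fixes P :: "complex \<Rightarrow> bool"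
  assumes "\<And>z. eventually P (at z)"
  shows "finite {z \<in> cball c R. \<not> P z}"
proof -
  have "eventually P (cosparse UNIV)"
    using assms by (simp add: eventually_cosparse_open_eq)
  then have "{z. \<not> P z} sparse_in cball c R"
    unfolding eventually_cosparse using sparse_in_subset by blast
  then have "finite (cball c R \<inter> {z. \<not> P z})"
    by (rule sparse_in_compact_finite) auto
  then show ?thesis
    by (rule rev_finite_subset) auto
qed

lemma meromorphic_eventually_analytic:
  assumes "h meromorphic_on UNIV"
  shows "eventually (\<lambda>w. h analytic_on {w}) (at z)"
  using meromorphic_on_imp_analytic_cosparse[OF assms] by (simp add: eventually_cosparse_open_eq)

lemma nzmero_eventually_regular:
  assumes "nzmero h"
  shows "eventually (\<lambda>w. h analytic_on {w} \<and> h w \<noteq> 0) (at z)"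
  using assms meromorphic_eventually_analytic by (auto simp: nzmero_def eventually_conj_iff)

lemma nzmero_eventually_zorder_0:
  assumes "nzmero h"
  shows "eventually (\<lambda>w. zorder h w = 0) (at z)"
  using nzmero_eventually_regular[OF assms] by eventually_elim (auto intro: zorder_eq_0I)

definition zeropoles :: "(complex \<Rightarrow> complex) \<Rightarrow> real \<Rightarrow> complex set" where
  "zeropoles h R = {a \<in> cball 0 R. zorder h a \<noteq> 0}"

lemma finite_zeropoles: "nzmero h \<Longrightarrow> finite (zeropoles h R)"
  unfolding zeropoles_def by (intro finite_cball_cosparse nzmero_eventually_zorder_0)

text \<open>Dividing by \<open>R\<close> normalizes each linear factor so that the mean of its
  logarithmic modulus over the circle of radius \<open>R\<close> is 0. Unlike Blaschke factors,
  these factors also accommodate zeros and poles on that circle.\<close>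

definition disc_prod :: "(complex \<Rightarrow> complex) \<Rightarrow> real \<Rightarrow> complex \<Rightarrow> complex" where
  "disc_prod h R x = (\<Prod>a\<in>zeropoles h R. ((x - a) / of_real R) powi zorder h a)"

lemma disc_prod_mero:
  assumes "nzmero h" "R > 0"
  shows "nzmero (disc_prod h R)"
    "x \<in> cball 0 R \<Longrightarrow> zorder (disc_prod h R) x = zorder h x"
proof -
  let ?S = "zeropoles h R"
  have nz: "eventually (\<lambda>w. disc_prod h R w \<noteq> 0) (at z)" for z
  proof -
    have "eventually (\<lambda>w. w \<notin> ?S) (at z)"
      using islimpt_finite[OF finite_zeropoles[OF assms(1)]] by (simp add: islimpt_iff_eventually)
    then show ?thesis
      by eventually_elim (use assms finite_zeropoles[OF assms(1)] in \<open>auto simp: disc_prod_def power_int_eq_0_iff\<close>)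
  qed
  have m: "disc_prod h R meromorphic_on UNIV"
    unfolding disc_prod_def by (intro meromorphic_intros)
  with nz show nzm: "nzmero (disc_prod h R)"
    by (simp add: nzmero_def)
  assume x: "x \<in> cball 0 R"
  have ord: "zorder (\<lambda>x. ((x - a) / of_real R) powi zorder h a) x = (if a = x then zorder h a else 0)" for a
  proof -
    have "zorder (\<lambda>x. ((x - a) / of_real R) powi zorder h a) x =
        zorder h a * zorder (\<lambda>x. (x - a) / of_real R) x"
    proof (rule zorder_power_int)
      show "(\<lambda>x. (x - a) / of_real R) meromorphic_on {x}"
        by (intro meromorphic_intros)
      have "eventually (\<lambda>w. w \<noteq> a) (at x)"
        by (rule eventually_neq_at_within)
      then have "eventually (\<lambda>w. (w - a) / of_real R \<noteq> 0) (at x)"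
        by eventually_elim (use assms in auto)
      then show "frequently (\<lambda>w. (w - a) / of_real R \<noteq> 0) (at x)"
        by (rule eventually_frequently[OF at_neq_bot])
    qed
    also have "zorder (\<lambda>x. (x - a) / of_real R) x = (if a = x then 1 else 0)"
    proof (cases "a = x")
      case True
      have "zorder (\<lambda>x. (x - a) / of_real R) x = 1"
        by (rule zorder_eqI[of UNIV _ "\<lambda>_. 1 / of_real R"]) (use assms True in auto)
      with True show ?thesis by simp
    next
      case False
      have "zorder (\<lambda>x. (x - a) / of_real R) x = 0"
        by (rule zorder_eq_0I) (use assms False in \<open>auto intro!: analytic_intros\<close>)
      with False show ?thesis by simp
    qed
    finally show ?thesis by simp
  qed
  have "zorder (disc_prod h R) x = (\<Sum>a\<in>?S. zorder (\<lambda>x. ((x - a) / of_real R) powi zorder h a) x)"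
    unfolding disc_prod_def
  proof (rule zorder_prod)
    show "eventually (\<lambda>z. (\<Prod>a\<in>?S. ((z - a) / of_real R) powi zorder h a) \<noteq> 0) (at x)"
      using nz[of x] unfolding disc_prod_def .
  qed (intro meromorphic_intros)
  also have "\<dots> = zorder h x"
    unfolding ord using finite_zeropoles[OF assms(1)] x by (simp add: sum.delta zeropoles_def)
  finally show "zorder (disc_prod h R) x = zorder h x" .
qed

text \<open>After division by \<open>disc_prod\<close> all orders on the closed disc are 0, so the
  quotient, with removable singularities filled, is analytic and zero-free there. Compactness
  extends this to a slightly larger disc, on which a holomorphic logarithm \<open>g\<close> exists.
  The enlarged radius permits Cauchy's formula on the circle of radius \<open>R\<close>;
  \<open>B\<close> contains the points where the prescribed values of \<open>h\<close> may
  differ.\<close>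

lemma disc_factorization:
  assumes h: "nzmero h" and R: "R > 0"
  obtains g R' B where "R < R'" "g holomorphic_on ball 0 R'" "finite B" "zeropoles h R \<subseteq> B"
    "\<And>x. x \<in> cball 0 R - B \<Longrightarrow> h x = disc_prod h R x * exp (g x)"
proof -
  let ?Q = "disc_prod h R"
  define k where "k = remove_sings (\<lambda>x. h x / ?Q x)"
  note Q = disc_prod_mero[OF h R]
  have hQ: "nzmero (\<lambda>x. h x / ?Q x)"
    by (rule nzmero_divide[OF h Q(1)])
  have reg: "k analytic_on {x} \<and> k x \<noteq> 0" if x: "x \<in> cball 0 R" for x
  proof -
    have z0: "zorder (\<lambda>x. h x / ?Q x) x = 0"
      using zorder_divide[OF nzmero_at(1,5)[OF h] nzmero_at(1,5)[OF Q(1)], of x] Q(2)[OF x] by simp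
    then have "\<not> is_pole (\<lambda>x. h x / ?Q x) x"
      using isolated_pole_imp_neg_zorder[OF nzmero_at(2)[OF hQ]] by force
    then obtain c where "(\<lambda>x. h x / ?Q x) \<midarrow>x\<rightarrow> c"
      using nzmero_at(3)[OF hQ, of x] by (auto simp: not_essential_def)
    then have a: "k analytic_on {x}"
      unfolding k_def using remove_sings_analytic_at nzmero_at(2)[OF hQ] by blast
    have ev: "eventually (\<lambda>w. k w = h w / ?Q w) (at x)"
      unfolding k_def by (rule eventually_remove_sings_eq_at[OF nzmero_at(2)[OF hQ]])
    then have "eventually (\<lambda>w. k w \<noteq> 0) (at x)"
      using nzmero_at(4)[OF hQ, of x] by eventually_elim simp
    then have "frequently (\<lambda>w. k w \<noteq> 0) (at x)"
      by (simp add: eventually_frequently)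
    moreover have "zorder k x = 0"
      using z0 zorder_cong[OF ev refl] by simp
    ultimately show ?thesis
      using zorder_eq_0_iff[OF a] a by blast
  qed
  define U where "U = {x. k analytic_on {x} \<and> k x \<noteq> 0}"
  have "open U"
  proof -
    have "open {x. k analytic_on {x}}"
      unfolding open_subopen[of "{x. k analytic_on {x}}"]
    proof
      fix x assume "x \<in> {x. k analytic_on {x}}"
      then obtain s where "open s" "x \<in> s" "k holomorphic_on s"
        by (auto simp: analytic_at)
      then show "\<exists>T. open T \<and> x \<in> T \<and> T \<subseteq> {x. k analytic_on {x}}"
        by (auto simp: analytic_at)
    qed
    moreover have "continuous_on {x. k analytic_on {x}} k"
      by (meson analytic_at_imp_isCont continuous_at_imp_continuous_on mem_Collect_eq)
    ultimately have "open ({x. k analytic_on {x}} \<inter> k -` (- {0}))"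
      by (intro continuous_open_preimage) auto
    also have "{x. k analytic_on {x}} \<inter> k -` (- {0}) = U"
      by (auto simp: U_def)
    finally show ?thesis .
  qed
  moreover have "cball 0 R \<subseteq> U"
    using reg by (auto simp: U_def)
  ultimately obtain e where e: "e > 0" "(\<Union>x\<in>cball 0 R. ball x e) \<subseteq> U"
    using compact_subset_open_imp_ball_epsilon_subset[of "cball 0 R" U] by auto
  have sub: "ball 0 (R + e) \<subseteq> U"
  proof
    fix x :: complex assume x: "x \<in> ball 0 (R + e)"
    \<comment> \<open>The radial projection of \<open>x\<close> onto the closed disc, whose distance
      from \<open>x\<close> is less than \<open>e\<close>.\<close>
    define y where "y = (if norm x \<le> R then x else of_real (R / norm x) * x)"
    have "y \<in> cball 0 R" "dist y x < e"
    proof -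
      show "y \<in> cball 0 R"
        using R by (auto simp: y_def norm_mult norm_divide)
      have "dist y x = norm x - R" if "\<not> norm x \<le> R"
      proof -
        have "x \<noteq> 0" using that R by auto
        have "dist y x = norm (of_real (R / norm x - 1) * x)"
          using that by (simp add: y_def dist_norm algebra_simps)
        also have "\<dots> = \<bar>R / norm x - 1\<bar> * norm x"
          by (simp only: norm_mult norm_of_real)
        also have "\<dots> = norm x - R"
          using that R \<open>x \<noteq> 0\<close> by (simp add: abs_if field_simps)
        finally show ?thesis .
      qed
      then show "dist y x < e"
        using x e by (cases "norm x \<le> R") (auto simp: y_def)
    qed
    then show "x \<in> U" using e(2) by (meson UN_I mem_ball subsetD)
  qed
  have "k holomorphic_on ball 0 (R + e)"
    using sub by (intro analytic_imp_holomorphic) (auto simp: U_def analytic_on_analytic_at[of k "ball _ _"])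
  then obtain g where g: "g holomorphic_on ball 0 (R + e)" "\<And>x. x \<in> ball 0 (R + e) \<Longrightarrow> exp (g x) = k x"
    using sub R e(1) holomorphic_logarithm_exists[of "ball 0 (R + e)" k 0] by (auto simp: U_def subset_iff)
  define B where "B = {x \<in> cball 0 R. \<not> (k x = h x / ?Q x \<and> ?Q x \<noteq> 0)} \<union> zeropoles h R"
  have "eventually (\<lambda>w. k w = h w / ?Q w \<and> ?Q w \<noteq> 0) (at z)" for z
    using eventually_remove_sings_eq_at[OF nzmero_at(2)[OF hQ, of z]] nzmero_at(4)[OF Q(1), of z]
    unfolding k_def by eventually_elim simp
  then have "finite B"
    unfolding B_def by (intro finite_UnI finite_cball_cosparse finite_zeropoles h)
  moreover have "h x = ?Q x * exp (g x)" if "x \<in> cball 0 R - B" for x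
  proof -
    have "x \<in> ball 0 (R + e)" using that e(1) by auto
    then have "exp (g x) = k x" by (rule g(2))
    then show ?thesis using that by (auto simp: B_def)
  qed
  moreover have "R < R + e" "zeropoles h R \<subseteq> B"
    using e(1) by (auto simp: B_def)
  ultimately show ?thesis
    using that[of "R + e" g B] g(1) by blast
qed

text \<open>The truncation at \<open>0\<close> makes \<open>logr r a\<close> a Lipschitz function of \<open>ln (norm a)\<close> across the circle
  \<open>norm a = r\<close>.\<close>

definition logr :: "real \<Rightarrow> complex \<Rightarrow> real" where
  "logr r a = (if a = 0 then ln r else max 0 (ln (r / norm a)))"

text \<open>The value of \<open>zor_poly h 0\<close> at 0 is the leading Laurent coefficient of
  \<open>h\<close> at 0; its logarithmic modulus is the constant in Jensen's formula.\<close>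

definition log_lead :: "(complex \<Rightarrow> complex) \<Rightarrow> real" where
  "log_lead h = ln (norm (zor_poly h 0 0))"

lemma ln_powi:
  fixes x :: real
  assumes "x > 0"
  shows "ln (x powi n) = of_int n * ln x"
  using assms by (simp add: power_int_def ln_realpow ln_inverse)

lemma ln_norm_prod_powi:
  fixes f :: "'a \<Rightarrow> complex"
  assumes "finite S" "\<And>a. a \<in> S \<Longrightarrow> f a \<noteq> 0"
  shows "ln (norm (\<Prod>a\<in>S. f a powi n a)) = (\<Sum>a\<in>S. of_int (n a) * ln (norm (f a)))"
proof -
  have "ln (norm (\<Prod>a\<in>S. f a powi n a)) = ln (\<Prod>a\<in>S. norm (f a) powi n a)"
    by (simp add: prod_norm[symmetric] norm_power_int)
  also have "\<dots> = (\<Sum>a\<in>S. ln (norm (f a) powi n a))"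
    using assms by (intro ln_prod) auto
  also have "\<dots> = (\<Sum>a\<in>S. of_int (n a) * ln (norm (f a)))"
    using assms by (intro sum.cong) (auto simp: ln_powi)
  finally show ?thesis .
qed

lemma ln_norm_factorized:
  assumes h: "nzmero h" and R: "R > 0" and B: "zeropoles h R \<subseteq> B"
    and eq: "\<And>x. x \<in> cball 0 R - B \<Longrightarrow> h x = disc_prod h R x * exp (g x)"
    and x: "x \<in> cball 0 R - B"
  shows "ln (norm (h x)) = (\<Sum>a\<in>zeropoles h R. of_int (zorder h a) * ln (norm (x - a) / R)) + Re (g x)"
proof -
  have ne: "(x - a) / of_real R \<noteq> 0" if "a \<in> zeropoles h R" for a
    using that x B R by auto
  then have ne': "disc_prod h R x \<noteq> 0"
    using finite_zeropoles[OF h] by (auto simp: disc_prod_def power_int_eq_0_iff)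
  have "ln (norm (h x)) = ln (norm (disc_prod h R x)) + Re (g x)"
    using ne' by (simp add: eq[OF x] norm_mult ln_mult)
  also have "ln (norm (disc_prod h R x)) = (\<Sum>a\<in>zeropoles h R. of_int (zorder h a) * ln (norm ((x - a) / of_real R)))"
    unfolding disc_prod_def by (intro ln_norm_prod_powi finite_zeropoles h ne)
  finally show ?thesis
    using R by (simp add: norm_divide)
qed

lemma cint_ln_norm_diff:
  assumes "R > 0"
  shows "cint (\<lambda>t. ln (norm (of_real R * cis t - a) / R))"
    and "norm a \<le> R \<Longrightarrow> cavg (\<lambda>t. ln (norm (of_real R * cis t - a) / R)) = 0"
proof -
  have "norm (of_real R * cis t - a) / R = norm (cis t - a / of_real R)" for t
  proof -
    have "of_real R * cis t - a = of_real R * (cis t - a / of_real R)"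
      using assms by (simp add: algebra_simps)
    then show ?thesis using assms by (simp add: norm_mult)
  qed
  then show "cint (\<lambda>t. ln (norm (of_real R * cis t - a) / R))"
    "norm a \<le> R \<Longrightarrow> cavg (\<lambda>t. ln (norm (of_real R * cis t - a) / R)) = 0"
    using assms by (auto simp: cint_ln_circle norm_divide intro!: cavg_ln_circle)
qed

lemma zero_eventually_outside_finite:
  assumes "finite B" "(R::real) > 0"
  shows "eventually (\<lambda>w. w \<in> cball 0 R - B) (at (0::complex))"
proof -
  have "\<not> 0 islimpt B" using assms(1) by (rule islimpt_finite)
  then have "eventually (\<lambda>w. w \<notin> B) (at 0)"
    by (simp add: islimpt_iff_eventually)
  moreover have "eventually (\<lambda>w. w \<in> ball 0 R) (at (0::complex))"
    using assms(2) by (intro eventually_at_in_open') auto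
  ultimately show ?thesis by eventually_elim auto
qed

text \<open>The linear factors of \<open>disc_factorization\<close> have logarithmic mean 0, so the
  mean equals \<open>Re (g 0)\<close>. Computing the leading coefficient at 0 from the same
  factorization expresses \<open>Re (g 0)\<close> by \<open>log_lead h\<close> and the zeros and
  poles.\<close>

lemma jensen:
  assumes h: "nzmero h" and R: "R > 0"
  shows "cint (\<lambda>t. ln (norm (h (of_real R * cis t))))"
    and "cavg (\<lambda>t. ln (norm (h (of_real R * cis t)))) =
      log_lead h + (\<Sum>a\<in>zeropoles h R. of_int (zorder h a) * logr R a)"
proof -
  let ?S = "zeropoles h R"
  obtain g R' B where g: "R < R'" "g holomorphic_on ball 0 R'" and B: "finite B" "?S \<subseteq> B"
    and eq: "\<And>x. x \<in> cball 0 R - B \<Longrightarrow> h x = disc_prod h R x * exp (g x)"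
    using disc_factorization[OF h R] by metis
  have S: "finite ?S" "\<And>a. a \<in> ?S \<Longrightarrow> norm a \<le> R"
    using finite_zeropoles[OF h] by (auto simp: zeropoles_def)
  let ?B = "{t \<in> {0..2*pi}. of_real R * cis t \<in> B}"
  have fB: "finite ?B" by (rule finite_circle_vimage[OF R B(1)])
  let ?u = "\<lambda>t. (\<Sum>a\<in>?S. of_int (zorder h a) * ln (norm (of_real R * cis t - a) / R)) + Re (g (of_real R * cis t))"
  have u: "cint ?u"
    by (intro cint_add cint_sum cint_cmult cint_ln_norm_diff R cint_Re_circle[OF g(2) R g(1)])
  have pt: "ln (norm (h (of_real R * cis t))) = ?u t" if "t \<in> {0..2*pi} - ?B" for t
    by (rule ln_norm_factorized[OF h R B(2) eq]) (use that R in \<open>auto simp: norm_mult\<close>)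
  show "cint (\<lambda>t. ln (norm (h (of_real R * cis t))))"
    by (rule cint_spike[OF u fB pt])
  have "cavg (\<lambda>t. ln (norm (h (of_real R * cis t)))) = cavg ?u"
    by (rule cavg_spike[OF fB pt])
  also have "\<dots> = cavg (\<lambda>t. \<Sum>a\<in>?S. of_int (zorder h a) * ln (norm (of_real R * cis t - a) / R)) +
      cavg (\<lambda>t. Re (g (of_real R * cis t)))"
    by (intro cavg_add cint_sum cint_cmult cint_ln_norm_diff R cint_Re_circle[OF g(2) R g(1)])
  also have "cavg (\<lambda>t. \<Sum>a\<in>?S. of_int (zorder h a) * ln (norm (of_real R * cis t - a) / R)) = 0"
    by (subst cavg_sum) (auto intro!: cint_cmult cint_ln_norm_diff R sum.neutral simp: cavg_cmult S)
  also have "cavg (\<lambda>t. Re (g (of_real R * cis t))) = Re (g 0)"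
    by (rule cavg_Re_holomorphic[OF g(2) R g(1)])
  finally have J: "cavg (\<lambda>t. ln (norm (h (of_real R * cis t)))) = Re (g 0)" by simp
  let ?n = "zorder h 0"
  define P where "P x = (\<Prod>a\<in>?S - {0}. ((x - a) / of_real R) powi zorder h a)" for x
  \<comment> \<open>The factor belonging to the point 0 is split off; what remains of the product at
    0, together with its power of \<open>R\<close>, is the leading coefficient.\<close>
  define c where "c = P 0 * of_real R powi (- ?n) * exp (g 0)"
  have Q: "disc_prod h R x = P x * (x / of_real R) powi ?n" for x
  proof (cases "0 \<in> ?S")
    case True
    then show ?thesis
      unfolding disc_prod_def P_def by (subst prod.remove[OF S(1) True]) (simp add: mult.commute)
  next
    case False
    then have "?n = 0" using R by (auto simp: zeropoles_def)
    with False show ?thesis by (simp add: disc_prod_def P_def)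
  qed
  have contP: "isCont P 0"
    unfolding P_def by (intro continuous_intros) (use R in auto)
  have contg: "isCont g 0"
    using g R by (intro holomorphic_on_imp_continuous_on[THEN continuous_on_interior]) auto
  have lim: "((\<lambda>x. h x * (x - 0) powi - ?n) \<longlongrightarrow> c) (at 0)"
  proof (rule Lim_transform_eventually)
    have "(\<lambda>x. P x * of_real R powi (- ?n) * exp (g x)) \<midarrow>0\<rightarrow> c"
      unfolding c_def by (intro tendsto_intros) (use contP contg in \<open>auto simp: isCont_def\<close>)
    then show "(\<lambda>x. P x * of_real R powi (- ?n) * exp (g x)) \<midarrow>0\<rightarrow> c" .
    show "\<forall>\<^sub>F x in at 0. P x * of_real R powi (- ?n) * exp (g x) = h x * (x - 0) powi - ?n"
      using zero_eventually_outside_finite[OF B(1) R] eventually_neq_at_within[of "0::complex" 0 UNIV]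
    proof eventually_elim
      case (elim x)
      have "h x = P x * (x / of_real R) powi ?n * exp (g x)"
        using eq[OF elim(1)] Q by simp
      moreover have "(x / of_real R) powi ?n * x powi (- ?n) = of_real R powi (- ?n)"
        using elim(2) unfolding power_int_divide_distrib by (simp add: power_int_minus divide_inverse)
      ultimately show ?case
        by (simp add: mult_ac)
    qed
  qed
  have "zor_poly h 0 0 = c"
    by (rule zor_poly_eqI[OF nzmero_at(2,3,5)[OF h] lim]) (auto simp: filterlim_ident)
  then have "log_lead h = ln (norm c)"
    by (simp add: log_lead_def)
  also have "\<dots> = ln (norm (P 0)) - of_int ?n * ln R + Re (g 0)"
  proof -
    have "P 0 \<noteq> 0"
      unfolding P_def using S(1) R by (auto simp: power_int_eq_0_iff)
    then show ?thesis
      using R by (simp add: c_def norm_mult ln_mult norm_power_int ln_powi)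
  qed
  also have "ln (norm (P 0)) = (\<Sum>a\<in>?S-{0}. of_int (zorder h a) * ln (norm ((0 - a) / of_real R)))"
    unfolding P_def by (intro ln_norm_prod_powi) (use S R in auto)
  also have "\<dots> = (\<Sum>a\<in>?S-{0}. - (of_int (zorder h a) * logr R a))"
  proof (intro sum.cong refl)
    fix a assume a: "a \<in> ?S - {0}"
    then have "norm a \<le> R" "norm a > 0" using S by auto
    then have "ln (R / norm a) \<ge> 0" "ln (norm a / R) = - ln (R / norm a)"
      using R by (auto simp: ln_div)
    then show "of_int (zorder h a) * ln (norm ((0 - a) / of_real R)) = - (of_int (zorder h a) * logr R a)"
      using a R by (simp add: logr_def norm_divide)
  qed
  also have "\<dots> - of_int ?n * ln R = - (\<Sum>a\<in>?S. of_int (zorder h a) * logr R a)"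
  proof (cases "0 \<in> ?S")
    case True
    then show ?thesis
      by (subst sum.remove[OF S(1) True]) (simp add: logr_def sum_negf)
  next
    case False
    then have "?n = 0" using R by (auto simp: zeropoles_def)
    with False show ?thesis by (simp add: sum_negf)
  qed
  finally show "cavg (\<lambda>t. ln (norm (h (of_real R * cis t)))) =
      log_lead h + (\<Sum>a\<in>?S. of_int (zorder h a) * logr R a)"
    using J by simp
qed

subsection \<open>Counting functions as logarithmic sums\<close>

definition lfin :: "(complex \<Rightarrow> real) \<Rightarrow> bool" where
  "lfin w \<longleftrightarrow> (\<forall>r. finite {x \<in> cball 0 r. w x \<noteq> 0})"

definition ncount :: "(complex \<Rightarrow> real) \<Rightarrow> real \<Rightarrow> real" where
  "ncount w r = (\<Sum>x | x \<in> cball 0 r \<and> w x \<noteq> 0. w x)"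

definition lcount :: "(complex \<Rightarrow> real) \<Rightarrow> real \<Rightarrow> real" where
  "lcount w r = (\<Sum>x | x \<in> cball 0 r \<and> w x \<noteq> 0. w x * logr r x)"

lemma lfinD: "lfin w \<Longrightarrow> finite {x. x \<in> cball 0 r \<and> w x \<noteq> 0}"
  by (simp add: lfin_def)

lemma lfin_Un: "lfin u \<Longrightarrow> lfin v \<Longrightarrow> (\<And>x. u x = 0 \<Longrightarrow> v x = 0 \<Longrightarrow> w x = 0) \<Longrightarrow> lfin w"
  unfolding lfin_def
proof (intro allI)
  fix r assume "\<forall>r. finite {x \<in> cball 0 r. u x \<noteq> 0}" "\<forall>r. finite {x \<in> cball 0 r. v x \<noteq> 0}"
    "\<And>x. u x = 0 \<Longrightarrow> v x = 0 \<Longrightarrow> w x = 0"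
  then show "finite {x \<in> cball 0 r. w x \<noteq> 0}"
    by (intro finite_subset[of "{x \<in> cball 0 r. w x \<noteq> 0}"
          "{x \<in> cball 0 r. u x \<noteq> 0} \<union> {x \<in> cball 0 r. v x \<noteq> 0}"]) auto
qed

lemma lfin_subset: "lfin w \<Longrightarrow> (\<And>x. w x = 0 \<Longrightarrow> v x = 0) \<Longrightarrow> lfin v"
  by (rule lfin_Un[of w w])

lemma lfin_sum: "finite A \<Longrightarrow> (\<And>n. n \<in> A \<Longrightarrow> lfin (w n)) \<Longrightarrow> lfin (\<lambda>x. \<Sum>n\<in>A. w n x)"
proof (induction A rule: finite_induct)
  case (insert a A)
  then have "lfin (w a)" "lfin (\<lambda>x. \<Sum>n\<in>A. w n x)" by auto
  then show ?case
    by (rule lfin_Un) (use insert in auto)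
qed (auto simp: lfin_def)

lemma logr_outside: "r > 0 \<Longrightarrow> x \<notin> cball 0 r \<Longrightarrow> logr r x = 0"
  by (cases "x = 0") (auto simp: logr_def max_def)

lemma logr_nonneg: "r \<ge> 1 \<Longrightarrow> logr r x \<ge> 0"
  by (auto simp: logr_def)

lemma logr_inside: "x \<noteq> 0 \<Longrightarrow> x \<in> cball 0 r \<Longrightarrow> logr r x = ln (r / norm x)"
  by (auto simp: logr_def max_def)

text \<open>The freedom in \<open>T\<close>, which may contain points outside the disc, comes from
  the truncation in \<open>logr\<close>. It is what allows later to sum over shifted point sets that
  overshoot the disc.\<close>

lemma lcount_eq:
  assumes "r > 0" "finite T" "{x \<in> cball 0 r. w x \<noteq> 0} \<subseteq> T"
  shows "lcount w r = (\<Sum>x\<in>T. w x * logr r x)"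
  unfolding lcount_def
proof (rule sum.mono_neutral_left)
  show "\<forall>i\<in>T - {x \<in> cball 0 r. w x \<noteq> 0}. w i * logr r i = 0"
    using logr_outside[OF assms(1)] by auto
qed (use assms in auto)

lemma lcount_diff:
  assumes "r > 0" "lfin u" "lfin v"
  shows "lcount (\<lambda>x. u x - v x) r = lcount u r - lcount v r"
proof -
  let ?T = "{x \<in> cball 0 r. u x \<noteq> 0} \<union> {x \<in> cball 0 r. v x \<noteq> 0}"
  have "finite ?T" using assms by (auto simp: lfin_def)
  then show ?thesis
    using assms(1) by (subst (1 2 3) lcount_eq[of r ?T]) (auto simp: left_diff_distrib sum_subtractf)
qed

lemma ncount_eq:
  assumes "finite T" "{x \<in> cball 0 r. w x \<noteq> 0} \<subseteq> T" "T \<subseteq> cball 0 r"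
  shows "ncount w r = (\<Sum>x\<in>T. w x)"
  unfolding ncount_def by (rule sum.mono_neutral_left) (use assms in auto)

lemma has_integral_inverse_from:
  fixes c r :: real
  assumes "0 < c" "c \<le> r"
  shows "((\<lambda>t. if c \<le> t then 1 / t else 0) has_integral ln (r / c)) {0..r}"
proof -
  have "((\<lambda>t. 1 / t) has_integral (ln r - ln c)) {c..r}"
    by (rule fundamental_theorem_of_calculus)
      (use assms in \<open>auto intro!: derivative_eq_intros simp flip: has_real_derivative_iff_has_vector_derivative\<close>)
  then have "((\<lambda>t. if t \<in> {c..r} then 1 / t else 0) has_integral (ln r - ln c)) {0..r}"
    by (subst has_integral_restrict) (use assms in auto)
  then have "((\<lambda>t. if c \<le> t then 1 / t else 0) has_integral (ln r - ln c)) {0..r}"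
    by (rule has_integral_eq[rotated]) auto
  then show ?thesis using assms by (simp add: ln_div)
qed

text \<open>A point \<open>x \<noteq> 0\<close> of the disc contributes \<open>1 / t\<close> from
  \<open>t = norm x\<close> on, which integrates to \<open>ln (r / norm x)\<close>; the point 0
  yields the separate term \<open>w 0 * ln r\<close>. As finite sums the counting functions can be
  compared point by point.\<close>

lemma integrated_count_ncount:
  assumes "lfin w" "r > 0"
  shows "integrated_count (ncount w) r = lcount w r"
proof -
  define S where "S = {x \<in> cball 0 r. w x \<noteq> 0}"
  have S: "finite S" using assms by (auto simp: S_def lfin_def)
  have n0: "ncount w 0 = w 0"
  proof -
    have "ncount w 0 = (\<Sum>x\<in>{0}. w x)"
      by (rule ncount_eq) auto
    then show ?thesis by simp
  qed
  have pt: "(ncount w t - ncount w 0) / t = (\<Sum>x\<in>S-{0}. w x * (if norm x \<le> t then 1 / t else 0))"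
    if t: "t \<in> {0..r}" for t
  proof -
    have "ncount w t = (\<Sum>x\<in>insert 0 {x\<in>S. norm x \<le> t}. w x)"
    proof (rule ncount_eq)
      show "finite (insert 0 {x\<in>S. norm x \<le> t})" using S by simp
    qed (use t in \<open>auto simp: S_def\<close>)
    also have "insert 0 {x\<in>S. norm x \<le> t} = insert 0 {x\<in>S-{0}. norm x \<le> t}"
      by auto
    also have "(\<Sum>x\<in>insert 0 {x\<in>S-{0}. norm x \<le> t}. w x) = w 0 + (\<Sum>x\<in>{x\<in>S-{0}. norm x \<le> t}. w x)"
      using S by (subst sum.insert) auto
    also have "(\<Sum>x\<in>{x\<in>S-{0}. norm x \<le> t}. w x) = (\<Sum>x\<in>S-{0}. if norm x \<le> t then w x else 0)"
      using S by (intro sum.inter_filter) auto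
    finally have "(ncount w t - ncount w 0) / t = (\<Sum>x\<in>S-{0}. if norm x \<le> t then w x else 0) / t"
      by (simp add: n0)
    also have "\<dots> = (\<Sum>x\<in>S-{0}. w x * (if norm x \<le> t then 1 / t else 0))"
      unfolding sum_divide_distrib by (intro sum.cong refl) simp
    finally show ?thesis .
  qed
  have "((\<lambda>t. \<Sum>x\<in>S-{0}. w x * (if norm x \<le> t then 1 / t else 0)) has_integral
      (\<Sum>x\<in>S-{0}. w x * ln (r / norm x))) {0..r}"
    by (intro has_integral_sum has_integral_mult_right has_integral_inverse_from)
      (use S in \<open>auto simp: S_def\<close>)
  then have "((\<lambda>t. (ncount w t - ncount w 0) / t) has_integral (\<Sum>x\<in>S-{0}. w x * ln (r / norm x))) {0..r}"
    by (rule has_integral_eq[rotated]) (simp only: pt)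
  then have "integrated_count (ncount w) r = (\<Sum>x\<in>S-{0}. w x * ln (r / norm x)) + w 0 * ln r"
    by (simp add: integrated_count_def integral_unique n0)
  also have "(\<Sum>x\<in>S-{0}. w x * ln (r / norm x)) = (\<Sum>x\<in>S-{0}. w x * logr r x)"
    by (intro sum.cong refl) (auto simp: S_def logr_inside)
  also have "\<dots> + w 0 * ln r = (\<Sum>x\<in>insert 0 (S - {0}). w x * logr r x)"
    using S by (subst sum.insert) (auto simp: logr_def)
  also have "\<dots> = lcount w r"
    using assms S by (intro lcount_eq[symmetric]) (auto simp: S_def)
  finally show ?thesis .
qed

text \<open>Every point of the disc of radius \<open>r\<close> has
  \<open>logr (2 * r) x \<ge> ln 2\<close>; for \<open>x = 0\<close> this uses
  \<open>r \<ge> 1\<close>.\<close>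

lemma ncount_le_lcount:
  assumes "lfin w" "\<And>x. w x \<ge> 0" "r \<ge> 1"
  shows "ln 2 * ncount w r \<le> lcount w (2 * r)"
proof -
  let ?S = "{x \<in> cball 0 r. w x \<noteq> 0}" and ?T = "{x \<in> cball 0 (2*r). w x \<noteq> 0}"
  have "ln 2 * ncount w r = (\<Sum>x\<in>?S. w x * ln 2)"
    by (simp add: ncount_def sum_distrib_left mult.commute)
  also have "\<dots> \<le> (\<Sum>x\<in>?S. w x * logr (2*r) x)"
  proof (intro sum_mono mult_left_mono assms(2))
    fix x assume x: "x \<in> ?S"
    show "ln 2 \<le> logr (2*r) x"
    proof (cases "x = 0")
      case False
      then have "2 \<le> 2 * r / norm x" using x by (simp add: field_simps)
      then have "ln 2 \<le> ln (2 * r / norm x)" using False by (subst ln_le_cancel_iff) auto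
      then show ?thesis using False by (auto simp: logr_def)
    qed (use assms in \<open>auto simp: logr_def\<close>)
  qed
  also have "\<dots> \<le> (\<Sum>x\<in>?T. w x * logr (2*r) x)"
    by (rule sum_mono2) (use assms lfinD[of w] in \<open>auto intro!: mult_nonneg_nonneg logr_nonneg\<close>)
  finally show ?thesis by (simp add: lcount_def)
qed

subsection \<open>The first main theorem\<close>

lemma ln_plus_eq: "x \<ge> 0 \<Longrightarrow> ln_plus x = max 0 (ln x)"
  by (cases "x = 0") (auto simp: ln_plus_def max_def not_le)

lemma ln_plus_nonneg: "ln_plus x \<ge> 0"
  by (simp add: ln_plus_def)

lemma ln_plus_mono: "x \<le> y \<Longrightarrow> ln_plus x \<le> ln_plus y"
  unfolding ln_plus_def by (subst ln_le_cancel_iff) auto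

lemma ln_plus_mult: "x \<ge> 0 \<Longrightarrow> y \<ge> 0 \<Longrightarrow> ln_plus (x * y) \<le> ln_plus x + ln_plus y"
proof -
  assume xy: "x \<ge> 0" "y \<ge> 0"
  have "1 * 1 \<le> max 1 x * max 1 y" "x * y \<le> max 1 x * max 1 y"
    using xy by (intro mult_mono; simp)+
  then have "max 1 (x * y) \<le> max 1 x * max 1 y"
    by simp
  then have "ln (max 1 (x * y)) \<le> ln (max 1 x * max 1 y)"
    by (subst ln_le_cancel_iff) auto
  moreover have "max 1 x > 0" "max 1 y > 0" by linarith+
  ultimately show ?thesis by (simp add: ln_plus_def ln_mult)
qed

lemma ln_plus_add: "x \<ge> 0 \<Longrightarrow> y \<ge> 0 \<Longrightarrow> ln_plus (x + y) \<le> ln_plus x + ln_plus y + ln 2"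
proof -
  assume xy: "x \<ge> 0" "y \<ge> 0"
  have a: "1 \<le> max 1 x * max 1 y" "max 1 x \<le> max 1 x * max 1 y" "max 1 y \<le> max 1 x * max 1 y"
    using mult_mono[of 1 "max 1 x" 1 "max 1 y"] mult_mono[of "max 1 x" "max 1 x" 1 "max 1 y"]
      mult_mono[of 1 "max 1 x" "max 1 y" "max 1 y"] by auto
  have "max 1 (x + y) \<le> 2 * (max 1 x * max 1 y)"
    using a xy max.cobounded2[of x 1] max.cobounded2[of y 1] by simp
  then have "ln (max 1 (x + y)) \<le> ln (2 * (max 1 x * max 1 y))"
    using a(1) by (subst ln_le_cancel_iff) auto
  also have "\<dots> = ln_plus x + ln_plus y + ln 2"
  proof -
    have "max 1 x > 0" "max 1 y > 0" by linarith+
    then show ?thesis by (simp add: ln_plus_def ln_mult)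
  qed
  finally show ?thesis by (simp add: ln_plus_def)
qed

text \<open>Valid also at 0, where \<open>1 / 0 = 0\<close> and \<open>ln 0 = 0\<close> make both
  sides vanish.\<close>

lemma ln_eq_ln_plus: "x \<ge> 0 \<Longrightarrow> ln x = ln_plus x - ln_plus (1 / x)" for x :: real
  by (cases "x = 0") (auto simp: ln_plus_eq ln_div max_def)

lemma proximity_cavg: "proximity r f = cavg (\<lambda>t. ln_plus (norm (f (of_real r * cis t))))"
  by (simp add: proximity_def cavg_def)

lemma cint_ln_plus:
  assumes "nzmero h" "r > 0"
  shows "cint (\<lambda>t. ln_plus (norm (h (of_real r * cis t))))"
  using jensen(1)[OF assms] by (auto simp: ln_plus_eq intro!: cint_max)

lemma cavg_nonneg: "(\<And>t. u t \<ge> 0) \<Longrightarrow> cint u \<Longrightarrow> cavg u \<ge> 0"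
  using cavg_mono[of "\<lambda>_. 0" u "{}"] by auto

lemma proximity_nonneg: "nzmero h \<Longrightarrow> r > 0 \<Longrightarrow> proximity r h \<ge> 0"
  unfolding proximity_cavg by (intro cavg_nonneg cint_ln_plus ln_plus_nonneg)

lemma nzmero_inverse:
  assumes "nzmero h"
  shows "nzmero (\<lambda>x. 1 / h x)"
proof -
  have "(\<lambda>x. 1 / h x) meromorphic_on UNIV"
    using assms by (auto simp: nzmero_def intro!: meromorphic_intros)
  then show ?thesis using assms by (simp add: nzmero_def)
qed

lemma zorder_inverse':
  assumes "nzmero h"
  shows "zorder (\<lambda>x. 1 / h x) z = - zorder h z"
  using zorder_divide[of "\<lambda>_. 1" z h] nzmero_at[OF assms] by (simp add: eventually_frequently meromorphic_on_const)

lemma pole_order_eq: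
  assumes "nzmero h"
  shows "pole_order h x = max 0 (- zorder h x)" "is_pole h x \<longleftrightarrow> zorder h x < 0"
proof -
  show *: "is_pole h x \<longleftrightarrow> zorder h x < 0"
    using nzmero_at[OF assms] isolated_pole_imp_neg_zorder zorder_neg_imp_is_pole by blast
  then show "pole_order h x = max 0 (- zorder h x)"
    by (auto simp: pole_order_def)
qed

lemma pole_order_inverse: "nzmero h \<Longrightarrow> pole_order (\<lambda>x. 1 / h x) x = max 0 (zorder h x)"
  by (simp add: pole_order_eq nzmero_inverse zorder_inverse')

lemma lfin_zorder: "nzmero h \<Longrightarrow> lfin (\<lambda>x. of_int (zorder h x))"
  using finite_zeropoles by (auto simp: lfin_def zeropoles_def)

lemma lfin_pole_order: "nzmero h \<Longrightarrow> lfin (\<lambda>x. of_int (pole_order h x))"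
  by (rule lfin_subset[OF lfin_zorder]) (auto simp: pole_order_eq)

lemma finite_poles_upto: "nzmero h \<Longrightarrow> finite (poles_upto r h)"
  by (rule finite_subset[OF _ finite_zeropoles[of h r]]) (auto simp: poles_upto_def zeropoles_def pole_order_eq)

lemma pole_count_ncount:
  assumes "nzmero h"
  shows "pole_count r h = ncount (\<lambda>x. of_int (pole_order h x)) r"
  unfolding pole_count_def of_int_sum
  by (rule ncount_eq[symmetric])
    (use assms in \<open>auto simp: finite_poles_upto\<close>, auto simp: poles_upto_def pole_order_def split: if_splits)

lemma nevanlinna_N_lcount:
  assumes "nzmero h" "r > 0"
  shows "nevanlinna_N r h = lcount (\<lambda>x. of_int (pole_order h x)) r"
  using integrated_count_ncount[OF lfin_pole_order[OF assms(1)] assms(2)]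
  by (simp add: nevanlinna_N_def pole_count_ncount[OF assms(1)])

lemma jensen_lcount:
  assumes "nzmero h" "r > 0"
  shows "cavg (\<lambda>t. ln (norm (h (of_real r * cis t)))) = log_lead h + lcount (\<lambda>x. of_int (zorder h x)) r"
proof -
  have "zeropoles h r = {x. x \<in> cball 0 r \<and> real_of_int (zorder h x) \<noteq> 0}"
    by (auto simp: zeropoles_def)
  then show ?thesis
    unfolding jensen(2)[OF assms] lcount_def by simp
qed

lemma jensen_N:
  assumes "nzmero h" "r > 0"
  shows "cavg (\<lambda>t. ln (norm (h (of_real r * cis t)))) =
    log_lead h + nevanlinna_N r (\<lambda>x. 1 / h x) - nevanlinna_N r h"
proof -
  have "real_of_int (zorder h x) = of_int (pole_order (\<lambda>x. 1 / h x) x) - of_int (pole_order h x)" for x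
    using assms(1) by (simp add: pole_order_inverse pole_order_eq)
  then have "lcount (\<lambda>x. of_int (zorder h x)) r = nevanlinna_N r (\<lambda>x. 1 / h x) - nevanlinna_N r h"
    using assms lcount_diff[OF assms(2) lfin_pole_order[OF nzmero_inverse[OF assms(1)]] lfin_pole_order[OF assms(1)]]
    by (simp add: nevanlinna_N_lcount nzmero_inverse)
  then show ?thesis
    using jensen_lcount[OF assms] by simp
qed

text \<open>Jensen's formula with \<open>ln\<close> written as a difference of two
  \<open>ln_plus\<close> terms. It is an exact identity, with no bounded error.\<close>

lemma nevanlinna_T_inverse:
  assumes "nzmero h" "r > 0"
  shows "nevanlinna_T r h = nevanlinna_T r (\<lambda>x. 1 / h x) + log_lead h"
proof -
  have "cavg (\<lambda>t. ln (norm (h (of_real r * cis t)))) =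
      cavg (\<lambda>t. ln_plus (norm (h (of_real r * cis t))) - ln_plus (norm (1 / h (of_real r * cis t))))"
    by (subst ln_eq_ln_plus) (simp_all add: norm_divide)
  also have "\<dots> = proximity r h - proximity r (\<lambda>x. 1 / h x)"
    unfolding proximity_cavg
    by (intro cavg_diff cint_ln_plus assms cint_ln_plus[OF nzmero_inverse[OF assms(1)], of r])
  finally show ?thesis
    using jensen_N[OF assms] by (simp add: nevanlinna_T_def)
qed

lemma is_pole_diff_const:
  "is_pole (\<lambda>x. f x - c) z \<longleftrightarrow> is_pole f z" for f :: "complex \<Rightarrow> complex"
proof -
  have "is_pole (\<lambda>x. f x + d) z" if "is_pole f z" for f :: "complex \<Rightarrow> complex" and d
    using that unfolding is_pole_def by (intro tendsto_add_filterlim_at_infinity') auto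
  from this[of f "-c"] this[of "\<lambda>x. f x - c" c] show ?thesis by auto
qed

lemma pole_order_diff_const:
  assumes "nzmero f" "nzmero (\<lambda>x. f x - c)"
  shows "pole_order (\<lambda>x. f x - c) z = pole_order f z"
proof (cases "is_pole f z \<and> c \<noteq> 0")
  case True
  then have "zorder f z < 0" using pole_order_eq(2)[OF assms(1)] by auto
  then have "zorder (\<lambda>x. f x - c) z = zorder f z"
    using True nzmero_at[OF assms(1)] by (intro zorder_diff1) (auto simp: eventually_frequently)
  with True show ?thesis by (simp add: pole_order_def is_pole_diff_const)
next
  case False
  then show ?thesis
  proof (cases "c = 0")
    case True then show ?thesis by simp
  qed (auto simp: pole_order_def is_pole_diff_const)
qed

lemma nevanlinna_N_diff_const:
  assumes "nzmero f" "nzmero (\<lambda>x. f x - c)" "r > 0"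
  shows "nevanlinna_N r (\<lambda>x. f x - c) = nevanlinna_N r f"
  using assms by (simp add: nevanlinna_N_lcount pole_order_diff_const)

lemma proximity_diff_const:
  assumes "nzmero f" "nzmero (\<lambda>x. f x - c)" "r > 0"
  shows "\<bar>proximity r (\<lambda>x. f x - c) - proximity r f\<bar> \<le> ln_plus (norm c) + ln 2"
proof -
  let ?z = "\<lambda>t. of_real r * cis t :: complex"
  have i: "cint (\<lambda>t. ln_plus (norm (f (?z t))))" "cint (\<lambda>t. ln_plus (norm (f (?z t) - c)))"
    using cint_ln_plus[OF assms(1,3)] cint_ln_plus[OF assms(2,3)] by auto
  have "proximity r (\<lambda>x. f x - c) \<le> cavg (\<lambda>t. ln_plus (norm (f (?z t))) + (ln_plus (norm c) + ln 2))"
    unfolding proximity_cavg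
  proof (rule cavg_mono[of _ _ "{}"])
    fix t
    have "ln_plus (norm (f (?z t) - c)) \<le> ln_plus (norm (f (?z t)) + norm c)"
      by (intro ln_plus_mono norm_triangle_ineq4)
    then show "ln_plus (norm (f (?z t) - c)) \<le> ln_plus (norm (f (?z t))) + (ln_plus (norm c) + ln 2)"
      using ln_plus_add[of "norm (f (?z t))" "norm c"] by simp
  qed (use i in auto)
  moreover have "proximity r f \<le> cavg (\<lambda>t. ln_plus (norm (f (?z t) - c)) + (ln_plus (norm c) + ln 2))"
    unfolding proximity_cavg
  proof (rule cavg_mono[of _ _ "{}"])
    fix t
    have "ln_plus (norm (f (?z t))) \<le> ln_plus (norm (f (?z t) - c) + norm c)"
      using norm_triangle_ineq[of "f (?z t) - c" c] by (intro ln_plus_mono) simp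
    then show "ln_plus (norm (f (?z t))) \<le> ln_plus (norm (f (?z t) - c)) + (ln_plus (norm c) + ln 2)"
      using ln_plus_add[of "norm (f (?z t) - c)" "norm c"] by simp
  qed (use i in auto)
  ultimately show ?thesis
    using i by (simp add: cavg_add proximity_cavg)
qed

lemma first_main_theorem:
  assumes "nzmero f" "nzmero (\<lambda>x. f x - c)" "r > 0"
  shows "\<bar>nevanlinna_T r (\<lambda>x. 1 / (f x - c)) - nevanlinna_T r f\<bar> \<le>
    ln_plus (norm c) + ln 2 + \<bar>log_lead (\<lambda>x. f x - c)\<bar>"
  using nevanlinna_T_inverse[OF assms(2,3)] proximity_diff_const[OF assms] nevanlinna_N_diff_const[OF assms]
  unfolding nevanlinna_T_def by linarith

lemma N_le_T: "nzmero h \<Longrightarrow> r > 0 \<Longrightarrow> nevanlinna_N r h \<le> nevanlinna_T r h"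
  using proximity_nonneg[of h r] by (simp add: nevanlinna_T_def)

lemma pole_count_le_T:
  assumes "nzmero h" "r \<ge> 1"
  shows "ln 2 * ncount (\<lambda>x. of_int (pole_order h x)) r \<le> nevanlinna_T (2 * r) h"
proof -
  have "ln 2 * ncount (\<lambda>x. of_int (pole_order h x)) r \<le> lcount (\<lambda>x. of_int (pole_order h x)) (2 * r)"
    using assms by (intro ncount_le_lcount lfin_pole_order) (auto simp: pole_order_eq)
  also have "\<dots> \<le> nevanlinna_T (2 * r) h"
    using assms N_le_T[of h "2 * r"] by (simp add: nevanlinna_N_lcount)
  finally show ?thesis .
qed

lemma nevanlinna_order_bound:
  assumes "nevanlinna_order f = ereal \<sigma>" "\<beta> > \<sigma>"
  shows "eventually (\<lambda>r. nevanlinna_T r f \<le> r powr \<beta>) at_top"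
proof -
  have "eventually (\<lambda>r. ereal (ln_plus (nevanlinna_T r f) / ln r) < ereal \<beta>) at_top"
    using assms by (intro Limsup_lessD) (auto simp: nevanlinna_order_def)
  then show ?thesis
    using eventually_gt_at_top[of 1]
  proof eventually_elim
    case (elim r)
    then have "ln_plus (nevanlinna_T r f) < \<beta> * ln r"
      by (simp add: pos_divide_less_eq)
    then have "ln (max 1 (nevanlinna_T r f)) < ln (r powr \<beta>)"
      using elim by (simp add: ln_plus_def ln_powr)
    then have "max 1 (nevanlinna_T r f) < r powr \<beta>"
      using elim by (subst (asm) ln_less_cancel_iff) auto
    then show ?case by simp
  qed
qed

subsection \<open>Logarithmic differences\<close>

text \<open>For \<open>s \<le> 1\<close> the chain is
  \<open>ln (1 + s) \<le> s \<le> s powr \<alpha>\<close>; for larger \<open>s\<close> apply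
  \<open>ln v \<le> v\<close> to \<open>v = (1 + s) powr \<alpha>\<close>.\<close>

lemma ln_one_plus_le_powr:
  fixes s \<alpha> :: real
  assumes "0 < \<alpha>" "\<alpha> < 1" "s \<ge> 0"
  shows "ln (1 + s) \<le> 2 / \<alpha> * s powr \<alpha>"
proof (cases "s \<le> 1")
  case True
  have "ln (1 + s) \<le> s"
    using assms by (intro ln_add_one_self_le_self) auto
  also have "s \<le> s powr \<alpha>"
    using True assms powr_mono'[of \<alpha> 1 s] by (cases "s = 0") auto
  also have "\<dots> \<le> 2 / \<alpha> * s powr \<alpha>"
    using assms mult_right_mono[of 1 "2 / \<alpha>" "s powr \<alpha>"] by simp
  finally show ?thesis .
next
  case False
  have "\<alpha> * ln (1 + s) = ln ((1 + s) powr \<alpha>)"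
    using False by (simp add: ln_powr)
  also have "\<dots> \<le> (1 + s) powr \<alpha>"
    using False by (intro ln_bound) auto
  also have "\<dots> \<le> (2 * s) powr \<alpha>"
    using False assms by (intro powr_mono2) auto
  also have "\<dots> = 2 powr \<alpha> * s powr \<alpha>"
    using False by (simp add: powr_mult)
  also have "\<dots> \<le> 2 powr 1 * s powr \<alpha>"
    using assms by (intro mult_right_mono powr_mono) auto
  finally show ?thesis
    using assms by (simp add: field_simps)
qed

text \<open>From \<open>norm u \<le> norm v + 1\<close> the quotient of the moduli is at most
  \<open>1 + 1 / norm v\<close>, so its logarithm is controlled by a power with exponent below 1.
  This is what keeps the singularity integrable.\<close>

lemma abs_ln_norm_diff_le:
  fixes u v :: complex
  assumes "0 < \<alpha>" "\<alpha> < 1" "u \<noteq> 0" "v \<noteq> 0" "norm (u - v) \<le> 1"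
  shows "\<bar>ln (norm u) - ln (norm v)\<bar> \<le> 2 / \<alpha> * (norm u powr - \<alpha> + norm v powr - \<alpha>)"
proof -
  have *: "ln (norm u) - ln (norm v) \<le> 2 / \<alpha> * norm v powr - \<alpha>"
    if uv: "u \<noteq> 0" "v \<noteq> 0" "norm (u - v) \<le> 1" for u v :: complex
  proof -
    have "norm u \<le> norm v + 1"
      using norm_triangle_ineq[of v "u - v"] uv by simp
    then have "norm u / norm v \<le> 1 + 1 / norm v"
      using uv by (simp add: field_simps)
    then have "ln (norm u / norm v) \<le> ln (1 + 1 / norm v)"
      using uv by (subst ln_le_cancel_iff) (auto intro: add_pos_pos)
    also have "\<dots> \<le> 2 / \<alpha> * (1 / norm v) powr \<alpha>"
      using assms by (intro ln_one_plus_le_powr) auto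
    finally show ?thesis
      using uv by (simp add: ln_div powr_divide powr_minus field_simps)
  qed
  have "0 \<le> 2 / \<alpha> * norm u powr - \<alpha>" "0 \<le> 2 / \<alpha> * norm v powr - \<alpha>"
    using assms by auto
  moreover have "ln (norm v) - ln (norm u) \<le> 2 / \<alpha> * norm u powr - \<alpha>"
    using * assms by (simp add: norm_minus_commute)
  ultimately show ?thesis
    using *[OF assms(3,4,5)] unfolding distrib_left by linarith
qed

definition zpcount :: "(complex \<Rightarrow> complex) \<Rightarrow> real \<Rightarrow> real" where
  "zpcount h R = (\<Sum>a\<in>zeropoles h R. \<bar>of_int (zorder h a)\<bar>)"

lemma zpcount_nonneg: "zpcount h R \<ge> 0"
  by (simp add: zpcount_def sum_nonneg)

lemma zpcount_le:
  assumes "nzmero h" "R \<ge> 1"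
  shows "ln 2 * zpcount h R \<le> nevanlinna_T (2 * R) h + nevanlinna_T (2 * R) (\<lambda>x. 1 / h x)"
proof -
  have *: "ncount (\<lambda>x. of_int (w x)) R = (\<Sum>x\<in>zeropoles h R. of_int (w x))"
    if "\<And>x. zorder h x = 0 \<Longrightarrow> w x = 0" for w :: "complex \<Rightarrow> int"
    by (rule ncount_eq) (use finite_zeropoles[OF assms(1)] that in \<open>auto simp: zeropoles_def\<close>)
  have "zpcount h R = ncount (\<lambda>x. of_int (pole_order h x)) R + ncount (\<lambda>x. of_int (pole_order (\<lambda>x. 1 / h x) x)) R"
    unfolding zpcount_def
    by (subst (1 2) *) (use assms in \<open>auto simp: pole_order_eq pole_order_inverse sum.distrib[symmetric] intro!: sum.cong\<close>)
  then show ?thesis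
    using pole_count_le_T[OF assms] pole_count_le_T[OF nzmero_inverse[OF assms(1)] assms(2)]
    by (simp add: distrib_left)
qed

text \<open>A function \<open>u\<close> with \<open>u \<le> ln 2\<close> satisfies
  \<open>\<bar>u\<bar> \<le> 2 * ln 2 - u\<close>, and here \<open>u\<close> has mean 0.\<close>

lemma cavg_abs_ln_norm_diff:
  assumes "R > 0" "norm a \<le> R"
  shows "cavg (\<lambda>t. \<bar>ln (norm (of_real R * cis t - a) / R)\<bar>) \<le> 2 * ln 2"
proof -
  let ?u = "\<lambda>t. ln (norm (of_real R * cis t - a) / R)"
  have i: "cint ?u" by (rule cint_ln_norm_diff) fact
  have "cavg (\<lambda>t. \<bar>?u t\<bar>) \<le> cavg (\<lambda>t. 2 * ln 2 - ?u t)"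
  proof (rule cavg_mono[of _ _ "{}"])
    fix t
    have "norm (of_real R * cis t - a) \<le> R + R"
      using norm_triangle_ineq4[of "of_real R * cis t" a] assms by (simp add: norm_mult)
    then have "norm (of_real R * cis t - a) / R \<le> 2"
      using assms by (simp add: field_simps)
    moreover have "0 \<le> norm (of_real R * cis t - a) / R"
      using assms by simp
    moreover have "ln y \<le> ln 2" if "0 \<le> y" "y \<le> 2" for y :: real
      using that by (cases "y = 0") auto
    ultimately have "?u t \<le> ln 2"
      by blast
    moreover have "ln 2 \<ge> (0::real)" by simp
    ultimately show "\<bar>?u t\<bar> \<le> 2 * ln 2 - ?u t"
      by linarith
  qed (use i in auto)
  also have "\<dots> = 2 * ln 2"
    using i cint_ln_norm_diff(2)[OF assms] by (simp add: cavg_diff)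
  finally show ?thesis .
qed

lemma cavg_abs_ln:
  assumes "nzmero h" "R > 0"
  shows "cavg (\<lambda>t. \<bar>ln (norm (h (of_real R * cis t)))\<bar>) = proximity R h + proximity R (\<lambda>x. 1 / h x)"
proof -
  have "\<bar>ln x\<bar> = ln_plus x + ln_plus (1 / x)" if "x \<ge> 0" for x :: real
    using that by (cases "x = 0") (auto simp: ln_plus_eq ln_div max_def)
  then have "cavg (\<lambda>t. \<bar>ln (norm (h (of_real R * cis t)))\<bar>) =
      cavg (\<lambda>t. ln_plus (norm (h (of_real R * cis t))) + ln_plus (norm (1 / h (of_real R * cis t))))"
    by (simp add: norm_divide)
  also have "\<dots> = proximity R h + proximity R (\<lambda>x. 1 / h x)"
    unfolding proximity_cavg
    by (intro cavg_add cint_ln_plus assms cint_ln_plus[OF nzmero_inverse[OF assms(1)], of R])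
  finally show ?thesis .
qed

text \<open>On the circle \<open>Re g\<close> is \<open>ln (norm h)\<close> minus the logarithms of
  the linear factors, each of which has absolute mean at most \<open>2 * ln 2\<close>. This supplies
  the input of \<open>deriv_bound_cavg_Re\<close>.\<close>

lemma cavg_Re_log_factor:
  assumes h: "nzmero h" and R: "R > 0"
    and g: "R < R'" "g holomorphic_on ball 0 R'" and B: "finite B" "zeropoles h R \<subseteq> B"
    and eq: "\<And>x. x \<in> cball 0 R - B \<Longrightarrow> h x = disc_prod h R x * exp (g x)"
  shows "cavg (\<lambda>t. \<bar>Re (g (of_real R * cis t))\<bar>) \<le>
    proximity R h + proximity R (\<lambda>x. 1 / h x) + 2 * ln 2 * zpcount h R"
proof -
  let ?S = "zeropoles h R"
  let ?z = "\<lambda>t. of_real R * cis t :: complex"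
  let ?l = "\<lambda>a t. \<bar>ln (norm (?z t - a) / R)\<bar>"
  have S: "norm a \<le> R" if "a \<in> ?S" for a using that by (auto simp: zeropoles_def)
  have i: "cint (\<lambda>t. \<bar>ln (norm (h (?z t)))\<bar>)" "cint (\<lambda>t. \<Sum>a\<in>?S. \<bar>of_int (zorder h a)\<bar> * ?l a t)"
    by (intro cint_abs jensen(1) h R cint_sum cint_cmult cint_ln_norm_diff)+
  have "cavg (\<lambda>t. \<bar>Re (g (?z t))\<bar>) \<le>
      cavg (\<lambda>t. \<bar>ln (norm (h (?z t)))\<bar> + (\<Sum>a\<in>?S. \<bar>of_int (zorder h a)\<bar> * ?l a t))"
  proof (rule cavg_mono[OF _ _ finite_circle_vimage[OF R B(1)]])
    fix t assume t: "t \<in> {0..2*pi} - {t \<in> {0..2*pi}. ?z t \<in> B}"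
    have "ln (norm (h (?z t))) = (\<Sum>a\<in>?S. of_int (zorder h a) * ln (norm (?z t - a) / R)) + Re (g (?z t))"
      by (rule ln_norm_factorized[OF h R B(2) eq]) (use t R in \<open>auto simp: norm_mult\<close>)
    moreover have "\<bar>\<Sum>a\<in>?S. of_int (zorder h a) * ln (norm (?z t - a) / R)\<bar> \<le> (\<Sum>a\<in>?S. \<bar>of_int (zorder h a)\<bar> * ?l a t)"
      by (rule order_trans[OF sum_abs]) (simp add: abs_mult)
    ultimately show "\<bar>Re (g (?z t))\<bar> \<le> \<bar>ln (norm (h (?z t)))\<bar> + (\<Sum>a\<in>?S. \<bar>of_int (zorder h a)\<bar> * ?l a t)"
      by linarith
  qed (intro cint_abs cint_Re_circle[OF g(2) R g(1)] cint_add i)+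
  also have "\<dots> = cavg (\<lambda>t. \<bar>ln (norm (h (?z t)))\<bar>) + cavg (\<lambda>t. \<Sum>a\<in>?S. \<bar>of_int (zorder h a)\<bar> * ?l a t)"
    by (intro cavg_add i)
  also have "cavg (\<lambda>t. \<Sum>a\<in>?S. \<bar>of_int (zorder h a)\<bar> * ?l a t) = (\<Sum>a\<in>?S. \<bar>of_int (zorder h a)\<bar> * cavg (?l a))"
    by (subst cavg_sum) (auto intro!: cint_cmult cint_abs cint_ln_norm_diff R simp: cavg_cmult)
  also have "\<dots> \<le> (\<Sum>a\<in>?S. \<bar>of_int (zorder h a)\<bar> * (2 * ln 2))"
    by (intro sum_mono mult_left_mono cavg_abs_ln_norm_diff R S) auto
  also have "\<dots> = 2 * ln 2 * zpcount h R"
    by (simp add: zpcount_def sum_distrib_left mult.commute)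
  finally show ?thesis
    by (simp add: cavg_abs_ln[OF h R])
qed

lemma square_half_circle: "(of_real \<rho> * cis (t / 2))\<^sup>2 = of_real (\<rho>\<^sup>2) * cis t"
proof -
  have "(cis (t / 2))\<^sup>2 = cis t"
    by (simp add: power2_eq_square cis_mult)
  then show ?thesis
    by (simp add: power_mult_distrib)
qed

text \<open>Taking both square roots of each point of \<open>B\<close> turns the condition into one
  on the circle itself, at the parameter \<open>t / 2\<close>.\<close>

lemma finite_half_circle_vimage:
  assumes "r > 0" "finite B"
  shows "finite {t \<in> {0..2*pi}. (of_real r * cis (t / 2) + \<eta>)\<^sup>2 \<in> B}"
proof -
  let ?B = "(\<lambda>b. csqrt b - \<eta>) ` B \<union> (\<lambda>b. - csqrt b - \<eta>) ` B"
  have "finite {t \<in> {0..2*pi}. of_real r * cis t \<in> ?B}"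
    using assms by (intro finite_circle_vimage) auto
  then have "finite ((\<lambda>t. 2 * t) ` {t \<in> {0..2*pi}. of_real r * cis t \<in> ?B})"
    by (rule finite_imageI)
  then show ?thesis
  proof (rule rev_finite_subset, intro subsetI)
    fix t assume t: "t \<in> {t \<in> {0..2*pi}. (of_real r * cis (t / 2) + \<eta>)\<^sup>2 \<in> B}"
    define b where "b = (of_real r * cis (t / 2) + \<eta>)\<^sup>2"
    have "of_real r * cis (t / 2) + \<eta> = csqrt b \<or> of_real r * cis (t / 2) + \<eta> = - csqrt b"
      using power2_csqrt[of b] unfolding b_def by (metis power2_eq_iff)
    then have "of_real r * cis (t / 2) = csqrt b - \<eta> \<or> of_real r * cis (t / 2) = - csqrt b - \<eta>"
      by (auto simp: algebra_simps)
    then have "of_real r * cis (t / 2) \<in> ?B"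
      using t unfolding b_def[symmetric] by auto
    then show "t \<in> (\<lambda>t. 2 * t) ` {t \<in> {0..2*pi}. of_real r * cis t \<in> ?B}"
      using t by (intro image_eqI[of _ _ "t / 2"]) auto
  qed
qed

text \<open>With \<open>b = csqrt a\<close> the distance splits as \<open>(w - b) * (w + b)\<close>,
  so shifting \<open>z\<close> translates each factor by \<eta> only, although
  \<open>z\<^sup>2\<close> moves much further. Two factors before and after the shift give the four
  centres in the list.\<close>

lemma ln_dist_square_shift:
  fixes z \<eta> a :: complex
  assumes "0 < \<alpha>" "\<alpha> < 1" "norm \<eta> \<le> 1" "z\<^sup>2 \<noteq> a" "(z + \<eta>)\<^sup>2 \<noteq> a"
  shows "\<bar>ln (norm ((z + \<eta>)\<^sup>2 - a)) - ln (norm (z\<^sup>2 - a))\<bar> \<le>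
    2 / \<alpha> * (\<Sum>c\<in>{0,1,2,3::nat}. norm (z - [csqrt a, - csqrt a, csqrt a - \<eta>, - csqrt a - \<eta>] ! c) powr - \<alpha>)"
proof -
  let ?b = "csqrt a"
  have fac: "w\<^sup>2 - a = (w - ?b) * (w + ?b)" for w
    by (metis power2_csqrt power2_eq_square square_diff_square_factored mult.commute)
  have ne: "z - ?b \<noteq> 0" "z + ?b \<noteq> 0" "z + \<eta> - ?b \<noteq> 0" "z + \<eta> + ?b \<noteq> 0"
    using assms(4,5) fac[of z] fac[of "z + \<eta>"] by auto
  have "\<bar>ln (norm ((z + \<eta>)\<^sup>2 - a)) - ln (norm (z\<^sup>2 - a))\<bar> \<le>
      \<bar>ln (norm (z + \<eta> - ?b)) - ln (norm (z - ?b))\<bar> + \<bar>ln (norm (z + \<eta> + ?b)) - ln (norm (z + ?b))\<bar>"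
    unfolding fac norm_mult using ne by (simp add: ln_mult)
  also have "\<dots> \<le> 2 / \<alpha> * (norm (z + \<eta> - ?b) powr - \<alpha> + norm (z - ?b) powr - \<alpha>) +
      2 / \<alpha> * (norm (z + \<eta> + ?b) powr - \<alpha> + norm (z + ?b) powr - \<alpha>)"
    using assms(3) by (intro add_mono abs_ln_norm_diff_le assms ne) auto
  also have "\<dots> = 2 / \<alpha> * (\<Sum>c\<in>{0,1,2,3::nat}. norm (z - [?b, - ?b, ?b - \<eta>, - ?b - \<eta>] ! c) powr - \<alpha>)"
    by (simp add: distrib_left algebra_simps)
  finally show ?thesis .
qed

text \<open>The first summand is the change of the exponential factor along the shift, the second
  the contribution of zeros and poles; its 8 is the factor 2 of \<open>ln_dist_square_shift\<close>
  times four centres.\<close>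

definition shift_error :: "(complex \<Rightarrow> complex) \<Rightarrow> real \<Rightarrow> real \<Rightarrow> real \<Rightarrow> real" where
  "shift_error h \<alpha> K r =
    4 / sqrt r * (proximity (4 * r) h + proximity (4 * r) (\<lambda>x. 1 / h x) + 2 * ln 2 * zpcount h (4 * r))
    + 8 / \<alpha> * K * zpcount h (4 * r) * r powr (- \<alpha> / 2)"

text \<open>For \<open>norm x = r\<close> the image of \<open>x = z\<^sup>2\<close> under the shift \<open>(z + \<eta>)\<^sup>2\<close> stays at distance \<open>O(\<surd>r)\<close>;
  the zero-free part of \<open>h\<close> is controlled by the derivative of its logarithm, the zeros and poles by
  integrals of \<open>norm (z - c) powr - \<alpha>\<close> in the variable \<open>z\<close>.\<close>

lemma log_shift_bound:
  assumes h: "nzmero h" and \<alpha>: "0 < \<alpha>" "\<alpha> < 1" and r: "r \<ge> 4" and \<eta>: "norm \<eta> = 1 / 2"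
    and K: "\<And>c. cint (\<lambda>t. norm (cis (t / 2) - c) powr - \<alpha>)"
      "\<And>c. cavg (\<lambda>t. norm (cis (t / 2) - c) powr - \<alpha>) \<le> K"
  obtains U B where "finite B" "cint U"
    "\<And>t. t \<in> {0..2*pi} - B \<Longrightarrow>
      ln_plus (norm (h ((of_real (sqrt r) * cis (t / 2) + \<eta>)\<^sup>2)) / norm (h (of_real r * cis t))) \<le> U t"
    "cavg U \<le> shift_error h \<alpha> K r"
proof -
  \<comment> \<open>The point and its shift lie in the disc of radius \<open>2 * r\<close>, which
    keeps distance \<open>2 * r\<close> from the circle of radius \<open>R\<close>.\<close>
  define R where "R = 4 * r"
  define \<rho> where "\<rho> = sqrt r"
  have R: "R > 0" using r by (simp add: R_def)
  have \<rho>: "\<rho> \<ge> 2" "\<rho>\<^sup>2 = r" using r real_le_rsqrt[of 2 r] by (auto simp: \<rho>_def)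
  let ?S = "zeropoles h R"
  have S: "finite ?S" by (rule finite_zeropoles[OF h])
  obtain g R' B where g: "R < R'" "g holomorphic_on ball 0 R'" and B: "finite B" "?S \<subseteq> B"
    and eq: "\<And>x. x \<in> cball 0 R - B \<Longrightarrow> h x = disc_prod h R x * exp (g x)"
    using disc_factorization[OF h R] by metis
  define M where "M = cavg (\<lambda>t. \<bar>Re (g (of_real R * cis t))\<bar>)"
  have M: "M \<le> proximity R h + proximity R (\<lambda>x. 1 / h x) + 2 * ln 2 * zpcount h R"
    unfolding M_def by (rule cavg_Re_log_factor[OF h R g B eq])
  have M0: "M \<ge> 0"
    unfolding M_def by (intro cavg_nonneg cint_abs cint_Re_circle[OF g(2) R g(1)]) auto
  let ?z = "\<lambda>t. of_real \<rho> * cis (t / 2) :: complex"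
  have z2: "(?z t)\<^sup>2 = of_real r * cis t" for t
    by (simp only: square_half_circle \<rho>)
  define L where "L a = [csqrt a, - csqrt a, csqrt a - \<eta>, - csqrt a - \<eta>]" for a
  define U where "U t = 4 / \<rho> * M + (\<Sum>a\<in>?S. \<bar>of_int (zorder h a)\<bar> *
      (2 / \<alpha> * (\<Sum>c\<in>{0,1,2,3::nat}. norm (?z t - L a ! c) powr - \<alpha>)))" for t
  \<comment> \<open>Rescaling to the unit half circle produces the gain
    \<open>r powr (- \<alpha> / 2)\<close>, since the radius in the variable \<open>z\<close> is
    only \<open>sqrt r\<close>.\<close>
  have pw: "norm (?z t - c) powr - \<alpha> = r powr (- \<alpha> / 2) * norm (cis (t / 2) - c / of_real \<rho>) powr - \<alpha>" for t c
  proof -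
    have "?z t - c = of_real \<rho> * (cis (t / 2) - c / of_real \<rho>)"
      using \<rho> by (simp add: algebra_simps)
    then have "norm (?z t - c) powr - \<alpha> = \<rho> powr - \<alpha> * norm (cis (t / 2) - c / of_real \<rho>) powr - \<alpha>"
      using \<rho> by (simp add: norm_mult powr_mult)
    also have "\<rho> powr - \<alpha> = r powr (- \<alpha> / 2)"
      using r by (simp add: \<rho>_def powr_half_sqrt[symmetric] powr_powr)
    finally show ?thesis .
  qed
  have ci: "cint (\<lambda>t. norm (?z t - c) powr - \<alpha>)" and ca: "cavg (\<lambda>t. norm (?z t - c) powr - \<alpha>) \<le> r powr (- \<alpha> / 2) * K" for c
    unfolding pw cavg_cmult by (intro cint_cmult K mult_left_mono; simp)+
  define B' where "B' = {t \<in> {0..2*pi}. (of_real \<rho> * cis (t / 2) + 0)\<^sup>2 \<in> B} \<union> {t \<in> {0..2*pi}. (of_real \<rho> * cis (t / 2) + \<eta>)\<^sup>2 \<in> B}"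
  have "finite B'"
    unfolding B'_def using \<rho> by (intro finite_UnI finite_half_circle_vimage B) auto
  moreover have U: "cint U"
    unfolding U_def by (intro cint_add cint_const cint_sum cint_cmult ci)
  moreover have "ln_plus (norm (h ((?z t + \<eta>)\<^sup>2)) / norm (h (of_real r * cis t))) \<le> U t"
    if t: "t \<in> {0..2*pi} - B'" for t
  proof -
    define x x' where "x = (?z t)\<^sup>2" and "x' = (?z t + \<eta>)\<^sup>2"
    have nB: "x \<notin> B" "x' \<notin> B"
      using t by (auto simp: B'_def x_def x'_def)
    have nx: "norm x = r" using r by (simp add: x_def z2 norm_mult)
    have "x' - x = \<eta> * (2 * ?z t + \<eta>)"
      by (simp add: x_def x'_def power2_eq_square algebra_simps)
    then have "norm (x' - x) = 1 / 2 * norm (2 * ?z t + \<eta>)"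
      by (simp add: norm_mult \<eta>)
    also have "\<dots> \<le> 1 / 2 * (2 * \<rho> + 1 / 2)"
      using norm_triangle_ineq[of "2 * ?z t" \<eta>] \<rho> \<eta> by (simp add: norm_mult)
    finally have dx: "norm (x' - x) \<le> 2 * \<rho>" using \<rho> by simp
    have "2 * \<rho> \<le> \<rho> * \<rho>" using \<rho> by (intro mult_right_mono) auto
    then have r2: "2 * \<rho> \<le> r"
      unfolding \<rho>(2)[symmetric] power2_eq_square .
    then have nx': "norm x' \<le> 2 * r"
      using norm_triangle_ineq[of x "x' - x"] dx nx by simp
    have in_ball: "x \<in> cball 0 R - B" "x' \<in> cball 0 R - B"
      using nx nx' nB r by (auto simp: R_def)
    have der: "norm (deriv g w) \<le> 2 / r * M" if "w \<in> cball 0 (2 * r)" for w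
    proof -
      have w: "norm w \<le> 2 * r" "norm w < R" using that r by (auto simp: R_def)
      have "norm (deriv g w) \<le> 2 * R / (R - norm w)\<^sup>2 * M"
        unfolding M_def by (rule deriv_bound_cavg_Re[OF g(2) R g(1) w(2)])
      also have "\<dots> \<le> 2 * R / (2 * r)\<^sup>2 * M"
        using w r M0 by (intro mult_right_mono divide_left_mono power_mono mult_pos_pos zero_less_power) (auto simp: R_def)
      also have "\<dots> = 2 / r * M"
        using r by (simp add: R_def power2_eq_square field_simps)
      finally show ?thesis .
    qed
    have "norm (g x' - g x) \<le> 2 / r * M * norm (x' - x)"
    proof (rule field_differentiable_bound[of "cball 0 (2 * r)"])
      show "(g has_field_derivative deriv g w) (at w within cball 0 (2 * r))" if "w \<in> cball 0 (2 * r)" for w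
        using that g r by (intro holomorphic_derivI[OF g(2)]) (auto simp: R_def)
    qed (use der nx nx' r in auto)
    also have "\<dots> \<le> 2 / r * M * (2 * \<rho>)"
      using dx M0 r by (intro mult_left_mono) auto
    \<comment> \<open>The derivative is of size \<open>M / r\<close> and the path of length at most
      \<open>2 * \<rho>\<close>, where \<open>r = \<rho>\<^sup>2\<close>.\<close>
    also have "\<dots> = 4 / \<rho> * M"
      using \<rho> by (simp add: field_simps power2_eq_square flip: \<rho>(2))
    finally have gb: "\<bar>Re (g x') - Re (g x)\<bar> \<le> 4 / \<rho> * M"
      by (metis abs_Re_le_cmod minus_complex.sel(1) order_trans)
    have Sb: "\<bar>\<Sum>a\<in>?S. of_int (zorder h a) * (ln (norm (x' - a) / R) - ln (norm (x - a) / R))\<bar> \<le>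
        (\<Sum>a\<in>?S. \<bar>of_int (zorder h a)\<bar> * (2 / \<alpha> * (\<Sum>c\<in>{0,1,2,3::nat}. norm (?z t - L a ! c) powr - \<alpha>)))"
    proof (rule order_trans[OF sum_abs], unfold abs_mult, intro sum_mono mult_left_mono abs_ge_zero)
      fix a assume "a \<in> ?S"
      then have ne: "x \<noteq> a" "x' \<noteq> a" using nB B by auto
      then have "ln (norm (x' - a) / R) - ln (norm (x - a) / R) = ln (norm (x' - a)) - ln (norm (x - a))"
        using R by (simp add: ln_div)
      then show "\<bar>ln (norm (x' - a) / R) - ln (norm (x - a) / R)\<bar> \<le>
          2 / \<alpha> * (\<Sum>c\<in>{0,1,2,3::nat}. norm (?z t - L a ! c) powr - \<alpha>)"
        using ln_dist_square_shift[OF \<alpha>, of \<eta> "?z t" a] ne \<eta> by (simp add: x_def x'_def L_def)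
    qed
    have lnh: "ln (norm (h w)) = (\<Sum>a\<in>?S. of_int (zorder h a) * ln (norm (w - a) / R)) + Re (g w)"
      if "w \<in> cball 0 R - B" for w
      by (rule ln_norm_factorized[OF h R B(2) eq]) (use that in auto)
    have "ln (norm (h x')) - ln (norm (h x)) =
        (\<Sum>a\<in>?S. of_int (zorder h a) * (ln (norm (x' - a) / R) - ln (norm (x - a) / R))) + (Re (g x') - Re (g x))"
      unfolding lnh[OF in_ball(1)] lnh[OF in_ball(2)]
      by (simp add: right_diff_distrib sum_subtractf)
    then have "ln (norm (h x')) - ln (norm (h x)) \<le> U t"
      using gb Sb unfolding U_def by linarith
    moreover have "0 \<le> U t"
      unfolding U_def using \<rho> M0 \<alpha> by (intro add_nonneg_nonneg mult_nonneg_nonneg sum_nonneg) auto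
    \<comment> \<open>If one of the values is 0, the quotient is 0 by convention and its
      \<open>ln_plus\<close> vanishes.\<close>
    moreover have "ln_plus (norm (h x') / norm (h x)) \<le> max 0 (ln (norm (h x')) - ln (norm (h x)))"
      by (cases "norm (h x) = 0 \<or> norm (h x') = 0") (auto simp: ln_plus_eq ln_div)
    ultimately show ?thesis
      by (simp add: x_def x'_def z2)
  qed
  moreover have "cavg U \<le> shift_error h \<alpha> K r"
  proof -
    have "cavg U = 4 / \<rho> * M + (\<Sum>a\<in>?S. \<bar>of_int (zorder h a)\<bar> * (2 / \<alpha> * (\<Sum>c\<in>{0,1,2,3::nat}. cavg (\<lambda>t. norm (?z t - L a ! c) powr - \<alpha>))))"
      unfolding U_def
      by (subst cavg_add, (intro cint_const cint_sum cint_cmult ci)+, subst cavg_sum, (intro cint_const cint_sum cint_cmult ci)+,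
          subst cavg_cmult, subst cavg_cmult, subst cavg_sum, (intro ci)+, simp)
    also have "\<dots> \<le> 4 / \<rho> * M + (\<Sum>a\<in>?S. \<bar>of_int (zorder h a)\<bar> * (2 / \<alpha> * (\<Sum>c\<in>{0,1,2,3::nat}. r powr (- \<alpha> / 2) * K)))"
      using \<alpha> by (intro add_left_mono sum_mono mult_left_mono ca) auto
    also have "\<dots> = 4 / \<rho> * M + 8 / \<alpha> * K * zpcount h R * r powr (- \<alpha> / 2)"
      by (simp add: zpcount_def sum_distrib_left sum_distrib_right mult_ac)
    also have "4 / \<rho> * M \<le> 4 / \<rho> * (proximity R h + proximity R (\<lambda>x. 1 / h x) + 2 * ln 2 * zpcount h R)"
      using M \<rho> by (intro mult_left_mono) auto
    finally show ?thesis by (simp add: R_def \<rho>_def shift_error_def)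
  qed
  ultimately show ?thesis
    using that[of B' U] by (auto simp: \<rho>_def)
qed

subsection \<open>The Wilson operator on meromorphic functions\<close>

text \<open>Off the cut one of \<open>csqrt\<close> and its negative serves; on the negative axis
  the cut is rotated away by using \<open>\<i> * csqrt (- x)\<close>.\<close>

lemma sqrt_branch:
  fixes z :: complex
  assumes "z \<noteq> 0"
  obtains s where "s analytic_on {z\<^sup>2}" "s (z\<^sup>2) = z" "\<And>x. (s x)\<^sup>2 = x"
proof (cases "z\<^sup>2 \<in> \<real>\<^sub>\<le>\<^sub>0")
  case False
  have a: "csqrt analytic_on {z\<^sup>2}" "(\<lambda>x. - csqrt x) analytic_on {z\<^sup>2}"
    using False by (auto intro!: analytic_on_neg analytic_on_subset[OF analytic_on_csqrt])
  have "csqrt (z\<^sup>2) = z \<or> - csqrt (z\<^sup>2) = z"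
    by (metis power2_csqrt power2_eq_iff minus_minus)
  with a show ?thesis
    using that[of csqrt] that[of "\<lambda>x. - csqrt x"] by auto
next
  case True
  have "Re (z\<^sup>2) \<noteq> 0 \<or> Im (z\<^sup>2) \<noteq> 0"
    using assms by (metis complex_eq_iff zero_complex.sel power_not_zero)
  then have n: "- (z\<^sup>2) \<notin> \<real>\<^sub>\<le>\<^sub>0"
    using True by (auto simp: complex_nonpos_Reals_iff)
  have a: "(\<lambda>x. \<i> * csqrt (- x)) analytic_on {z\<^sup>2}"
    using n by (intro analytic_intros) auto
  from analytic_on_neg[OF this] have a': "(\<lambda>x. - (\<i> * csqrt (- x))) analytic_on {z\<^sup>2}" .
  have sq: "(\<i> * csqrt (- x))\<^sup>2 = x" for x
    by (simp add: power_mult_distrib)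
  have "\<i> * csqrt (- (z\<^sup>2)) = z \<or> - (\<i> * csqrt (- (z\<^sup>2))) = z"
    using sq by (metis power2_eq_iff minus_minus)
  then show ?thesis
    using that[of "\<lambda>x. \<i> * csqrt (- x)"] that[of "\<lambda>x. - (\<i> * csqrt (- x))"] a a' sq
    by (auto simp del: mult_minus_right)
qed

lemma filterlim_square_shift:
  fixes a c :: complex
  shows "filterlim (\<lambda>z. (z + c)\<^sup>2) (at ((a + c)\<^sup>2)) (at a)"
proof (rule filterlim_atI)
  show "((\<lambda>z. (z + c)\<^sup>2) \<longlongrightarrow> (a + c)\<^sup>2) (at a)"
    by (intro tendsto_intros)
  show "\<forall>\<^sub>F z in at a. (z + c)\<^sup>2 \<noteq> (a + c)\<^sup>2"
    using eventually_neq_at_within[of a a UNIV] eventually_neq_at_within[of "- a - 2 * c" a UNIV]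
  proof eventually_elim
    case (elim z)
    have "(z + c)\<^sup>2 - (a + c)\<^sup>2 = (z - a) * (z - (- a - 2 * c))"
      by (simp add: power2_eq_square algebra_simps)
    with elim show ?case by auto
  qed
qed

lemma meromorphic_square_shift:
  assumes "f meromorphic_on UNIV"
  shows "(\<lambda>v. f ((v + c)\<^sup>2)) meromorphic_on UNIV"
proof -
  have "(\<lambda>v. (v + c)\<^sup>2) analytic_on UNIV"
    by (intro analytic_intros)
  then show ?thesis
    by (rule meromorphic_on_compose[OF assms]) simp
qed

text \<open>The order is preserved because the inner map has derivative \<open>2 * (u + c)\<close>,
  nonzero at \<open>u\<close>. At \<open>u = - c\<close> it would be doubled, which explains the
  exclusion.\<close>

lemma square_shift_nzmero:
  assumes "nzmero f"
  shows "nzmero (\<lambda>v. f ((v + c)\<^sup>2))"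
    and "u + c \<noteq> 0 \<Longrightarrow> zorder (\<lambda>v. f ((v + c)\<^sup>2)) u = zorder f ((u + c)\<^sup>2)"
proof -
  have "(\<lambda>v. f ((v + c)\<^sup>2)) meromorphic_on UNIV"
    using assms meromorphic_square_shift by (simp add: nzmero_def)
  moreover have "eventually (\<lambda>v. f ((v + c)\<^sup>2) \<noteq> 0) (at a)" for a
    by (rule eventually_compose_filterlim[OF nzmero_at(4)[OF assms] filterlim_square_shift])
  ultimately show "nzmero (\<lambda>v. f ((v + c)\<^sup>2))"
    by (simp add: nzmero_def)
  assume u: "u + c \<noteq> 0"
  have "zorder (f \<circ> (\<lambda>v. (v + c)\<^sup>2)) u = zorder f ((u + c)\<^sup>2) * zorder (\<lambda>v. (v + c)\<^sup>2 - (u + c)\<^sup>2) u"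
  proof (rule zorder_compose')
    show "(\<lambda>v. (v + c)\<^sup>2) analytic_on {u}" by (intro analytic_intros)
    show "\<forall>\<^sub>F w in at u. (w + c)\<^sup>2 \<noteq> (u + c)\<^sup>2"
      using filterlim_square_shift[of c u] by (simp add: filterlim_at)
  qed (use nzmero_at[OF assms] in auto)
  also have "zorder (\<lambda>v. (v + c)\<^sup>2 - (u + c)\<^sup>2) u = 1"
  proof (rule zorder_eqI[of UNIV _ "\<lambda>v. v + u + 2 * c"])
    have "u + u + 2 * c = 2 * (u + c)" by simp
    then show "u + u + 2 * c \<noteq> 0"
      using u by (simp only: mult_eq_0_iff) simp
    show "(\<lambda>v. v + u + 2 * c) holomorphic_on UNIV"
      by (intro holomorphic_intros)
    show "(w + c)\<^sup>2 - (u + c)\<^sup>2 = (w + u + 2 * c) * (w - u) powi 1" for w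
      unfolding power2_eq_square power_int_1_right by (simp add: algebra_simps)
  qed auto
  finally show "zorder (\<lambda>v. f ((v + c)\<^sup>2)) u = zorder f ((u + c)\<^sup>2)"
    by (simp add: o_def)
qed

lemma wilson_quot_meromorphic:
  assumes "f meromorphic_on UNIV"
  shows "wilson_quot f meromorphic_on UNIV"
proof -
  have "(\<lambda>z. (f ((z + \<i> / 2)\<^sup>2) - f ((z + (- \<i> / 2))\<^sup>2)) / (2 * \<i> * z)) meromorphic_on UNIV"
    by (intro meromorphic_intros meromorphic_square_shift assms)
  then show ?thesis
    by (simp add: wilson_quot_def[abs_def])
qed

lemma wilson_quot_csqrt_square: "wilson_quot f (csqrt (z\<^sup>2)) = wilson_quot f z"
  by (rule wilson_quot_square_cong) simp

text \<open>Near \<open>x \<noteq> 0\<close> evenness lets \<open>csqrt\<close> be replaced by a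
  local analytic branch. At 0 no branch is analytic; instead an annulus of regularity for the
  quotient in \<open>z\<close> gives an isolated singularity, and since \<open>csqrt x\<close> tends
  to 0 through nonzero values, limits and poles are inherited.\<close>

lemma wilson_pre_meromorphic:
  assumes f: "f meromorphic_on UNIV"
  shows "(\<lambda>x. wilson_quot f (csqrt x)) meromorphic_on UNIV"
proof -
  let ?G = "wilson_quot f"
  have G: "?G meromorphic_on UNIV" by (rule wilson_quot_meromorphic[OF f])
  have branch: "(\<lambda>x. ?G (csqrt x)) = (\<lambda>x. ?G (s x))" if "\<And>x. (s x)\<^sup>2 = x" for s
    using that by (intro ext wilson_quot_square_cong) simp
  have nz: "(\<lambda>x. ?G (csqrt x)) meromorphic_on {x}" if "x \<noteq> 0" for x
  proof -
    obtain s where s: "s analytic_on {x}" "\<And>x. (s x)\<^sup>2 = x"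
      using sqrt_branch[of "csqrt x"] \<open>x \<noteq> 0\<close> by auto
    have "(\<lambda>x. ?G (s x)) meromorphic_on {x}"
      by (rule meromorphic_on_compose[OF G s(1)]) auto
    then show ?thesis by (simp only: branch[OF s(2)])
  qed
  obtain e where e: "e > 0" "?G analytic_on ball 0 e - {0}"
    using meromorphic_on_isolated_singularity[OF meromorphic_on_subset[OF G subset_UNIV]]
    unfolding isolated_singularity_at_def by blast
  have an: "(\<lambda>x. ?G (csqrt x)) analytic_on {x}" if x: "x \<in> ball 0 (e\<^sup>2) - {0}" for x
  proof -
    obtain s where s: "s analytic_on {x}" "\<And>x. (s x)\<^sup>2 = x"
      using sqrt_branch[of "csqrt x"] x by auto
    have "(norm (s x))\<^sup>2 = norm x"
      unfolding norm_power[symmetric] by (simp only: s(2))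
    moreover have "norm x < e\<^sup>2"
      using x by simp
    ultimately have "(norm (s x))\<^sup>2 < e\<^sup>2"
      by linarith
    then have "norm (s x) < e"
      by (rule power2_less_imp_less) (use e(1) in linarith)
    moreover have "s x \<noteq> 0"
    proof
      assume "s x = 0"
      then have "x = 0"
        using s(2)[of x] by (simp only: power_zero_numeral)
      then show False
        using x by blast
    qed
    ultimately have "s x \<in> ball 0 e - {0}"
      by simp
    then have "?G analytic_on {s x}"
      using analytic_on_subset[OF e(2), of "{s x}"] by auto
    then have "(?G \<circ> s) analytic_on {x}"
      by (intro analytic_on_compose s) auto
    then show ?thesis by (simp only: branch[OF s(2)] o_def)
  qed
  have "(\<lambda>x. ?G (csqrt x)) analytic_on ball 0 (e\<^sup>2) - {0}"
    using an analytic_on_analytic_at by blast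
  then have iso: "isolated_singularity_at (\<lambda>x. ?G (csqrt x)) 0"
    unfolding isolated_singularity_at_def using e(1) by (intro exI[of _ "e\<^sup>2"]) auto
  have "((\<lambda>x. sqrt (cmod x)) \<longlongrightarrow> sqrt (cmod 0)) (at (0 :: complex))"
    by (intro tendsto_intros)
  then have "(csqrt \<longlongrightarrow> 0) (at 0)"
    by (intro tendsto_norm_zero_cancel[where f = csqrt]) simp
  moreover have "\<forall>\<^sub>F x in at 0. csqrt x \<noteq> 0"
    by (simp add: eventually_at_filter)
  ultimately have fl: "filterlim csqrt (at 0) (at 0)"
    by (simp add: filterlim_at)
  have "not_essential ?G 0"
    by (rule meromorphic_on_not_essential[OF meromorphic_on_subset[OF G subset_UNIV]])
  then have "not_essential (\<lambda>x. ?G (csqrt x)) 0"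
    unfolding not_essential_def is_pole_def
    using filterlim_compose[OF _ fl, of ?G] by blast
  with iso have "(\<lambda>x. ?G (csqrt x)) meromorphic_on {0}"
    by (simp add: meromorphic_at_iff)
  with nz show ?thesis
    by (subst meromorphic_on_meromorphic_at) metis
qed

lemma wilson_meromorphic:
  assumes "f meromorphic_on UNIV"
  shows "wilson f meromorphic_on UNIV" "wilson f nicely_meromorphic_on UNIV"
  unfolding wilson_def
  using remove_sings_meromorphic[OF wilson_pre_meromorphic[OF assms]]
    remove_sings_nicely_meromorphic[OF wilson_pre_meromorphic[OF assms]] .

lemma wilson_eventually:
  assumes "f meromorphic_on UNIV"
  shows "eventually (\<lambda>x. wilson f x = wilson_quot f (csqrt x)) (at x)"
  unfolding wilson_def
  using meromorphic_on_subset[OF wilson_pre_meromorphic[OF assms], of "{x}"]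
  by (intro eventually_remove_sings_eq_at meromorphic_on_isolated_singularity) simp

lemma filterlim_square:
  fixes a :: complex shows "filterlim (\<lambda>z. z\<^sup>2) (at (a\<^sup>2)) (at a)"
  using filterlim_square_shift[where c = 0 and a = a] by (simp only: add_0_right)

lemma wilson_eventually_square:
  assumes "f meromorphic_on UNIV"
  shows "eventually (\<lambda>z. wilson f (z\<^sup>2) = wilson_quot f z) (at z)"
  using eventually_compose_filterlim[OF wilson_eventually[OF assms] filterlim_square[of z]]
  unfolding wilson_quot_csqrt_square .

lemma nzmero_wilson_quot_iff:
  assumes "f meromorphic_on UNIV"
  shows "nzmero (wilson_quot f) \<longleftrightarrow> nzmero (wilson f)"
proof
  assume "nzmero (wilson f)"
  then have "eventually (\<lambda>z. wilson f (z\<^sup>2) \<noteq> 0) (at 1)"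
    by (intro eventually_compose_filterlim[OF nzmero_at(4) filterlim_square[of 1]])
  then have "eventually (\<lambda>z. wilson_quot f z \<noteq> 0) (at 1)"
    using wilson_eventually_square[OF assms, of 1] by eventually_elim simp
  then show "nzmero (wilson_quot f)"
    by (intro nzmeroI[of _ 1] wilson_quot_meromorphic assms) (simp add: eventually_frequently)
next
  assume nz: "nzmero (wilson_quot f)"
  have "\<not> eventually (\<lambda>x. wilson f x = 0) (at 1)"
  proof
    assume "eventually (\<lambda>x. wilson f x = 0) (at 1)"
    then have "eventually (\<lambda>x. wilson f x = 0) (at (1\<^sup>2))"
      by simp
    from eventually_compose_filterlim[OF this filterlim_square[of 1]] wilson_eventually_square[OF assms, of 1]
    have "eventually (\<lambda>z. wilson_quot f z = 0) (at 1)"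
      by eventually_elim simp
    with nzmero_at(4)[OF nz, of 1] have "eventually (\<lambda>z. False) (at (1::complex))"
      by eventually_elim simp
    then show False by simp
  qed
  then show "nzmero (wilson f)"
    by (intro nzmeroI[of _ 1] wilson_meromorphic assms) (simp add: frequently_def)
qed

lemma zorder_wilson_square:
  assumes "f meromorphic_on UNIV" "nzmero (wilson_quot f)" "z \<noteq> 0"
  shows "zorder (wilson f) (z\<^sup>2) = zorder (wilson_quot f) z"
proof -
  have "nzmero (wilson f)" using assms nzmero_wilson_quot_iff by blast
  from square_shift_nzmero(2)[OF this, of z 0] assms(3)
  have "zorder (\<lambda>v. wilson f (v\<^sup>2)) z = zorder (wilson f) (z\<^sup>2)" by simp
  moreover have "zorder (\<lambda>v. wilson f (v\<^sup>2)) z = zorder (wilson_quot f) z"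
    by (rule zorder_cong[OF wilson_eventually_square[OF assms(1)] refl])
  ultimately show ?thesis by simp
qed

text \<open>Membership outside the kernel gives a single nonzero value; it becomes generic
  nonvanishing because \<open>wilson f\<close> is nicely meromorphic. If \<open>f\<close> agreed
  generically with \<open>c\<close>, the Wilson quotient would vanish generically.\<close>

lemma not_wilson_ker_nzmero:
  assumes "f meromorphic_on UNIV" "f \<notin> wilson_ker"
  shows "nzmero (wilson f)" "nzmero (wilson_quot f)" "nzmero (\<lambda>x. f x - c)"
proof -
  have "\<not> (\<forall>x\<in>UNIV. wilson f x = 0)"
    using assms(2) by (simp add: wilson_ker_def)
  then have "\<forall>\<^sub>\<approx>x\<in>UNIV. wilson f x \<noteq> 0"
    using nicely_meromorphic_imp_constant_or_avoid[OF wilson_meromorphic(2)[OF assms(1)] open_UNIV connected_UNIV, of 0] by blast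
  then show W: "nzmero (wilson f)"
    using wilson_meromorphic(1)[OF assms(1)] unfolding nzmero_def
    by (simp add: eventually_cosparse_open_eq)
  then show Q: "nzmero (wilson_quot f)"
    using nzmero_wilson_quot_iff[OF assms(1)] by simp
  have m: "(\<lambda>x. f x - c) meromorphic_on UNIV"
    using assms(1) by (intro meromorphic_intros)
  show "nzmero (\<lambda>x. f x - c)"
  proof (rule ccontr)
    assume neg: "\<not> nzmero (\<lambda>x. f x - c)"
    have ev: "eventually (\<lambda>x. f x = c) (at x)" for x
    proof (rule ccontr)
      assume "\<not> eventually (\<lambda>x. f x = c) (at x)"
      then have "nzmero (\<lambda>x. f x - c)"
        by (intro nzmeroI[OF m, of x]) (simp add: frequently_def)
      with neg show False by simp
    qed
    have "eventually (\<lambda>z. f ((z + d)\<^sup>2) = c) (at 1)" for d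
      by (rule eventually_compose_filterlim[OF ev filterlim_square_shift])
    from this[of "\<i> / 2"] this[of "- \<i> / 2"] nzmero_at(4)[OF Q, of 1]
    have "eventually (\<lambda>z. False) (at (1::complex))"
    proof eventually_elim
      case (elim z)
      have "z + - \<i> / 2 = z - \<i> / 2" by simp
      with elim show ?case by (simp only: wilson_quot_def) simp
    qed
    then show False by simp
  qed
qed

lemma wilson_diff_const: "wilson (\<lambda>x. f x - c) = wilson f"
  unfolding wilson_def wilson_quot_def by simp

text \<open>In the centred variable \<open>u = z + \<i> / 2\<close> the two nodes are
  \<open>z\<^sup>2\<close> and \<open>(z + \<i>)\<^sup>2\<close>, that is \<open>x\<close> and
  \<open>x\<^sup>+\<^sup>+\<close>, while \<open>u\<^sup>2\<close> is \<open>x\<^sup>+\<close>. The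
  second claim is the quotient rule: the Wilson quotient of \<open>1 / f\<close> is minus that of
  \<open>f\<close> divided by the product of the values of \<open>f\<close> at the nodes.\<close>

lemma wilson_local_orders:
  fixes z :: complex
  assumes f: "f meromorphic_on UNIV" "f \<notin> wilson_ker" and z: "z \<noteq> 0" "z + \<i> / 2 \<noteq> 0" "z + \<i> \<noteq> 0"
  defines "p \<equiv> zorder f (z\<^sup>2)" and "q \<equiv> zorder f ((z + \<i>)\<^sup>2)" and "d \<equiv> zorder (wilson f) ((z + \<i> / 2)\<^sup>2)"
  shows "d \<ge> min p q" "zorder (wilson (\<lambda>x. 1 / f x)) ((z + \<i> / 2)\<^sup>2) = d - p - q"
proof -
  let ?u = "z + \<i> / 2"
  define A where "A v = f ((v + (- \<i> / 2))\<^sup>2)" for v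
  define B where "B v = f ((v + \<i> / 2)\<^sup>2)" for v
  have nf: "nzmero f" using not_wilson_ker_nzmero(3)[OF f, of 0] by simp
  note Q = not_wilson_ker_nzmero(2)[OF f]
  have uz: "?u + - \<i> / 2 = z" "?u + \<i> / 2 = z + \<i>" by (simp_all add: field_simps)
  have A: "nzmero A" "zorder A ?u = p"
    using square_shift_nzmero(1)[OF nf, of "- \<i> / 2"] square_shift_nzmero(2)[OF nf, of ?u "- \<i> / 2"] z uz
    unfolding A_def p_def by simp_all
  have B: "nzmero B" "zorder B ?u = q"
    using square_shift_nzmero(1)[OF nf, of "\<i> / 2"] square_shift_nzmero(2)[OF nf, of ?u "\<i> / 2"] z uz
    unfolding B_def q_def by simp_all
  have Qeq: "wilson_quot f v = (B v - A v) / (2 * \<i> * v)" for v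
    by (simp add: wilson_quot_def A_def B_def)
  have lin: "nzmero (\<lambda>v. 2 * \<i> * v)" "zorder (\<lambda>v. 2 * \<i> * v) ?u = 0"
  proof -
    have "\<exists>\<^sub>F w in at 1. 2 * \<i> * w \<noteq> 0"
      using eventually_neq_at_within[of "0::complex" 1 UNIV] by (simp add: eventually_frequently)
    then show "nzmero (\<lambda>v. 2 * \<i> * v)"
      by (intro nzmeroI[of _ 1]) (auto intro!: meromorphic_intros)
    show "zorder (\<lambda>v. 2 * \<i> * v) ?u = 0"
      by (rule zorder_eq_0I) (use z in \<open>auto intro!: analytic_intros\<close>)
  qed
  have BA: "nzmero (\<lambda>v. B v - A v)"
  proof (rule nzmeroI)
    show "(\<lambda>v. B v - A v) meromorphic_on UNIV"
      using A(1) B(1) by (auto simp: nzmero_def intro!: meromorphic_intros)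
    have "eventually (\<lambda>v. B v - A v \<noteq> 0) (at ?u)"
      using nzmero_at(4)[OF Q, of ?u] by eventually_elim (auto simp: Qeq)
    then show "\<exists>\<^sub>F v in at ?u. B v - A v \<noteq> 0" by (simp add: eventually_frequently)
  qed
  have d: "d = zorder (\<lambda>v. B v - A v) ?u"
  proof -
    have "d = zorder (wilson_quot f) ?u"
      unfolding d_def by (rule zorder_wilson_square[OF f(1) Q z(2)])
    also have "\<dots> = zorder (\<lambda>v. B v - A v) ?u"
      unfolding Qeq[abs_def] using zorder_divide[OF nzmero_at(1,5)[OF BA] nzmero_at(1,5)[OF lin(1)]] lin(2) by simp
    finally show ?thesis .
  qed
  show "d \<ge> min p q"
    unfolding d
  proof (rule zorder_diff_ge[OF nzmero_at(1,5)[OF B(1)] nzmero_at(1,5)[OF A(1)]])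
    show "\<exists>\<^sub>F z in at ?u. B z \<noteq> A z"
      using nzmero_at(5)[OF BA, of ?u] by simp
  qed (use A B in auto)
  let ?f = "\<lambda>x. 1 / f x"
  have m': "?f meromorphic_on UNIV" using f(1) by (intro meromorphic_intros)
  have AB: "nzmero (\<lambda>v. A v * B v)" "zorder (\<lambda>v. A v * B v) ?u = p + q"
  proof -
    have "eventually (\<lambda>v. A v * B v \<noteq> 0) (at x)" for x
      using nzmero_at(4)[OF A(1), of x] nzmero_at(4)[OF B(1), of x] by eventually_elim simp
    then show "nzmero (\<lambda>v. A v * B v)"
      using A(1) B(1) by (auto simp: nzmero_def intro!: meromorphic_intros)
    show "zorder (\<lambda>v. A v * B v) ?u = p + q"
      using zorder_mult[OF nzmero_at(1,5)[OF A(1)] nzmero_at(1,5)[OF B(1)]] A B by simp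
  qed
  have eqQ: "eventually (\<lambda>v. wilson_quot ?f v = - (wilson_quot f v / (A v * B v))) (at x)" for x
    using nzmero_at(4)[OF A(1), of x] nzmero_at(4)[OF B(1), of x]
  proof eventually_elim
    case (elim v)
    have "wilson_quot ?f v = (1 / B v - 1 / A v) / (2 * \<i> * v)"
      by (simp add: wilson_quot_def A_def B_def)
    also have "1 / B v - 1 / A v = - ((B v - A v) / (A v * B v))"
      using elim by (simp add: diff_frac_eq) (metis minus_diff_eq minus_divide_left mult.commute)
    finally show ?case
      unfolding Qeq by (metis divide_divide_eq_left minus_divide_left mult.commute)
  qed
  have Q': "nzmero (wilson_quot ?f)"
  proof (rule nzmeroI)
    show "wilson_quot ?f meromorphic_on UNIV" by (rule wilson_quot_meromorphic[OF m'])
    have "eventually (\<lambda>v. wilson_quot ?f v \<noteq> 0) (at 1)"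
      using eqQ[of 1] nzmero_at(4)[OF AB(1), of 1] nzmero_at(4)[OF Q, of 1] by eventually_elim simp
    then show "\<exists>\<^sub>F v in at 1. wilson_quot ?f v \<noteq> 0" by (simp add: eventually_frequently)
  qed
  have "zorder (wilson ?f) (?u\<^sup>2) = zorder (wilson_quot ?f) ?u"
    by (rule zorder_wilson_square[OF m' Q' z(2)])
  also have "\<dots> = zorder (\<lambda>v. - (wilson_quot f v / (A v * B v))) ?u"
    by (rule zorder_cong[OF eqQ refl])
  also have "\<dots> = zorder (\<lambda>v. wilson_quot f v / (A v * B v)) ?u"
    by simp
  also have "\<dots> = zorder (wilson_quot f) ?u - (p + q)"
    using zorder_divide[OF nzmero_at(1,5)[OF Q] nzmero_at(1,5)[OF AB(1)]] AB(2) by simp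
  also have "zorder (wilson_quot f) ?u = d"
    unfolding d_def by (rule zorder_wilson_square[OF f(1) Q z(2), symmetric])
  finally show "zorder (wilson ?f) (?u\<^sup>2) = d - p - q" by simp
qed

section \<open>Wilson weights at a single point\<close>

definition wilson_weight :: "(complex \<Rightarrow> complex) \<Rightarrow> (complex \<Rightarrow> complex) \<Rightarrow> complex \<Rightarrow> int" where
  "wilson_weight s f x = (if is_pole f x
     then max 0 (pole_order f x - zero_order (wilson (\<lambda>w. 1 / f w)) (wilson_plus s x)) else 0)"

text \<open>The amount by which the Wilson count of \<open>c\<close>-points falls short of the
  ordinary count at \<open>x\<close>; it is the smaller of the multiplicity and the zero order of
  \<open>wilson f\<close> at \<open>x\<^sup>+\<close>.\<close>

definition wilson_excess :: "(complex \<Rightarrow> complex) \<Rightarrow> (complex \<Rightarrow> complex) \<Rightarrow> complex \<Rightarrow> complex \<Rightarrow> int" where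
  "wilson_excess s f c x = pole_order (\<lambda>v. 1 / (f v - c)) x - wilson_weight s (\<lambda>v. 1 / (f v - c)) x"

lemma wilson_weight_bounds: "0 \<le> wilson_weight s f x" "nzmero f \<Longrightarrow> wilson_weight s f x \<le> pole_order f x"
proof -
  show "0 \<le> wilson_weight s f x"
    by (simp add: wilson_weight_def)
  show "wilson_weight s f x \<le> pole_order f x" if "nzmero f"
    using pole_order_eq(1)[OF that, of x] unfolding wilson_weight_def zero_order_def by simp
qed

lemma zorder_diff_pos_unique:
  assumes "nzmero (\<lambda>x. f x - a)" "nzmero (\<lambda>x. f x - b)"
    "zorder (\<lambda>x. f x - a) x > 0" "zorder (\<lambda>x. f x - b) x > 0"
  shows "a = b"
proof -
  have "(\<lambda>w. f w - a) \<midarrow>x\<rightarrow> 0" "(\<lambda>w. f w - b) \<midarrow>x\<rightarrow> 0"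
    using zorder_pos_imp_isolated_zero[OF nzmero_at(1,4)[OF assms(1)] assms(3)]
      zorder_pos_imp_isolated_zero[OF nzmero_at(1,4)[OF assms(2)] assms(4)]
    by (auto simp: isolated_zero_def)
  from tendsto_diff[OF this] have "(\<lambda>w. b - a) \<midarrow>x\<rightarrow> 0" by simp
  then show ?thesis
    by (simp add: tendsto_const_iff)
qed

text \<open>Only one value can be approached at \<open>x\<close>, so at most one excess is nonzero,
  and none if \<open>x\<close> is a pole. What remains are two cases in the integers
  \<open>p\<close>, \<open>k\<close>, \<open>d\<close>, settled by \<open>d \<ge> min p k\<close>
  and the order of the Wilson derivative of \<open>1 / f\<close>.\<close>

lemma wilson_local_inequality:
  fixes y :: "nat \<Rightarrow> complex"
  assumes f: "f meromorphic_on UNIV" "f \<notin> wilson_ker" and y: "inj_on y {1..q}"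
    and z: "s x = z" "z\<^sup>2 = x" "z \<noteq> 0" "z + \<i> / 2 \<noteq> 0" "z + \<i> \<noteq> 0"
  defines "w \<equiv> wilson_plus s x"
  shows "- zorder (wilson f) w + (\<Sum>n=1..q. wilson_excess s f (y n) x)
    \<le> pole_order f ((z + \<i>)\<^sup>2) + wilson_weight s f x"
proof -
  have w: "w = (z + \<i> / 2)\<^sup>2" by (simp add: w_def wilson_plus_def z)
  have nf: "nzmero f" using not_wilson_ker_nzmero(3)[OF f, of 0] by simp
  have ny: "nzmero (\<lambda>x. f x - y n)" for n by (rule not_wilson_ker_nzmero(3)[OF f])
  define d where "d = zorder (wilson f) w"
  define p where "p = zorder f x"
  define k where "k = zorder f ((z + \<i>)\<^sup>2)"
  have ord: "d \<ge> min p k" "zorder (wilson (\<lambda>x. 1 / f x)) w = d - p - k"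
    using wilson_local_orders[OF f z(3,4,5)] unfolding d_def p_def k_def w z(2) by auto
  define m where "m n = max 0 (zorder (\<lambda>x. f x - y n) x)" for n
  \<comment> \<open>The reciprocal of \<open>1 / (f - y n)\<close> is \<open>f - y n\<close>, whose
    Wilson derivative does not depend on \<open>y n\<close>; hence the same \<open>d\<close> occurs
    for every \<open>n\<close>.\<close>
  have diff: "wilson_excess s f (y n) x = min (m n) (max 0 d)" for n
  proof -
    have P: "pole_order (\<lambda>v. 1 / (f v - y n)) x = m n"
      using pole_order_inverse[OF ny] by (simp add: m_def)
    have "is_pole (\<lambda>v. 1 / (f v - y n)) x \<longleftrightarrow> m n > 0"
      using pole_order_eq(2)[OF nzmero_inverse[OF ny]] zorder_inverse'[OF ny] by (auto simp: m_def)
    then have "wilson_weight s (\<lambda>v. 1 / (f v - y n)) x = (if m n > 0 then max 0 (m n - max 0 d) else 0)"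
      unfolding wilson_weight_def P zero_order_def by (simp add: wilson_diff_const d_def w_def)
    then show ?thesis
      unfolding wilson_excess_def P by (simp add: m_def; linarith)
  qed
  have m0: "m n \<ge> 0" for n by (simp add: m_def)
  have sum_le: "(\<Sum>n=1..q. min (m n) (max 0 d)) \<le> (if p < 0 then 0 else max 0 d)"
  proof (cases "\<exists>n\<in>{1..q}. m n > 0")
    case False
    then have "m n = 0" if "n \<in> {1..q}" for n
      using that m0[of n] by (meson antisym not_le)
    then have "(\<Sum>n=1..q. min (m n) (max 0 d)) = 0" by (intro sum.neutral) auto
    then show ?thesis by auto
  next
    case True
    then obtain n where n: "n \<in> {1..q}" "m n > 0" by blast
    have np: "\<not> p < 0"
    proof
      assume "p < 0"
      then have "is_pole f x" using pole_order_eq(2)[OF nf] by (simp add: p_def)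
      then have "zorder (\<lambda>x. f x - y n) x < 0"
        using pole_order_eq(2)[OF ny] by (simp add: is_pole_diff_const)
      with n show False by (simp add: m_def)
    qed
    have "m k = 0" if "k \<in> {1..q} - {n}" for k
    proof (rule ccontr)
      assume "m k \<noteq> 0"
      then have "y k = y n"
        using n by (intro zorder_diff_pos_unique[OF ny ny, of k x n]) (auto simp: m_def split: if_splits)
      with that n y show False by (auto dest: inj_onD)
    qed
    then have "(\<Sum>k\<in>{1..q} - {n}. min (m k) (max 0 d)) = 0"
      by (intro sum.neutral) auto
    then have "(\<Sum>k=1..q. min (m k) (max 0 d)) = min (m n) (max 0 d)"
      using n by (subst sum.remove[of _ n]) auto
    with np show ?thesis by auto
  qed
  have W: "wilson_weight s f x = (if p < 0 then max 0 (- p - max 0 (d - p - k)) else 0)"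
    using pole_order_eq[OF nf] ord(2) by (auto simp: wilson_weight_def zero_order_def p_def w_def[symmetric])
  have "- d + (if p < 0 then 0 else max 0 d) \<le> max 0 (- k) + wilson_weight s f x"
    unfolding W using ord(1) by (cases "p < 0"; simp; linarith)
  then show ?thesis
    unfolding diff using sum_le pole_order_eq(1)[OF nf, of "(z + \<i>)\<^sup>2"]
    by (simp add: d_def k_def)
qed

subsection \<open>Error terms\<close>

text \<open>A one-sided version of big O: no absolute value of \<open>g\<close> is taken, since the
  error expressions are only bounded from above and may be very negative.\<close>

definition dominated :: "(real \<Rightarrow> real) \<Rightarrow> (real \<Rightarrow> real) \<Rightarrow> bool" where
  "dominated h g \<longleftrightarrow> (\<exists>C\<ge>0. \<forall>\<^sub>F r in at_top. g r \<le> C * h r)"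

lemma dominatedI:
  assumes "\<forall>\<^sub>F r in at_top. 0 \<le> h r" "\<forall>\<^sub>F r in at_top. g r \<le> C * h r"
  shows "dominated h g"
proof -
  have "\<forall>\<^sub>F r in at_top. g r \<le> max 0 C * h r"
    using assms
  proof eventually_elim
    case (elim r)
    have "C * h r \<le> max 0 C * h r"
      using elim by (intro mult_right_mono) auto
    with elim show ?case by linarith
  qed
  then show ?thesis
    unfolding dominated_def by (intro exI[of _ "max 0 C"]) auto
qed

lemma dominated_mono:
  assumes "dominated h g" "\<forall>\<^sub>F r in at_top. f r \<le> g r"
  shows "dominated h f"
proof -
  obtain C where "C \<ge> 0" "\<forall>\<^sub>F r in at_top. g r \<le> C * h r"
    using assms(1) by (auto simp: dominated_def)
  moreover from this(2) assms(2) have "\<forall>\<^sub>F r in at_top. f r \<le> C * h r"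
    by eventually_elim linarith
  ultimately show ?thesis by (auto simp: dominated_def)
qed

lemma dominated_add:
  assumes "dominated h f" "dominated h g"
  shows "dominated h (\<lambda>r. f r + g r)"
proof -
  obtain C D where CD: "C \<ge> 0" "D \<ge> 0"
    "\<forall>\<^sub>F r in at_top. f r \<le> C * h r" "\<forall>\<^sub>F r in at_top. g r \<le> D * h r"
    using assms by (auto simp: dominated_def)
  from CD(3,4) have "\<forall>\<^sub>F r in at_top. f r + g r \<le> (C + D) * h r"
    by eventually_elim (simp add: distrib_right)
  with CD(1,2) show ?thesis
    unfolding dominated_def by (intro exI[of _ "C + D"]) auto
qed

lemma dominated_cmult:
  assumes "dominated h f" "c \<ge> 0"
  shows "dominated h (\<lambda>r. c * f r)"
proof -
  obtain C where C: "C \<ge> 0" "\<forall>\<^sub>F r in at_top. f r \<le> C * h r"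
    using assms by (auto simp: dominated_def)
  from C(2) have "\<forall>\<^sub>F r in at_top. c * f r \<le> (c * C) * h r"
    by eventually_elim (use assms(2) in \<open>simp add: mult_left_mono mult.assoc\<close>)
  with C(1) assms(2) show ?thesis
    unfolding dominated_def by (intro exI[of _ "c * C"]) auto
qed

lemma dominated_sum:
  assumes "\<And>n. n \<in> A \<Longrightarrow> dominated h (w n)"
  shows "dominated h (\<lambda>r. \<Sum>n\<in>A. w n r)"
  using assms
proof (induction A rule: infinite_finite_induct)
  case (insert a A)
  have "dominated h (\<lambda>r. w a r + (\<Sum>n\<in>A. w n r))"
    by (rule dominated_add) (use insert in simp_all)
  then show ?case using insert.hyps by simp
qed (auto simp: dominated_def)

abbreviation err :: "real \<Rightarrow> (real \<Rightarrow> real) \<Rightarrow> bool" where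
  "err \<delta> \<equiv> dominated (\<lambda>r. r powr \<delta> + ln r)"

text \<open>The additive constant absorbs the bounded term of the first main theorem when \<open>\<beta> < 0\<close>.\<close>

abbreviation grow :: "real \<Rightarrow> (real \<Rightarrow> real) \<Rightarrow> bool" where
  "grow \<beta> \<equiv> dominated (\<lambda>r. r powr \<beta> + 1)"

lemma errI:
  assumes "\<forall>\<^sub>F r in at_top. g r \<le> C * (r powr \<delta> + ln r)"
  shows "err \<delta> g"
proof (rule dominatedI[OF _ assms])
  show "\<forall>\<^sub>F r in at_top. 0 \<le> r powr \<delta> + ln r"
    using eventually_ge_at_top[of 1] by eventually_elim simp
qed

lemma err_ln: "err \<delta> (\<lambda>r. c * ln r)"
proof (rule errI)
  show "\<forall>\<^sub>F r in at_top. c * ln r \<le> \<bar>c\<bar> * (r powr \<delta> + ln r)"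
    using eventually_ge_at_top[of 1]
  proof eventually_elim
    case (elim r)
    have "c * ln r \<le> \<bar>c\<bar> * ln r" using elim by (intro mult_right_mono) auto
    also have "\<dots> \<le> \<bar>c\<bar> * (r powr \<delta> + ln r)" by (intro mult_left_mono) auto
    finally show ?case .
  qed
qed

text \<open>Eventually \<open>ln r \<ge> 1\<close>, so constants are absorbed even when the exponent
  \<delta> is negative.\<close>

lemma err_const: "err \<delta> (\<lambda>r. c)"
proof (rule dominated_mono[OF err_ln])
  show "\<forall>\<^sub>F r in at_top. c \<le> \<bar>c\<bar> * ln r"
    using eventually_ge_at_top[of "exp 1"]
  proof eventually_elim
    case (elim r)
    have "ln (exp 1) \<le> ln r"
      using elim less_le_trans[OF exp_gt_zero elim] by (subst ln_le_cancel_iff) auto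
    then have "\<bar>c\<bar> * 1 \<le> \<bar>c\<bar> * ln r" by (intro mult_left_mono) auto
    then show ?case by linarith
  qed
qed

lemma err_powr:
  assumes "\<tau> \<le> \<delta>"
  shows "err \<delta> (\<lambda>r. c * r powr \<tau>)"
proof (rule errI)
  show "\<forall>\<^sub>F r in at_top. c * r powr \<tau> \<le> \<bar>c\<bar> * (r powr \<delta> + ln r)"
    using eventually_ge_at_top[of 1]
  proof eventually_elim
    case (elim r)
    have "c * r powr \<tau> \<le> \<bar>c\<bar> * r powr \<delta>" using elim assms by (intro mult_mono powr_mono) auto
    also have "\<dots> \<le> \<bar>c\<bar> * (r powr \<delta> + ln r)" using elim by (intro mult_left_mono) auto
    finally show ?case .
  qed
qed

lemma growI:
  assumes "\<forall>\<^sub>F r in at_top. g r \<le> A * r powr \<beta> + c"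
  shows "grow \<beta> g"
proof (rule dominatedI)
  show "\<forall>\<^sub>F r in at_top. g r \<le> max A c * (r powr \<beta> + 1)"
    using assms
  proof eventually_elim
    case (elim r)
    have "A * r powr \<beta> \<le> max A c * r powr \<beta>" by (intro mult_right_mono) auto
    with elim show ?case unfolding distrib_left by linarith
  qed
qed simp

lemma growE:
  assumes "grow \<beta> g"
  obtains A where "A \<ge> 0" "\<forall>\<^sub>F r in at_top. g r \<le> A * r powr \<beta> + A"
  using assms by (auto simp: dominated_def distrib_left)

lemma grow_const: "grow \<beta> (\<lambda>r. c)"
  by (rule growI[of _ 0 _ c]) simp

text \<open>Polynomial growth makes a fixed enlargement of the radius harmless; this replaces growth
  lemmas with exceptional sets.\<close>

lemma grow_scale:
  assumes "grow \<beta> f" "k > 0"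
  shows "grow \<beta> (\<lambda>r. f (k * r))"
proof -
  obtain A where ev: "\<forall>\<^sub>F r in at_top. f r \<le> A * r powr \<beta> + A"
    using growE[OF assms(1)] by metis
  have "filterlim (\<lambda>r. k * r) at_top at_top"
    using assms(2) by (intro filterlim_tendsto_pos_mult_at_top[OF tendsto_const] filterlim_ident)
  with ev have "\<forall>\<^sub>F r in at_top. f (k * r) \<le> A * (k * r) powr \<beta> + A"
    by (rule eventually_compose_filterlim)
  then have "\<forall>\<^sub>F r in at_top. f (k * r) \<le> (A * k powr \<beta>) * r powr \<beta> + A"
    using eventually_ge_at_top[of 0]
    by eventually_elim (use assms(2) in \<open>simp add: powr_mult mult_ac\<close>)
  then show ?thesis by (rule growI)
qed

lemma grow_imp_err:
  assumes "grow \<beta> f" "\<alpha> \<ge> 0" "\<beta> - \<alpha> \<le> \<delta>" "k \<ge> 0"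
  shows "err \<delta> (\<lambda>r. k * r powr - \<alpha> * f r)"
proof -
  obtain A where Ac: "A \<ge> 0" "\<forall>\<^sub>F r in at_top. f r \<le> A * r powr \<beta> + A"
    using growE[OF assms(1)] by metis
  have "\<forall>\<^sub>F r in at_top. k * r powr - \<alpha> * f r \<le> (k * A) * r powr (\<beta> - \<alpha>) + k * A"
    using Ac(2) eventually_ge_at_top[of 1]
  proof eventually_elim
    case (elim r)
    have le1: "r powr - \<alpha> \<le> 1"
      using elim assms powr_mono[of "- \<alpha>" 0 r] by simp
    have "k * r powr - \<alpha> * f r \<le> k * r powr - \<alpha> * (A * r powr \<beta> + A)"
      using elim assms by (intro mult_left_mono) auto
    also have "\<dots> = (k * A) * (r powr \<beta> * r powr - \<alpha>) + (k * A) * r powr - \<alpha>"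
      by (simp add: algebra_simps)
    also have "r powr \<beta> * r powr - \<alpha> = r powr (\<beta> - \<alpha>)"
      by (simp add: powr_add[symmetric])
    also have "(k * A) * r powr - \<alpha> \<le> (k * A) * 1"
      using le1 Ac assms by (intro mult_left_mono) auto
    finally show ?case by simp
  qed
  with dominated_add[OF err_powr[OF assms(3)] err_const] show ?thesis
    by (rule dominated_mono)
qed

subsection \<open>Proximity of the logarithmic Wilson difference\<close>

lemma nevanlinna_N_nonneg:
  assumes "nzmero h" "r \<ge> 1"
  shows "nevanlinna_N r h \<ge> 0"
proof -
  have "lcount (\<lambda>x. of_int (pole_order h x)) r \<ge> 0"
    unfolding lcount_def using assms by (intro sum_nonneg mult_nonneg_nonneg logr_nonneg) (auto simp: pole_order_eq)
  then show ?thesis using assms by (simp add: nevanlinna_N_lcount)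
qed

lemma proximity_le_T: "nzmero h \<Longrightarrow> r \<ge> 1 \<Longrightarrow> proximity r h \<le> nevanlinna_T r h"
  using nevanlinna_N_nonneg[of h r] by (simp add: nevanlinna_T_def)

lemma grow_T_diff_const:
  assumes "nzmero f" "nzmero (\<lambda>x. f x - c)" "grow \<beta> (\<lambda>r. nevanlinna_T r f)"
  shows "grow \<beta> (\<lambda>r. nevanlinna_T r (\<lambda>x. 1 / (f x - c)))" "grow \<beta> (\<lambda>r. nevanlinna_T r (\<lambda>x. f x - c))"
proof -
  let ?k = "ln_plus (norm c) + ln 2 + \<bar>log_lead (\<lambda>x. f x - c)\<bar>"
  have "\<forall>\<^sub>F r in at_top. nevanlinna_T r (\<lambda>x. 1 / (f x - c)) \<le> nevanlinna_T r f + ?k"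
    using eventually_gt_at_top[of 0]
  proof eventually_elim
    case (elim r)
    then show ?case using first_main_theorem[OF assms(1,2) elim] by linarith
  qed
  then show 1: "grow \<beta> (\<lambda>r. nevanlinna_T r (\<lambda>x. 1 / (f x - c)))"
    by (rule dominated_mono[OF dominated_add[OF assms(3) grow_const]])
  have "\<forall>\<^sub>F r in at_top. nevanlinna_T r (\<lambda>x. f x - c) \<le> nevanlinna_T r (\<lambda>x. 1 / (f x - c)) + log_lead (\<lambda>x. f x - c)"
    using eventually_gt_at_top[of 0]
    by eventually_elim (simp add: nevanlinna_T_inverse[OF assms(2)])
  then show "grow \<beta> (\<lambda>r. nevanlinna_T r (\<lambda>x. f x - c))"
    by (rule dominated_mono[OF dominated_add[OF 1 grow_const]])
qed

text \<open>The constant \<open>y\<close> cancels in the difference of the values at the two nodes,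
  and the denominator has modulus \<open>2 * sqrt r \<ge> 1\<close>. So the quotient is at most the
  sum of the two shifted quotients of \<open>h\<close>, each covered by
  \<open>log_shift_bound\<close>.\<close>

lemma proximity_wilson_quot_le:
  fixes y :: complex
  assumes f: "f meromorphic_on UNIV" "f \<notin> wilson_ker" and \<alpha>: "0 < \<alpha>" "\<alpha> < 1" and r: "r \<ge> 4"
    and K: "\<And>c. cint (\<lambda>t. norm (cis (t / 2) - c) powr - \<alpha>)"
      "\<And>c. cavg (\<lambda>t. norm (cis (t / 2) - c) powr - \<alpha>) \<le> K"
  defines "h \<equiv> \<lambda>x. f x - y"
  shows "proximity r (\<lambda>x. wilson f x / h x) \<le> ln 2 + 2 * shift_error h \<alpha> K r"
    (is "_ \<le> ln 2 + 2 * ?E")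
proof -
  have h: "nzmero h" unfolding h_def by (rule not_wilson_ker_nzmero(3)[OF f])
  note W = not_wilson_ker_nzmero(1)[OF f]
  have Wh: "nzmero (\<lambda>x. wilson f x / h x)"
    by (rule nzmero_divide[OF W h])
  define \<rho> where "\<rho> = sqrt r"
  have \<rho>: "\<rho> \<ge> 2" "\<rho>\<^sup>2 = r" using r real_le_rsqrt[of 2 r] by (auto simp: \<rho>_def)
  let ?z = "\<lambda>t. of_real \<rho> * cis (t / 2) :: complex"
  have z2: "(?z t)\<^sup>2 = of_real r * cis t" for t
    by (simp only: square_half_circle \<rho>)
  have n1: "norm (\<i> / 2) = 1 / 2" "norm (- \<i> / 2) = 1 / 2" by (simp_all add: norm_divide)
  obtain U1 B1 where 1: "finite B1" "cint U1"
    "\<And>t. t \<in> {0..2*pi} - B1 \<Longrightarrow> ln_plus (norm (h ((?z t + \<i> / 2)\<^sup>2)) / norm (h (of_real r * cis t))) \<le> U1 t"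
    "cavg U1 \<le> ?E"
    using log_shift_bound[OF h \<alpha> r n1(1) K] unfolding \<rho>_def by metis
  obtain U2 B2 where 2: "finite B2" "cint U2"
    "\<And>t. t \<in> {0..2*pi} - B2 \<Longrightarrow> ln_plus (norm (h ((?z t + - \<i> / 2)\<^sup>2)) / norm (h (of_real r * cis t))) \<le> U2 t"
    "cavg U2 \<le> ?E"
    using log_shift_bound[OF h \<alpha> r n1(2) K] unfolding \<rho>_def by metis
  \<comment> \<open>The formula \<open>wilson_eq\<close> needs continuity of \<open>f\<close> at
    both nodes; the parameters for which a node is not a regular point are finite in number.\<close>
  define S where "S = {x \<in> cball 0 ((\<rho> + 1)\<^sup>2). \<not> f analytic_on {x}}"
  have S: "finite S"
    unfolding S_def by (intro finite_cball_cosparse meromorphic_eventually_analytic f)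
  define B where "B = B1 \<union> B2 \<union> {t \<in> {0..2*pi}. (?z t + \<i> / 2)\<^sup>2 \<in> S} \<union> {t \<in> {0..2*pi}. (?z t + - \<i> / 2)\<^sup>2 \<in> S}"
  have B: "finite B"
    unfolding B_def using \<rho> by (intro finite_UnI finite_half_circle_vimage 1 2 S) auto
  have i: "cint (\<lambda>t. U1 t + U2 t + ln 2)" by (intro cint_add 1 2 cint_const)
  have "proximity r (\<lambda>x. wilson f x / h x) \<le> cavg (\<lambda>t. U1 t + U2 t + ln 2)"
    unfolding proximity_cavg
  proof (rule cavg_mono[OF _ i B])
    show "cint (\<lambda>t. ln_plus (norm (wilson f (of_real r * cis t) / h (of_real r * cis t))))"
      using cint_ln_plus[OF Wh, of r] r by simp
    fix t assume t: "t \<in> {0..2*pi} - B"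
    define xp xm where "xp = (?z t + \<i> / 2)\<^sup>2" and "xm = (?z t + - \<i> / 2)\<^sup>2"
    have nz: "norm (?z t) = \<rho>" using \<rho> by (simp add: norm_mult)
    have nn: "norm ((?z t + c)\<^sup>2) \<le> (\<rho> + 1)\<^sup>2" if "norm c = 1 / 2" for c
    proof -
      have "norm (?z t + c) \<le> \<rho> + 1"
        using norm_triangle_ineq[of "?z t" c] nz that by linarith
      then show ?thesis by (simp only: norm_power power_mono norm_ge_zero)
    qed
    have an: "f analytic_on {xp}" "f analytic_on {xm}"
      using t nn[OF n1(1)] nn[OF n1(2)] unfolding B_def S_def xp_def xm_def by auto
    have "wilson f ((?z t)\<^sup>2) = wilson_quot f (?z t)"
    proof (rule wilson_eq)
      show "?z t \<noteq> 0" using nz \<rho> by (metis norm_zero not_numeral_le_zero)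
      show "isCont f ((?z t + \<i> / 2)\<^sup>2)" "isCont f ((?z t - \<i> / 2)\<^sup>2)"
        using an[THEN analytic_at_imp_isCont] by (simp_all add: xp_def xm_def)
    qed
    also have "\<dots> = (h xp - h xm) / (2 * \<i> * ?z t)"
      by (simp add: wilson_quot_def xp_def xm_def h_def)
    finally have D: "norm (wilson f (of_real r * cis t)) = norm (h xp - h xm) / (2 * \<rho>)"
      unfolding z2 using nz by (simp add: norm_divide norm_mult)
    let ?H = "norm (h (of_real r * cis t))"
    have "norm (h xp - h xm) / (2 * \<rho>) \<le> norm (h xp - h xm) / 1"
      using \<rho> by (intro divide_left_mono) auto
    then have "norm (wilson f (of_real r * cis t)) \<le> norm (h xp) + norm (h xm)"
      unfolding D using norm_triangle_ineq4[of "h xp" "h xm"] by simp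
    then have "norm (wilson f (of_real r * cis t) / h (of_real r * cis t)) \<le> norm (h xp) / ?H + norm (h xm) / ?H"
      unfolding norm_divide add_divide_distrib[symmetric] by (rule divide_right_mono) simp
    then have "ln_plus (norm (wilson f (of_real r * cis t) / h (of_real r * cis t))) \<le> ln_plus (norm (h xp) / ?H + norm (h xm) / ?H)"
      by (rule ln_plus_mono)
    also have "\<dots> \<le> ln_plus (norm (h xp) / ?H) + ln_plus (norm (h xm) / ?H) + ln 2"
      by (intro ln_plus_add) auto
    also have "\<dots> \<le> U1 t + U2 t + ln 2"
      using 1(3)[of t] 2(3)[of t] t unfolding xp_def xm_def B_def by auto
    finally show "ln_plus (norm (wilson f (of_real r * cis t) / h (of_real r * cis t))) \<le> U1 t + U2 t + ln 2" .
  qed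
  also have "\<dots> = cavg U1 + cavg U2 + ln 2"
    by (simp add: cavg_add cint_add 1 2)
  finally have P: "proximity r (\<lambda>x. wilson f x / h x) \<le> cavg U1 + cavg U2 + ln 2" .
  have "p \<le> ln 2 + 2 * E" if "p \<le> u + v + ln 2" "u \<le> E" "v \<le> E" for p u v E :: real
    using that by linarith
  from this[OF P 1(4) 2(4)] show ?thesis .
qed

text \<open>Both parts of \<open>shift_error\<close> are brought to the common decay
  \<open>r powr - (\<alpha> / 2)\<close>; the first has the stronger factor
  \<open>1 / sqrt r\<close> because \<alpha> < 1.\<close>

lemma log_shift_bound_arith:
  fixes r \<alpha> K n p T4 T8 :: real
  assumes "r \<ge> 4" "0 < \<alpha>" "\<alpha> < 1" "K > 0" "n \<ge> 0" "ln 2 * n \<le> T8" "0 \<le> p" "p \<le> T4"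
  shows "ln 2 + 2 * (4 / sqrt r * (p + 2 * ln 2 * n) + 8 / \<alpha> * K * n * r powr (- \<alpha> / 2)) \<le>
    ln 2 + 16 * r powr - (\<alpha> / 2) * ((T4 + 2 * T8) + K / \<alpha> * (1 / ln 2) * T8)"
proof -
  define P where "P = r powr - (\<alpha> / 2)"
  have P: "P \<ge> 0" by (simp add: P_def)
  have "1 / sqrt r = r powr - (1 / 2)"
    using assms(1) by (simp add: powr_minus_divide powr_half_sqrt)
  also have "\<dots> \<le> P"
    unfolding P_def using assms by (intro powr_mono) auto
  finally have sq: "4 / sqrt r \<le> 8 * P"
    using P by simp
  have "4 / sqrt r * (p + 2 * ln 2 * n) \<le> 8 * P * (T4 + 2 * T8)"
  proof (rule mult_mono[OF sq])
    show "p + 2 * ln 2 * n \<le> T4 + 2 * T8" using assms by linarith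
    show "0 \<le> p + 2 * ln 2 * n" using assms by simp
  qed (use P in simp)
  moreover have "8 / \<alpha> * K * n * P \<le> 8 / \<alpha> * K * (1 / ln 2 * T8) * P"
  proof (intro mult_right_mono mult_left_mono P)
    show "n \<le> 1 / ln 2 * T8"
      using assms(6) pos_le_divide_eq[of "ln 2" n T8] by (simp add: mult.commute)
    show "0 \<le> 8 / \<alpha> * K" using assms by simp
  qed
  moreover have "ln 2 + 2 * (8 * P * T + 8 / \<alpha> * K * (1 / ln 2 * T8) * P) =
      ln 2 + 16 * P * (T + K / \<alpha> * (1 / ln 2) * T8)" for T
    by (simp add: algebra_simps)
  moreover have "- \<alpha> / 2 = - (\<alpha> / 2)" by simp
  ultimately show ?thesis
    unfolding P_def by (smt (verit))
qed

lemma err_proximity_wilson_quot: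
  fixes y :: complex
  assumes f: "f meromorphic_on UNIV" "f \<notin> wilson_ker" and g: "grow \<beta> (\<lambda>r. nevanlinna_T r f)"
    and \<alpha>: "0 < \<alpha>" "\<alpha> < 1" "\<beta> - \<alpha> / 2 \<le> \<delta>"
  shows "err \<delta> (\<lambda>r. proximity r (\<lambda>x. wilson f x / (f x - y)))"
proof -
  define h where "h = (\<lambda>x. f x - y)"
  have nf: "nzmero f" using not_wilson_ker_nzmero(3)[OF f, of 0] by simp
  have h: "nzmero h" unfolding h_def by (rule not_wilson_ker_nzmero(3)[OF f])
  obtain K where K: "K > 0" "\<And>c. cint (\<lambda>t. norm (cis (t / 2) - c) powr - \<alpha>)"
      "\<And>c. cavg (\<lambda>t. norm (cis (t / 2) - c) powr - \<alpha>) \<le> K"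
    using negpow_half_circle[OF \<alpha>(1,2)] by metis
  let ?T = "\<lambda>k r. nevanlinna_T (k * r) h + nevanlinna_T (k * r) (\<lambda>x. 1 / h x)"
  have gT: "grow \<beta> (?T k)" if "k > 0" for k
    unfolding h_def by (intro dominated_add grow_scale[OF grow_T_diff_const(1)] grow_scale[OF grow_T_diff_const(2)] nf g that h[unfolded h_def])
  \<comment> \<open>Radius \<open>4 * r\<close> comes from the factorization disc; counting zeros
    and poles in that disc costs one more doubling, hence \<open>8 * r\<close>.\<close>
  define G where "G r = (?T 4 r + 2 * ?T 8 r) + K / \<alpha> * (1 / ln 2) * ?T 8 r" for r
  have gT4: "grow \<beta> (?T 4)" and gT8: "grow \<beta> (?T 8)"
    by (rule gT, simp)+
  have "0 \<le> K / \<alpha> * (1 / ln 2)"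
    using K(1) \<alpha>(1) by simp
  then have G: "grow \<beta> G"
    unfolding G_def
    by (rule dominated_add[OF dominated_add[OF gT4 dominated_cmult[OF gT8]] dominated_cmult[OF gT8], rotated]) simp
  have "\<forall>\<^sub>F r in at_top. proximity r (\<lambda>x. wilson f x / h x) \<le> ln 2 + 16 * r powr - (\<alpha> / 2) * G r"
    using eventually_ge_at_top[of 4]
  proof eventually_elim
    case (elim r)
    have "2 * (4 * r) = 8 * r" and r1: "1 \<le> 4 * r" "0 < 4 * r"
      using elim by simp_all
    then have n: "ln 2 * zpcount h (4 * r) \<le> ?T 8 r"
      using zpcount_le[OF h r1(1)] by (simp only:)
    have p: "proximity (4 * r) h + proximity (4 * r) (\<lambda>x. 1 / h x) \<le> ?T 4 r"
      by (rule add_mono[OF proximity_le_T[OF h r1(1)] proximity_le_T[OF nzmero_inverse[OF h] r1(1)]])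
    have p0: "0 \<le> proximity (4 * r) h + proximity (4 * r) (\<lambda>x. 1 / h x)"
      by (rule add_nonneg_nonneg[OF proximity_nonneg[OF h r1(2)] proximity_nonneg[OF nzmero_inverse[OF h] r1(2)]])
    have "proximity r (\<lambda>x. wilson f x / h x) \<le> ln 2 + 2 * shift_error h \<alpha> K r"
      unfolding h_def by (rule proximity_wilson_quot_le[OF f \<alpha>(1,2) elim K(2,3)])
    from order_trans[OF this[unfolded shift_error_def] log_shift_bound_arith[OF elim \<alpha>(1,2) K(1) zpcount_nonneg n p0 p]]
    show ?case
      unfolding G_def .
  qed
  moreover have "err \<delta> (\<lambda>r. ln 2 + 16 * r powr - (\<alpha> / 2) * G r)"
    using \<alpha> by (intro dominated_add err_const grow_imp_err[OF G]) auto
  ultimately show ?thesis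
    unfolding h_def[symmetric] using dominated_mono by (simp add: h_def)
qed

subsection \<open>The branch and the shifts\<close>

text \<open>The sign \<open>\<tau>\<close> treats the right and the left half-plane at once; on the
  cut the branch takes the upper imaginary axis in either case.\<close>

lemma wilson_branch_half_plane:
  assumes "wilson_branch s"
  obtains \<tau> :: real where "\<tau> = 1 \<or> \<tau> = -1" "\<And>x. \<tau> * Re (s x) \<ge> 0" "\<And>x. Re (s x) = 0 \<Longrightarrow> Im (s x) \<ge> 0"
proof -
  have neg: "s x = \<i> * of_real (sqrt (- Re x))" "Re x \<le> 0" if "x \<in> \<real>\<^sub>\<le>\<^sub>0" for x
  proof -
    have x: "Re x \<le> 0" "x = of_real (- ((sqrt (- Re x))\<^sup>2))"
      using that by (auto simp: complex_nonpos_Reals_iff complex_eq_iff)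
    have "s (of_real (- ((sqrt (- Re x))\<^sup>2))) = \<i> * of_real (sqrt (- Re x))"
      using assms x(1) unfolding wilson_branch_def by (metis real_sqrt_ge_zero neg_0_le_iff_le)
    then show "s x = \<i> * of_real (sqrt (- Re x))" "Re x \<le> 0"
      using x by (simp_all only: x(2)[symmetric])
  qed
  then have n: "Re (s x) = 0" "Im (s x) \<ge> 0" if "x \<in> \<real>\<^sub>\<le>\<^sub>0" for x
    using neg[OF that] by simp_all
  from assms consider "\<forall>x. x \<notin> \<real>\<^sub>\<le>\<^sub>0 \<longrightarrow> Re (s x) > 0" | "\<forall>x. x \<notin> \<real>\<^sub>\<le>\<^sub>0 \<longrightarrow> Re (s x) < 0"
    by (auto simp: wilson_branch_def)
  then show ?thesis
  proof cases
    case 1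
    show ?thesis
    proof (rule that[of 1])
      fix x show "1 * Re (s x) \<ge> 0" using 1 n by (cases "x \<in> \<real>\<^sub>\<le>\<^sub>0") (auto simp: less_imp_le)
      show "Im (s x) \<ge> 0" if "Re (s x) = 0" using that 1 n(2)[of x] by (cases "x \<in> \<real>\<^sub>\<le>\<^sub>0") auto
    qed auto
  next
    case 2
    show ?thesis
    proof (rule that[of "-1"])
      fix x show "-1 * Re (s x) \<ge> 0" using 2 n by (cases "x \<in> \<real>\<^sub>\<le>\<^sub>0") (auto simp: less_imp_le)
      show "Im (s x) \<ge> 0" if "Re (s x) = 0" using that 2 n(2)[of x] by (cases "x \<in> \<real>\<^sub>\<le>\<^sub>0") auto
    qed auto
  qed
qed

lemma wilson_branch_square: "wilson_branch s \<Longrightarrow> (s x)\<^sup>2 = x"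
  by (simp only: wilson_branch_def)

lemma norm_wilson_branch:
  assumes "wilson_branch s"
  shows "norm (s x) = sqrt (norm x)"
proof -
  have "(norm (s x))\<^sup>2 = norm x"
    unfolding norm_power[symmetric] by (simp only: wilson_branch_square[OF assms])
  then have "sqrt ((norm (s x))\<^sup>2) = sqrt (norm x)" by (rule arg_cong)
  then show ?thesis by (simp only: real_sqrt_abs abs_norm_cancel)
qed

text \<open>Equal squares allow \<open>s x + \<i> * c = - (s y + \<i> * c)\<close>. Then the real
  parts, being of the same sign, both vanish, and the imaginary parts are nonnegative with negative
  sum, a contradiction.\<close>

lemma shift_inj:
  assumes s: "wilson_branch s" and c: "c > 0"
  shows "inj (\<lambda>x. (s x + \<i> * of_real c)\<^sup>2)"
proof (rule injI)
  obtain \<tau> :: real where \<tau>: "\<tau> = 1 \<or> \<tau> = -1" "\<And>x. \<tau> * Re (s x) \<ge> 0" "\<And>x. Re (s x) = 0 \<Longrightarrow> Im (s x) \<ge> 0"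
    using wilson_branch_half_plane[OF s] by metis
  fix x y assume "(s x + \<i> * of_real c)\<^sup>2 = (s y + \<i> * of_real c)\<^sup>2"
  then consider "s x + \<i> * of_real c = s y + \<i> * of_real c" | "s x + \<i> * of_real c = - (s y + \<i> * of_real c)"
    by (auto simp: power2_eq_iff)
  then show "x = y"
  proof cases
    case 1
    then have "(s x)\<^sup>2 = (s y)\<^sup>2" by simp
    then show ?thesis by (simp only: wilson_branch_square[OF s])
  next
    case 2
    then have "Re (s x) = - Re (s y)" and im: "Im (s x) + Im (s y) = - 2 * c"
      by (auto simp: complex_eq_iff)
    then have "Re (s x) = 0" "Re (s y) = 0"
      using \<tau>(1) \<tau>(2)[of x] \<tau>(2)[of y] by auto
    then show ?thesis using \<tau>(3)[of x] \<tau>(3)[of y] im c by simp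
  qed
qed

lemma wilson_plus_inj: "wilson_branch s \<Longrightarrow> inj (wilson_plus s)"
  using shift_inj[of s "1 / 2"] by (simp add: wilson_plus_def[abs_def])

lemma wilson_plus_plus_inj: "wilson_branch s \<Longrightarrow> inj (\<lambda>x. (s x + \<i>)\<^sup>2)"
  using shift_inj[of s 1] by simp

text \<open>Choose the square root \<open>u\<close> of \<open>w\<close> in the range of the branch;
  \<open>u - \<i> / 2\<close> still belongs to it, unless \<open>u\<close> lies low on the upper
  imaginary axis, with imaginary part at most 1/2. The bound on \<open>w\<close> excludes that
  case.\<close>

lemma wilson_plus_surj:
  assumes s: "wilson_branch s" and w: "norm w > 1"
  obtains x where "wilson_plus s x = w" "sqrt (norm x) \<le> sqrt (norm w) + 1 / 2"
proof -
  obtain \<tau> :: real where \<tau>: "\<tau> = 1 \<or> \<tau> = -1" "\<And>x. \<tau> * Re (s x) \<ge> 0" "\<And>x. Re (s x) = 0 \<Longrightarrow> Im (s x) \<ge> 0"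
    using wilson_branch_half_plane[OF s] by metis
  obtain u where u: "u\<^sup>2 = w" "\<tau> * Re u > 0 \<or> Re u = 0 \<and> Im u \<ge> 0"
  proof -
    have "0 < Re (csqrt w) \<or> Re (csqrt w) = 0 \<and> 0 \<le> Im (csqrt w)"
      by (rule csqrt_principal)
    then show ?thesis
      using that[of "csqrt w"] that[of "- csqrt w"] \<tau>(1) by (cases "Re (csqrt w) = 0") auto
  qed
  have "(norm u)\<^sup>2 = norm w" by (simp only: norm_power[symmetric] u(1))
  then have nu: "norm u = sqrt (norm w)" by (metis norm_ge_zero real_sqrt_unique)
  define z where "z = u - \<i> / 2"
  have "s (z\<^sup>2) = z"
  proof -
    have "s (z\<^sup>2) = z \<or> s (z\<^sup>2) = - z"
      using wilson_branch_square[OF s, of "z\<^sup>2"] by (simp only: power2_eq_iff)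
    moreover have False if eq: "s (z\<^sup>2) = - z"
    proof -
      have "\<tau> * Re u \<le> 0"
        using \<tau>(2)[of "z\<^sup>2"] unfolding eq by (simp add: z_def)
      with u(2) have u0: "Re u = 0" "Im u \<ge> 0" by auto
      have "Im (- z) \<ge> 0"
        using \<tau>(3)[of "z\<^sup>2"] u0 unfolding eq by (simp add: z_def)
      then have "Im u \<le> 1 / 2" by (simp add: z_def)
      moreover have "norm u = Im u" using u0 by (simp add: cmod_def)
      moreover have "sqrt (norm w) > 1" using w by simp
      ultimately show False using nu by simp
    qed
    ultimately show ?thesis by blast
  qed
  then have "wilson_plus s (z\<^sup>2) = w"
    by (simp add: wilson_plus_def z_def u)
  moreover have "sqrt (norm (z\<^sup>2)) \<le> sqrt (norm w) + 1 / 2"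
  proof -
    have "sqrt (norm (z\<^sup>2)) = norm z" by (simp add: norm_power)
    also have "\<dots> \<le> norm u + 1 / 2"
      unfolding z_def using norm_triangle_ineq4[of u "\<i> / 2"] by (simp add: norm_divide)
    finally show ?thesis by (simp add: nu)
  qed
  ultimately show ?thesis by (rule that)
qed

lemma norm_shift_le:
  assumes s: "wilson_branch s" and c: "norm c \<le> 1"
  shows "norm ((s x + c)\<^sup>2) \<le> (sqrt (norm x) + norm c)\<^sup>2" "norm x \<ge> 16 \<Longrightarrow> norm ((s x + c)\<^sup>2 - x) \<le> 3 * sqrt (norm x)"
proof -
  have n: "norm (s x) = sqrt (norm x)" by (rule norm_wilson_branch[OF s])
  show "norm ((s x + c)\<^sup>2) \<le> (sqrt (norm x) + norm c)\<^sup>2"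
    unfolding norm_power n[symmetric] by (intro power_mono norm_triangle_ineq) simp
  assume x: "norm x \<ge> 16"
  have "(s x + c)\<^sup>2 - (s x)\<^sup>2 = c * (2 * s x + c)"
    by (simp add: power2_eq_square algebra_simps)
  then have "norm ((s x + c)\<^sup>2 - x) = norm c * norm (2 * s x + c)"
    by (simp only: wilson_branch_square[OF s] norm_mult)
  also have "\<dots> \<le> 1 * (2 * sqrt (norm x) + 1)"
  proof (rule mult_mono[OF c])
    show "norm (2 * s x + c) \<le> 2 * sqrt (norm x) + 1"
      using norm_triangle_ineq[of "2 * s x" c] c n by (simp add: norm_mult)
  qed auto
  also have "\<dots> \<le> 3 * sqrt (norm x)"
    using real_le_rsqrt[of 1 "norm x"] x by simp
  finally show "norm ((s x + c)\<^sup>2 - x) \<le> 3 * sqrt (norm x)" .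
qed

lemma abs_ln_diff_le:
  fixes a b :: real
  assumes "0 < m" "m \<le> a" "m \<le> b"
  shows "\<bar>ln a - ln b\<bar> \<le> \<bar>a - b\<bar> / m"
proof -
  have *: "ln a - ln b \<le> \<bar>a - b\<bar> / m" if "0 < m" "m \<le> a" "m \<le> b" for a b :: real
  proof -
    have "ln a - ln b = ln (a / b)" using that by (simp add: ln_div)
    also have "\<dots> \<le> a / b - 1" using that by (intro ln_le_minus_one) auto
    also have "\<dots> = (a - b) / b" using that by (simp add: field_simps)
    also have "\<dots> \<le> \<bar>a - b\<bar> / b" using that by (intro divide_right_mono) auto
    also have "\<dots> \<le> \<bar>a - b\<bar> / m" using that by (intro divide_left_mono) auto
    finally show ?thesis .
  qed
  show ?thesis using *[OF assms] *[OF assms(1,3,2)] by (simp add: abs_le_iff abs_minus_commute)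
qed

lemma logr_lipschitz:
  assumes "r > 0" "u \<noteq> 0" "v \<noteq> 0"
  shows "\<bar>logr r u - logr r v\<bar> \<le> \<bar>ln (norm u) - ln (norm v)\<bar>"
  using assms by (auto simp: logr_def ln_div max_def)

text \<open>From \<open>norm x \<ge> 16\<close> one gets
  \<open>3 * sqrt (norm x) \<le> 3 / 4 * norm x\<close>, so \<open>v\<close> stays at modulus at
  least \<open>norm x / 4\<close>. The relative change of the modulus, with this lower bound, yields
  \<open>12 = 3 * 4\<close>.\<close>

lemma logr_near:
  assumes r: "r > 0" and x: "norm x \<ge> 16" and v: "norm (v - x) \<le> 3 * sqrt (norm x)"
  shows "norm v \<ge> norm x / 4" "norm v \<le> 2 * norm x" "\<bar>logr r v - logr r x\<bar> \<le> 12 / sqrt (norm x)"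
proof -
  define \<rho> where "\<rho> = sqrt (norm x)"
  have \<rho>: "\<rho> \<ge> 4" "norm x = \<rho> * \<rho>"
    using x real_le_rsqrt[of 4 "norm x"] by (auto simp: \<rho>_def)
  have "4 * \<rho> \<le> \<rho> * \<rho>" using \<rho> by (intro mult_right_mono) auto
  then have le: "4 * \<rho> \<le> norm x" by (simp only: \<rho>)
  have d: "\<bar>norm v - norm x\<bar> \<le> 3 * \<rho>"
    using v norm_triangle_ineq3[of v x] unfolding \<rho>_def by linarith
  show 1: "norm v \<ge> norm x / 4" and 2: "norm v \<le> 2 * norm x"
    using d le \<rho>(1) by linarith+
  have "v \<noteq> 0" "x \<noteq> 0" using 1 x by auto
  then have "\<bar>logr r v - logr r x\<bar> \<le> \<bar>ln (norm v) - ln (norm x)\<bar>"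
    by (rule logr_lipschitz[OF r])
  also have "\<dots> \<le> \<bar>norm v - norm x\<bar> / (norm x / 4)"
    using 1 x by (intro abs_ln_diff_le) auto
  also have "\<dots> \<le> 3 * \<rho> / (norm x / 4)"
    using d x by (intro divide_right_mono) auto
  also have "\<dots> = 12 / \<rho>"
    using \<rho> by (simp add: field_simps)
  finally show "\<bar>logr r v - logr r x\<bar> \<le> 12 / sqrt (norm x)" by (simp add: \<rho>_def)
qed

subsection \<open>Sums of inverse square roots\<close>

definition rsum :: "(complex \<Rightarrow> real) \<Rightarrow> real \<Rightarrow> real" where
  "rsum w R = (\<Sum>x | x \<in> cball 0 R \<and> w x \<noteq> 0 \<and> 1 \<le> norm x. w x / sqrt (norm x))"

lemma ncount_mono:
  assumes "lfin w" "\<And>x. 0 \<le> w x" "r \<le> R"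
  shows "ncount w r \<le> ncount w R"
  unfolding ncount_def by (rule sum_mono2) (use assms lfinD[OF assms(1)] in auto)

lemma ncount_le:
  assumes "lfin v" "\<And>x. 0 \<le> w x" "\<And>x. w x \<le> v x"
  shows "ncount w r \<le> ncount v r"
proof -
  have z: "w x = 0" if "v x = 0" for x using assms(2,3)[of x] that by simp
  have "ncount w r = (\<Sum>x | x \<in> cball 0 r \<and> v x \<noteq> 0. w x)"
    by (rule ncount_eq) (use z lfinD[OF assms(1)] in auto)
  also have "\<dots> \<le> ncount v r" unfolding ncount_def by (intro sum_mono assms)
  finally show ?thesis .
qed

text \<open>On the shell from \<open>2 ^ k\<close> to \<open>2 ^ Suc k\<close> the inverse square
  root is at most \<open>1 / sqrt (2 ^ k)\<close>, and the shell carries at most the full count up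
  to its outer radius.\<close>

lemma rsum_dyadic:
  assumes w: "lfin w" "\<And>x. 0 \<le> w x" and R: "R < 2 ^ K"
  shows "rsum w R \<le> (\<Sum>k<K. ncount w (2 ^ Suc k) / sqrt (2 ^ k))"
proof -
  have "(\<Sum>x | x \<in> cball 0 (2 ^ K) \<and> w x \<noteq> 0 \<and> 1 \<le> norm x \<and> norm x < 2 ^ K. w x / sqrt (norm x)) \<le>
      (\<Sum>k<K. ncount w (2 ^ Suc k) / sqrt (2 ^ k))"
  proof (induction K)
    case 0
    have "{x::complex. x \<in> cball 0 (2 ^ 0) \<and> w x \<noteq> 0 \<and> 1 \<le> norm x \<and> norm x < 2 ^ 0} = {}" by auto
    then show ?case by (simp only: sum.empty) simp
  next
    case (Suc K)
    let ?A = "\<lambda>K. {x. x \<in> cball 0 (2 ^ K) \<and> w x \<noteq> 0 \<and> 1 \<le> norm x \<and> norm x < 2 ^ K}"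
    let ?B = "{x. x \<in> cball 0 (2 ^ Suc K) \<and> w x \<noteq> 0 \<and> 2 ^ K \<le> norm x}"
    have fin: "finite (?A K)" "finite ?B"
      by (rule finite_subset[OF _ lfinD[OF w(1)]]; auto)+
    have "?A (Suc K) \<subseteq> ?A K \<union> ?B" by auto
    then have "(\<Sum>x\<in>?A (Suc K). w x / sqrt (norm x)) \<le> (\<Sum>x\<in>?A K \<union> ?B. w x / sqrt (norm x))"
      using fin w by (intro sum_mono2) auto
    also have "\<dots> \<le> (\<Sum>x\<in>?A K. w x / sqrt (norm x)) + (\<Sum>x\<in>?B. w x / sqrt (norm x))"
      using sum.union_inter[OF fin, of "\<lambda>x. w x / sqrt (norm x)"] sum_nonneg[of "?A K \<inter> ?B" "\<lambda>x. w x / sqrt (norm x)"] w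
      by (smt (verit) divide_nonneg_nonneg norm_ge_zero real_sqrt_ge_zero)
    also have "(\<Sum>x\<in>?B. w x / sqrt (norm x)) \<le> (\<Sum>x\<in>?B. w x / sqrt (2 ^ K))"
    proof (intro sum_mono divide_left_mono w)
      fix x assume "x \<in> ?B"
      then have x: "2 ^ K \<le> norm x" by blast
      then show "sqrt (2 ^ K) \<le> sqrt (norm x)" by simp
      have "0 < norm x"
        by (rule less_le_trans[OF _ x]) simp
      then show "0 < sqrt (norm x) * sqrt (2 ^ K)" by simp
    qed
    also have "\<dots> = (\<Sum>x\<in>?B. w x) / sqrt (2 ^ K)"
      by (simp add: sum_divide_distrib)
    also have "\<dots> \<le> ncount w (2 ^ Suc K) / sqrt (2 ^ K)"
      unfolding ncount_def using w fin by (intro divide_right_mono sum_mono2 lfinD) auto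
    finally show ?case using Suc by simp
  qed
  moreover have "rsum w R \<le> (\<Sum>x | x \<in> cball 0 (2 ^ K) \<and> w x \<noteq> 0 \<and> 1 \<le> norm x \<and> norm x < 2 ^ K. w x / sqrt (norm x))"
    unfolding rsum_def
  proof (rule sum_mono2)
    show "finite {x. x \<in> cball 0 (2 ^ K) \<and> w x \<noteq> 0 \<and> 1 \<le> norm x \<and> norm x < 2 ^ K}"
      by (rule finite_subset[OF _ lfinD[OF w(1)]]) auto
  qed (use w R in auto)
  ultimately show ?thesis by linarith
qed

text \<open>There are \<open>O(ln r)\<close> dyadic shells, each contributing at most a multiple of
  \<open>1 + r powr \<tau>\<close> plus a constant, where \<open>\<tau> = \<beta> - 1 / 2\<close>
  may be negative. The factor \<open>ln r\<close> in front of the power is paid for by the strict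
  inequality \<open>\<tau> < \<delta>\<close>.\<close>

lemma err_rsum:
  assumes w: "lfin w" "\<And>x. 0 \<le> w x" and g: "grow \<beta> (ncount w)" and \<delta>: "\<beta> - 1 / 2 < \<delta>"
  shows "err \<delta> (\<lambda>r. rsum w (8 * r))"
proof -
  define \<tau> where "\<tau> = \<beta> - 1 / 2"
  obtain A where Ac: "A \<ge> 0" "\<forall>\<^sub>F r in at_top. ncount w r \<le> A * r powr \<beta> + A"
    using growE[OF g] by metis
  then obtain t0 where t0: "\<And>t. t \<ge> t0 \<Longrightarrow> ncount w t \<le> A * t powr \<beta> + A"
    by (auto simp: eventually_at_top_linorder)
  have n0: "ncount w t \<ge> 0" for t unfolding ncount_def by (intro sum_nonneg w)
  define d where "d = A + ncount w t0"
  have d: "d \<ge> 0" using Ac n0 by (simp add: d_def)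
  \<comment> \<open>The growth bound is only asymptotic but the small shells are needed too;
    monotonicity lets the count at \<open>t0\<close> cover them.\<close>
  have all: "ncount w t \<le> A * t powr \<beta> + d" for t
  proof (cases "t \<ge> t0")
    case True
    then show ?thesis unfolding d_def using t0[OF True] n0[of t0] by linarith
  next
    case False
    then have "ncount w t \<le> ncount w t0" by (intro ncount_mono w) simp
    moreover have "0 \<le> A * t powr \<beta>" using Ac by simp
    ultimately show ?thesis unfolding d_def using Ac(1) by linarith
  qed
  define A' where "A' = A * 2 powr \<beta>"
  have A': "A' \<ge> 0" using Ac by (simp add: A'_def)
  have term_le: "ncount w (2 ^ Suc k) / sqrt (2 ^ k) \<le> A' * (1 + S powr \<tau>) + d" if "2 ^ k \<le> S" for k and S :: real
  proof -
    define p :: real where "p = 2 ^ k"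
    have p: "p \<ge> 1" "p \<le> S" using that by (auto simp: p_def)
    have "ncount w (2 ^ Suc k) / sqrt p \<le> (A * (2 * p) powr \<beta> + d) / sqrt p"
      using all[of "2 ^ Suc k"] p by (intro divide_right_mono) (auto simp: p_def)
    also have "\<dots> = A' * (p powr \<beta> / sqrt p) + d / sqrt p"
      using p by (simp add: A'_def powr_mult add_divide_distrib)
    also have "p powr \<beta> / sqrt p = p powr \<tau>"
      using p by (simp add: \<tau>_def powr_diff powr_half_sqrt)
    also have "d / sqrt p \<le> d / 1"
      using p d by (intro divide_left_mono) auto
    also have "A' * p powr \<tau> \<le> A' * (1 + S powr \<tau>)"
    proof (rule mult_left_mono[OF _ A'])
      show "p powr \<tau> \<le> 1 + S powr \<tau>"
      proof (cases "\<tau> \<ge> 0")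
        case True
        then have "p powr \<tau> \<le> S powr \<tau>" using p by (intro powr_mono2) auto
        then show ?thesis by simp
      next
        case False
        then have "p powr \<tau> \<le> p powr 0" using p by (intro powr_mono) auto
        also have "\<dots> \<le> 1 + S powr \<tau>" using p by simp
        finally show ?thesis .
      qed
    qed
    finally show ?thesis by (simp add: p_def)
  qed
  define B where "B = 3 / ln 2 * (A' + d)"
  define C where "C = 3 / ln 2 * A' * 16 powr \<tau> / (\<delta> - \<tau>)"
  have "\<forall>\<^sub>F r in at_top. rsum w (8 * r) \<le> B * ln r + C * r powr \<delta>"
    using eventually_ge_at_top[of 4]
  proof eventually_elim
    case (elim r)
    \<comment> \<open>By minimality \<open>2 ^ K \<le> 16 * r\<close>, so every shell radius is
      comparable with \<open>r\<close> or smaller.\<close>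
    define K where "K = (LEAST n. 8 * r < 2 ^ n)"
    have ex: "\<exists>n. 8 * r < 2 ^ n" using real_arch_pow[of 2 "8 * r"] by simp
    then have K: "8 * r < 2 ^ K" unfolding K_def by (rule LeastI_ex)
    have "K \<noteq> 0"
    proof
      assume "K = 0"
      with K elim show False by simp
    qed
    then obtain J where J: "K = Suc J" by (cases K) auto
    have "\<not> 8 * r < 2 ^ J"
      using not_less_Least[of J "\<lambda>n. 8 * r < 2 ^ n"] J unfolding K_def[symmetric] by simp
    then have K2: "2 ^ K \<le> 16 * r" using J by simp
    have lnK: "real K * ln 2 \<le> 3 * ln r"
    proof -
      have "real K * ln 2 = ln (2 ^ K)" by (simp add: ln_realpow)
      also have "\<dots> \<le> ln (16 * r)" using K2 elim by (subst ln_le_cancel_iff) auto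
      also have "\<dots> \<le> ln (r ^ 3)"
      proof -
        have "16 \<le> r ^ 2" using power_mono[of 4 r 2] elim by simp
        then have "16 * r \<le> r ^ 2 * r" using elim by (intro mult_right_mono) auto
        then have "16 * r \<le> r ^ 3" by (simp add: power2_eq_square power3_eq_cube)
        then show ?thesis using elim by (subst ln_le_cancel_iff) auto
      qed
      also have "\<dots> = 3 * ln r" using elim by (simp add: ln_realpow)
      finally show ?thesis .
    qed
    have "rsum w (8 * r) \<le> (\<Sum>k<K. ncount w (2 ^ Suc k) / sqrt (2 ^ k))"
      by (rule rsum_dyadic[OF w K])
    also have "\<dots> \<le> (\<Sum>k<K. A' * (1 + (16 * r) powr \<tau>) + d)"
    proof (intro sum_mono term_le)
      fix k assume "k \<in> {..<K}"
      then have "(2::real) ^ k \<le> 2 ^ K" by (intro power_increasing) auto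
      then show "2 ^ k \<le> 16 * r" using K2 by linarith
    qed
    also have "\<dots> = real K * (A' * (1 + (16 * r) powr \<tau>) + d)" by simp
    also have "\<dots> \<le> (3 * ln r / ln 2) * (A' * (1 + (16 * r) powr \<tau>) + d)"
    proof (rule mult_right_mono)
      show "real K \<le> 3 * ln r / ln 2" using lnK by (simp add: pos_le_divide_eq)
      show "0 \<le> A' * (1 + (16 * r) powr \<tau>) + d" using A' d by simp
    qed
    also have "(16 * r) powr \<tau> = 16 powr \<tau> * r powr \<tau>" using elim by (simp add: powr_mult)
    also have "(3 * ln r / ln 2) * (A' * (1 + 16 powr \<tau> * r powr \<tau>) + d) =
        B * ln r + (3 / ln 2 * A' * 16 powr \<tau>) * (ln r * r powr \<tau>)"
      by (simp add: B_def algebra_simps add_divide_distrib)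
    also have "(3 / ln 2 * A' * 16 powr \<tau>) * (ln r * r powr \<tau>) \<le> (3 / ln 2 * A' * 16 powr \<tau>) * (r powr \<delta> / (\<delta> - \<tau>))"
    proof (rule mult_left_mono)
      have "ln r \<le> r powr (\<delta> - \<tau>) / (\<delta> - \<tau>)"
        using elim \<delta> by (intro ln_powr_bound) (auto simp: \<tau>_def)
      then have "ln r * r powr \<tau> \<le> r powr (\<delta> - \<tau>) / (\<delta> - \<tau>) * r powr \<tau>"
        by (intro mult_right_mono) auto
      also have "\<dots> = (r powr (\<delta> - \<tau>) * r powr \<tau>) / (\<delta> - \<tau>)" by simp
      also have "r powr (\<delta> - \<tau>) * r powr \<tau> = r powr \<delta>"
        unfolding powr_add[symmetric] by simp
      finally show "ln r * r powr \<tau> \<le> r powr \<delta> / (\<delta> - \<tau>)" .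
    qed (use A' in simp)
    finally show ?case by (simp add: C_def)
  qed
  with dominated_add[OF err_ln err_powr[OF order_refl]] show ?thesis
    by (rule dominated_mono)
qed

lemma err_finite_logr: "err \<delta> (\<lambda>r. \<Sum>x\<in>F. c x * logr r x)"
proof (rule dominated_sum)
  fix x
  have "\<forall>\<^sub>F r in at_top. c x * logr r x \<le> \<bar>c x\<bar> * (1 * ln r + \<bar>ln (norm x)\<bar>)"
    using eventually_ge_at_top[of 1]
  proof eventually_elim
    case (elim r)
    have "logr r x \<le> ln r + \<bar>ln (norm x)\<bar>"
      using elim by (auto simp: logr_def ln_div)
    then have "\<bar>c x\<bar> * logr r x \<le> \<bar>c x\<bar> * (ln r + \<bar>ln (norm x)\<bar>)"
      by (intro mult_left_mono) auto
    moreover have "c x * logr r x \<le> \<bar>c x\<bar> * logr r x"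
      using logr_nonneg[OF elim] by (intro mult_right_mono) auto
    ultimately show ?case by simp
  qed
  then show "err \<delta> (\<lambda>r. c x * logr r x)"
    by (rule dominated_mono[OF dominated_cmult[OF dominated_add[OF err_ln err_const]], rotated]) simp
qed

text \<open>Points of \<open>Y\<close> outside the disc carry \<open>logr r x = 0\<close>, so
  \<open>Y\<close> may be a shifted set that leaves the disc.\<close>

lemma sum_le_lcount:
  assumes "lfin w" "\<And>x. 0 \<le> w x" "finite Y" "r \<ge> 1"
  shows "(\<Sum>x\<in>Y. w x * logr r x) \<le> lcount w r"
proof -
  let ?T = "Y \<union> {x. x \<in> cball 0 r \<and> w x \<noteq> 0}"
  have "(\<Sum>x\<in>Y. w x * logr r x) \<le> (\<Sum>x\<in>?T. w x * logr r x)"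
    using assms lfinD[OF assms(1)] by (intro sum_mono2) (auto intro!: mult_nonneg_nonneg logr_nonneg)
  also have "\<dots> = lcount w r"
    using assms lfinD[OF assms(1)] by (intro lcount_eq[symmetric]) auto
  finally show ?thesis .
qed

lemma sum_le_rsum:
  assumes "lfin w" "\<And>x. 0 \<le> w x" "finite Y" "\<And>x. x \<in> Y \<Longrightarrow> 1 \<le> norm x \<and> norm x \<le> R"
  shows "(\<Sum>x\<in>Y. w x / sqrt (norm x)) \<le> rsum w R"
proof -
  have "(\<Sum>x\<in>Y. w x / sqrt (norm x)) = (\<Sum>x\<in>{x\<in>Y. w x \<noteq> 0}. w x / sqrt (norm x))"
    using assms(3) by (intro sum.mono_neutral_right) auto
  also have "\<dots> \<le> rsum w R"
    unfolding rsum_def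
  proof (rule sum_mono2)
    show "finite {x. x \<in> cball 0 R \<and> w x \<noteq> 0 \<and> 1 \<le> norm x}"
      by (rule finite_subset[OF _ lfinD[OF assms(1)]]) auto
  qed (use assms in auto)
  finally show ?thesis .
qed

subsection \<open>Comparison of the counting functions\<close>

lemma lfin_wilson_weight: "nzmero f \<Longrightarrow> lfin (\<lambda>x. of_int (wilson_weight s f x))"
proof (rule lfin_subset[OF lfin_pole_order])
  fix x assume f: "nzmero f" and "real_of_int (pole_order f x) = 0"
  then show "real_of_int (wilson_weight s f x) = 0"
    using wilson_weight_bounds(1)[of s f x] wilson_weight_bounds(2)[OF f, of s x] by simp
qed

lemma wilson_N_lcount:
  assumes "nzmero f" "r > 0"
  shows "wilson_N s r f = lcount (\<lambda>x. of_int (wilson_weight s f x)) r"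
proof -
  have "wilson_n s t f = ncount (\<lambda>x. of_int (wilson_weight s f x)) t" for t
  proof -
    have "wilson_n s t f = (\<Sum>x\<in>poles_upto t f. of_int (wilson_weight s f x))"
      unfolding wilson_n_def of_int_sum
      by (intro sum.cong refl) (auto simp: poles_upto_def wilson_weight_def)
    also have "\<dots> = ncount (\<lambda>x. of_int (wilson_weight s f x)) t"
      by (rule ncount_eq[symmetric, OF finite_poles_upto[OF assms(1)]])
        (auto simp: poles_upto_def wilson_weight_def split: if_splits)
    finally show ?thesis .
  qed
  then have "wilson_N s r f = integrated_count (ncount (\<lambda>x. of_int (wilson_weight s f x))) r"
    by (simp only: wilson_N_def)
  also have "\<dots> = lcount (\<lambda>x. of_int (wilson_weight s f x)) r"
    by (rule integrated_count_ncount[OF lfin_wilson_weight[OF assms(1)] assms(2)])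
  finally show ?thesis .
qed

lemma grow_pole_order:
  assumes "nzmero h" "grow \<beta> (\<lambda>r. nevanlinna_T r h)"
  shows "grow \<beta> (ncount (\<lambda>x. of_int (pole_order h x)))"
proof -
  have "\<forall>\<^sub>F r in at_top. ncount (\<lambda>x. of_int (pole_order h x)) r \<le> 1 / ln 2 * nevanlinna_T (2 * r) h"
    using eventually_ge_at_top[of 1]
  proof eventually_elim
    case (elim r)
    then show ?case
      using pole_count_le_T[OF assms(1) elim]
        pos_le_divide_eq[of "ln 2" "ncount (\<lambda>x. of_int (pole_order h x)) r" "nevanlinna_T (2 * r) h"]
      by (simp add: mult.commute)
  qed
  moreover have "grow \<beta> (\<lambda>r. 1 / ln 2 * nevanlinna_T (2 * r) h)"
    by (rule dominated_cmult[OF grow_scale[OF assms(2)]]) auto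
  ultimately show ?thesis by (rule dominated_mono[rotated])
qed

text \<open>Both sides are sums over the points \<open>x\<close> of the local inequality at \<open>x\<^sup>+\<close>; moving
  between \<open>x\<close>, \<open>x\<^sup>+\<close> and \<open>x\<^sup>+\<^sup>+\<close> changes \<open>ln (r / norm x)\<close> by \<open>O(1 / \<surd>(norm x))\<close> only.\<close>

lemma wilson_counting:
  fixes y :: "nat \<Rightarrow> complex"
  assumes s: "wilson_branch s" and f: "f meromorphic_on UNIV" "f \<notin> wilson_ker" and y: "inj_on y {1..q}"
    and g: "grow \<beta> (\<lambda>r. nevanlinna_T r f)" and \<delta>: "\<beta> - 1 / 2 < \<delta>"
  defines "\<mu> \<equiv> \<lambda>x. \<Sum>n=1..q. real_of_int (wilson_excess s f (y n) x)"
  shows "err \<delta> (\<lambda>r. lcount \<mu> r - lcount (\<lambda>x. of_int (zorder (wilson f) x)) r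
    - nevanlinna_N r f - wilson_N s r f)"
proof -
  define \<phi> where "\<phi> = wilson_plus s"
  define \<psi> where "\<psi> x = (s x + \<i>)\<^sup>2" for x
  define D where "D x = real_of_int (zorder (wilson f) x)" for x
  define a where "a x = real_of_int (pole_order f x)" for x
  define v where "v x = real_of_int (wilson_weight s f x)" for x
  have nf: "nzmero f" using not_wilson_ker_nzmero(3)[OF f, of 0] by simp
  have ny: "nzmero (\<lambda>x. f x - y n)" for n by (rule not_wilson_ker_nzmero(3)[OF f])
  note niy = nzmero_inverse[OF ny]
  define P where "P n x = real_of_int (pole_order (\<lambda>v. 1 / (f v - y n)) x)" for n x
  have P: "lfin (P n)" "0 \<le> P n x" "grow \<beta> (ncount (P n))" for n x
    unfolding P_def
    by (rule lfin_pole_order[OF niy], simp add: pole_order_eq[OF niy],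
        rule grow_pole_order[OF niy grow_T_diff_const(1)[OF nf ny g]])
  define PS where "PS x = (\<Sum>n=1..q. P n x)" for x
  have PS: "lfin PS" unfolding PS_def[abs_def] by (intro lfin_sum P) auto
  have D: "lfin D" unfolding D_def[abs_def] by (rule lfin_zorder[OF not_wilson_ker_nzmero(1)[OF f]])
  have a: "lfin a" "0 \<le> a x" "grow \<beta> (ncount a)" for x
    unfolding a_def[abs_def]
    by (rule lfin_pole_order[OF nf], simp add: pole_order_eq[OF nf], rule grow_pole_order[OF nf g])
  have v: "lfin v" "0 \<le> v x" "v x \<le> a x" for x
    unfolding v_def[abs_def] a_def
    by (rule lfin_wilson_weight[OF nf], simp add: wilson_weight_bounds, simp add: wilson_weight_bounds(2)[OF nf])
  have \<mu>: "0 \<le> \<mu> x" "\<mu> x \<le> PS x" for x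
    unfolding \<mu>_def PS_def P_def wilson_excess_def
    by (intro sum_nonneg, simp add: wilson_weight_bounds(2)[OF niy], intro sum_mono, simp add: wilson_weight_bounds(1))
  have l\<mu>: "lfin \<mu>"
    by (rule lfin_subset[OF PS]) (use \<mu> in \<open>metis order_antisym\<close>)
  have g\<mu>: "grow \<beta> (ncount \<mu>)"
  proof -
    have "ncount \<mu> r \<le> (\<Sum>n=1..q. ncount (P n) r)" for r
    proof -
      let ?T = "\<Union>n\<in>{1..q}. {x. x \<in> cball 0 r \<and> P n x \<noteq> 0}"
      have T: "finite ?T" using P(1) lfinD by blast
      have "ncount \<mu> r \<le> ncount PS r" by (rule ncount_le[OF PS \<mu>])
      also have "\<dots> = (\<Sum>x\<in>?T. PS x)"
      proof (rule ncount_eq[OF T])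
        show "{x \<in> cball 0 r. PS x \<noteq> 0} \<subseteq> ?T"
          unfolding PS_def by (auto dest: sum.not_neutral_contains_not_neutral)
      qed auto
      also have "\<dots> = (\<Sum>n=1..q. \<Sum>x\<in>?T. P n x)"
        unfolding PS_def by (rule sum.swap)
      also have "\<dots> = (\<Sum>n=1..q. ncount (P n) r)"
        by (intro sum.cong refl ncount_eq[OF T, symmetric]) auto
      finally show ?thesis .
    qed
    then have "\<forall>\<^sub>F r in at_top. ncount \<mu> r \<le> (\<Sum>n=1..q. ncount (P n) r)"
      by (intro always_eventually allI)
    then show ?thesis
      by (rule dominated_mono[OF dominated_sum, rotated]) (rule P(3))
  qed
  have gv: "grow \<beta> (ncount v)"
    by (rule dominated_mono[OF a(3)]) (intro always_eventually allI ncount_le[OF a(1)] v)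
  have inj: "inj \<phi>" "inj \<psi>"
    unfolding \<phi>_def \<psi>_def using wilson_plus_inj[OF s] wilson_plus_plus_inj[OF s] by auto
  have hh: "norm (\<i> / 2) \<le> 1" "norm \<i> \<le> 1" "norm (\<i> / 2) = 1 / 2" by (simp_all add: norm_divide)
  have \<phi>_le: "norm (\<phi> x) \<le> (sqrt (norm x) + 1 / 2)\<^sup>2" for x
    using norm_shift_le(1)[OF s hh(1), of x] unfolding hh(3) by (simp add: \<phi>_def wilson_plus_def)
  \<comment> \<open>The threshold 21 lies just above \<open>(4 + 1 / 2)\<^sup>2\<close>; the value
    16 is what \<open>logr_near\<close> requires.\<close>
  have big: "norm x \<ge> 16" if "norm (\<phi> x) > 21" for x
  proof (rule ccontr)
    assume "\<not> norm x \<ge> 16"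
    then have "sqrt (norm x) \<le> 4" using real_sqrt_le_mono[of "norm x" 16] by simp
    then have "(sqrt (norm x) + 1 / 2)\<^sup>2 \<le> (4 + 1 / 2)\<^sup>2" by (intro power_mono) auto
    with \<phi>_le[of x] that show False by (simp add: power2_eq_square)
  qed
  have local_ineq: "- D (\<phi> x) + \<mu> x \<le> a (\<psi> x) + v x" if x: "norm x \<ge> 16" for x
  proof -
    have n: "norm (s x) \<ge> 4"
      unfolding norm_wilson_branch[OF s] using x real_le_rsqrt[of 4 "norm x"] by simp
    have nz: "s x + c \<noteq> 0" if "norm c \<le> 1" for c
    proof
      assume "s x + c = 0"
      then have "s x = - c" by (simp add: add_eq_0_iff2)
      with n that show False by simp
    qed
    have "- zorder (wilson f) (\<phi> x) + (\<Sum>n=1..q. wilson_excess s f (y n) x)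
        \<le> pole_order f (\<psi> x) + wilson_weight s f x"
      unfolding \<phi>_def \<psi>_def
      by (rule wilson_local_inequality[OF f y refl wilson_branch_square[OF s]])
        (use nz[of 0] nz[OF hh(1)] nz[OF hh(2)] in auto)
    then have "real_of_int (- zorder (wilson f) (\<phi> x) + (\<Sum>n=1..q. wilson_excess s f (y n) x))
        \<le> real_of_int (pole_order f (\<psi> x) + wilson_weight s f x)"
      by (simp only: of_int_le_iff)
    then show ?thesis
      by (simp add: D_def \<mu>_def a_def v_def)
  qed
  define F1 where "F1 = {w. w \<in> cball 0 21 \<and> D w \<noteq> 0}"
  \<comment> \<open>Beyond 32 the square root exceeds \<open>11 / 2\<close>, so
    \<open>x\<^sup>+\<close> has modulus at least 25 and lies above the threshold 21.\<close>
  define F2 where "F2 = {x. x \<in> cball 0 32 \<and> \<mu> x \<noteq> 0}"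
  have F: "finite F1" "finite F2"
    unfolding F1_def F2_def by (rule lfinD[OF D], rule lfinD[OF l\<mu>])
  have small_bound: "norm x \<le> 4 * r" if "sqrt (norm x) \<le> sqrt t + 1 / 2" "t \<le> r" "r \<ge> 1" "t \<ge> 0" for x :: complex and t r
  proof -
    have "sqrt t + 1 / 2 \<le> 2 * sqrt r"
    proof -
      have "sqrt t \<le> sqrt r" "1 \<le> sqrt r" using that by simp_all
      then show ?thesis by linarith
    qed
    then have "sqrt (norm x) \<le> 2 * sqrt r" using that by linarith
    then have "(sqrt (norm x))\<^sup>2 \<le> (2 * sqrt r)\<^sup>2" by (intro power_mono) auto
    moreover have "(sqrt (norm x))\<^sup>2 = norm x" by simp
    moreover have "(2 * sqrt r)\<^sup>2 = 4 * r" using that(3) by (simp add: power_mult_distrib)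
    ultimately show ?thesis by linarith
  qed
  have main: "lcount \<mu> r - lcount D r \<le> lcount a r + lcount v r
      + ((\<Sum>x\<in>F2. \<mu> x * logr r x) + (\<Sum>w\<in>F1. (- D w) * logr r w)
      + (12 * rsum \<mu> (8 * r) + 48 * rsum a (8 * r) + 12 * rsum v (8 * r)))" if r: "r \<ge> 1" for r
  proof -
    \<comment> \<open>A point of the disc of radius \<open>r\<close> and modulus above 21 has its
      preimage under \<open>\<phi>\<close> within \<open>4 * r\<close>, and \<open>\<psi>\<close> at
      most doubles moduli there. This explains the radius \<open>8 * r\<close> in the error
      sums.\<close>
    define X where "X = {x. norm (\<phi> x) > 21 \<and> norm x \<le> 4 * r \<and> (D (\<phi> x) \<noteq> 0 \<or> \<mu> x \<noteq> 0 \<or> a (\<psi> x) \<noteq> 0 \<or> v x \<noteq> 0)}"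
    have r0: "r > 0" using r by simp
    have X16: "norm x \<ge> 16" if "x \<in> X" for x using that big by (auto simp: X_def)
    have \<phi>n: "norm (\<phi> x - x) \<le> 3 * sqrt (norm x)" and \<psi>n: "norm (\<psi> x - x) \<le> 3 * sqrt (norm x)"
      if "norm x \<ge> 16" for x
      unfolding \<phi>_def wilson_plus_def \<psi>_def
      by (rule norm_shift_le(2)[OF s hh(1) that], rule norm_shift_le(2)[OF s hh(2) that])
    have L\<phi>: "\<bar>logr r (\<phi> x) - logr r x\<bar> \<le> 12 / sqrt (norm x)" and L\<psi>: "\<bar>logr r (\<psi> x) - logr r x\<bar> \<le> 12 / sqrt (norm x)"
      and \<psi>b: "norm (\<psi> x) \<ge> norm x / 4" "norm (\<psi> x) \<le> 2 * norm x" and \<phi>b: "norm (\<phi> x) \<le> 2 * norm x"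
      if "norm x \<ge> 16" for x
      by (rule logr_near(3)[OF r0 that \<phi>n[OF that]], rule logr_near(3)[OF r0 that \<psi>n[OF that]],
          rule logr_near(1)[OF r0 that \<psi>n[OF that]], rule logr_near(2)[OF r0 that \<psi>n[OF that]],
          rule logr_near(2)[OF r0 that \<phi>n[OF that]])
    have X: "finite X"
    proof -
      have "finite (\<phi> -` {w. w \<in> cball 0 (8 * r) \<and> D w \<noteq> 0} \<union> {x. x \<in> cball 0 (4 * r) \<and> \<mu> x \<noteq> 0}
          \<union> \<psi> -` {w. w \<in> cball 0 (8 * r) \<and> a w \<noteq> 0} \<union> {x. x \<in> cball 0 (4 * r) \<and> v x \<noteq> 0})"
        by (intro finite_UnI finite_vimageI lfinD D l\<mu> a v inj)
      then show ?thesis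
      proof (rule rev_finite_subset, intro subsetI)
        fix x assume x: "x \<in> X"
        then have "norm (\<phi> x) \<le> 8 * r" "norm (\<psi> x) \<le> 8 * r" "norm x \<le> 4 * r"
          using \<phi>b[OF X16[OF x]] \<psi>b(2)[OF X16[OF x]] by (auto simp: X_def)
        with x show "x \<in> \<phi> -` {w. w \<in> cball 0 (8 * r) \<and> D w \<noteq> 0} \<union> {x. x \<in> cball 0 (4 * r) \<and> \<mu> x \<noteq> 0}
          \<union> \<psi> -` {w. w \<in> cball 0 (8 * r) \<and> a w \<noteq> 0} \<union> {x. x \<in> cball 0 (4 * r) \<and> v x \<noteq> 0}"
          by (auto simp: X_def)
      qed
    qed
    \<comment> \<open>Since \<open>D\<close> takes both signs this must be an identity: outside
      \<open>F1\<close> each point of the disc is hit exactly once, by surjectivity and injectivity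
      of \<open>\<phi>\<close>.\<close>
    have lD: "lcount D r = (\<Sum>w\<in>F1. D w * logr r w) + (\<Sum>x\<in>X. D (\<phi> x) * logr r (\<phi> x))"
    proof -
      have "lcount D r = (\<Sum>w\<in>F1 \<union> \<phi> ` X. D w * logr r w)"
      proof (rule lcount_eq[OF r0])
        show "{w \<in> cball 0 r. D w \<noteq> 0} \<subseteq> F1 \<union> \<phi> ` X"
        proof
          fix w assume w: "w \<in> {w \<in> cball 0 r. D w \<noteq> 0}"
          show "w \<in> F1 \<union> \<phi> ` X"
          proof (cases "norm w \<le> 21")
            case True with w show ?thesis by (auto simp: F1_def)
          next
            case False
            then have "norm w > 1" by simp
            then obtain x where x: "wilson_plus s x = w" "sqrt (norm x) \<le> sqrt (norm w) + 1 / 2"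
              by (rule wilson_plus_surj[OF s])
            have "norm x \<le> 4 * r" using small_bound[OF x(2) _ r] w by simp
            with x(1) w False have "x \<in> X" by (auto simp: X_def \<phi>_def)
            with x(1) show ?thesis by (auto simp: \<phi>_def)
          qed
        qed
      qed (use F X in auto)
      also have "\<dots> = (\<Sum>w\<in>F1. D w * logr r w) + (\<Sum>w\<in>\<phi> ` X. D w * logr r w)"
        by (rule sum.union_disjoint) (use F X in \<open>auto simp: F1_def X_def\<close>)
      also have "(\<Sum>w\<in>\<phi> ` X. D w * logr r w) = (\<Sum>x\<in>X. D (\<phi> x) * logr r (\<phi> x))"
        using inj(1) by (subst sum.reindex) (auto simp: inj_on_def inj_def)
      finally show ?thesis .
    qed
    \<comment> \<open>Here an inequality suffices because \<open>\<mu>\<close> is nonnegative;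
      \<open>F2\<close> and \<open>X\<close> may overlap.\<close>
    have l\<mu>_le: "lcount \<mu> r \<le> (\<Sum>x\<in>F2. \<mu> x * logr r x) + (\<Sum>x\<in>X. \<mu> x * logr r x)"
    proof -
      have "lcount \<mu> r = (\<Sum>x\<in>F2 \<union> X. \<mu> x * logr r x)"
      proof (rule lcount_eq[OF r0])
        show "{x \<in> cball 0 r. \<mu> x \<noteq> 0} \<subseteq> F2 \<union> X"
        proof
          fix x assume x: "x \<in> {x \<in> cball 0 r. \<mu> x \<noteq> 0}"
          show "x \<in> F2 \<union> X"
          proof (cases "norm x \<le> 32")
            case True with x show ?thesis by (auto simp: F2_def)
          next
            case False
            then have x16: "norm x \<ge> 16" and sq: "sqrt (norm x) \<ge> 5"
              using real_le_rsqrt[of 5 "norm x"] by auto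
            have "norm (s x) \<le> norm (s x + \<i> / 2) + 1 / 2"
              using norm_triangle_ineq4[of "s x + \<i> / 2" "\<i> / 2"] hh(3) by simp
            then have "norm (s x + \<i> / 2) \<ge> sqrt (norm x) - 1 / 2"
              by (simp add: norm_wilson_branch[OF s])
            then have "(sqrt (norm x) - 1 / 2)\<^sup>2 \<le> (norm (s x + \<i> / 2))\<^sup>2"
              using sq by (intro power_mono) auto
            then have "(sqrt (norm x) - 1 / 2)\<^sup>2 \<le> norm (\<phi> x)"
              by (simp add: \<phi>_def wilson_plus_def norm_power)
            moreover have "(sqrt (norm x) - 1 / 2)\<^sup>2 > 21"
            proof -
              define \<rho> where "\<rho> = sqrt (norm x)"
              have \<rho>: "\<rho> * \<rho> = norm x" by (simp add: \<rho>_def)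
              have "\<rho> \<ge> 11 / 2"
                unfolding \<rho>_def using False by (intro real_le_rsqrt) (auto simp: power2_eq_square)
              then have "(\<rho> - 1 / 2)\<^sup>2 \<ge> (11 / 2 - 1 / 2)\<^sup>2" by (intro power_mono) auto
              then show ?thesis by (simp add: \<rho>_def[symmetric] power2_eq_square)
            qed
            ultimately have "norm (\<phi> x) > 21" by linarith
            then show ?thesis using x r by (auto simp: X_def)
          qed
        qed
      qed (use F X in auto)
      also have "\<dots> \<le> (\<Sum>x\<in>F2. \<mu> x * logr r x) + (\<Sum>x\<in>X. \<mu> x * logr r x)"
      proof -
        have "0 \<le> (\<Sum>x\<in>F2 \<inter> X. \<mu> x * logr r x)"
          by (intro sum_nonneg mult_nonneg_nonneg \<mu> logr_nonneg r)
        then show ?thesis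
          using sum.union_inter[OF F(2) X, of "\<lambda>x. \<mu> x * logr r x"] by linarith
      qed
      finally show ?thesis .
    qed
    have near: "(\<Sum>x\<in>X. u x * c x) \<le> (\<Sum>x\<in>X. u x * d x) + 12 * rsum u (8 * r)"
      if "lfin u" "\<And>x. 0 \<le> u x" "\<And>x. x \<in> X \<Longrightarrow> c x \<le> d x + 12 / sqrt (norm x)" for u c d
    proof -
      have "(\<Sum>x\<in>X. u x * c x) \<le> (\<Sum>x\<in>X. u x * (d x + 12 / sqrt (norm x)))"
        by (intro sum_mono mult_left_mono that)
      also have "\<dots> = (\<Sum>x\<in>X. u x * d x) + 12 * (\<Sum>x\<in>X. u x / sqrt (norm x))"
        by (simp add: distrib_left sum.distrib sum_distrib_left mult_ac)
      also have "(\<Sum>x\<in>X. u x / sqrt (norm x)) \<le> rsum u (8 * r)"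
      proof (rule sum_le_rsum[OF that(1,2) X])
        fix x assume x: "x \<in> X"
        have "norm x \<le> 4 * r" using x by (simp add: X_def)
        then show "1 \<le> norm x \<and> norm x \<le> 8 * r" using X16[OF x] r by linarith
      qed
      finally show ?thesis by simp
    qed
    \<comment> \<open>The local inequality is weighted by \<open>logr\<close> at
      \<open>x\<^sup>+\<close>, so the exact sum for \<open>D\<close> is not disturbed and only
      nonnegative weights are moved afterwards.\<close>
    have "(\<Sum>x\<in>X. (- D (\<phi> x) + \<mu> x) * logr r (\<phi> x)) \<le> (\<Sum>x\<in>X. (a (\<psi> x) + v x) * logr r (\<phi> x))"
      by (intro sum_mono mult_right_mono local_ineq X16 logr_nonneg r)
    then have A: "- (\<Sum>x\<in>X. D (\<phi> x) * logr r (\<phi> x)) + (\<Sum>x\<in>X. \<mu> x * logr r (\<phi> x)) \<le>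
        (\<Sum>x\<in>X. a (\<psi> x) * logr r (\<phi> x)) + (\<Sum>x\<in>X. v x * logr r (\<phi> x))"
      by (simp only: distrib_right sum.distrib mult_minus_left sum_negf)
    have B: "(\<Sum>x\<in>X. \<mu> x * logr r x) \<le> (\<Sum>x\<in>X. \<mu> x * logr r (\<phi> x)) + 12 * rsum \<mu> (8 * r)"
    proof (rule near[OF l\<mu> \<mu>(1), of "logr r" "\<lambda>x. logr r (\<phi> x)"])
      fix x assume "x \<in> X"
      from L\<phi>[OF X16[OF this]] show "logr r x \<le> logr r (\<phi> x) + 12 / sqrt (norm x)" by linarith
    qed
    have C: "(\<Sum>x\<in>X. v x * logr r (\<phi> x)) \<le> lcount v r + 12 * rsum v (8 * r)"
    proof -
      have "(\<Sum>x\<in>X. v x * logr r (\<phi> x)) \<le> (\<Sum>x\<in>X. v x * logr r x) + 12 * rsum v (8 * r)"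
      proof (rule near[OF v(1,2), of "\<lambda>x. logr r (\<phi> x)" "logr r"])
        fix x assume "x \<in> X"
        from L\<phi>[OF X16[OF this]] show "logr r (\<phi> x) \<le> logr r x + 12 / sqrt (norm x)" by linarith
      qed
      also have "(\<Sum>x\<in>X. v x * logr r x) \<le> lcount v r"
        by (rule sum_le_lcount[OF v(1,2) X r])
      finally show ?thesis by simp
    qed
    have E: "(\<Sum>x\<in>X. a (\<psi> x) * logr r (\<phi> x)) \<le> lcount a r + 48 * rsum a (8 * r)"
    proof -
      have "(\<Sum>x\<in>X. a (\<psi> x) * logr r (\<phi> x)) \<le> (\<Sum>x\<in>X. a (\<psi> x) * (logr r (\<psi> x) + 48 / sqrt (norm (\<psi> x))))"
      proof (intro sum_mono mult_left_mono a)
        fix x assume x: "x \<in> X"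
        note x16 = X16[OF x]
        have "sqrt (norm (\<psi> x)) \<le> sqrt (4 * norm x)"
          using \<psi>b(2)[OF x16] x16 by simp
        then have le: "sqrt (norm (\<psi> x)) \<le> 2 * sqrt (norm x)"
          by (simp add: real_sqrt_mult)
        have pos: "sqrt (norm (\<psi> x)) > 0" "sqrt (norm x) > 0" using \<psi>b(1)[OF x16] x16 by auto
        \<comment> \<open>The move from \<open>x\<^sup>+\<close> to \<open>x\<^sup>+\<^sup>+\<close>
          passes through \<open>x\<close> and costs 12 twice; expressing the bound at
          \<open>\<psi> x\<close> instead of \<open>x\<close> doubles it again.\<close>
        have "24 / sqrt (norm x) = 48 / (2 * sqrt (norm x))" by simp
        also have "\<dots> \<le> 48 / sqrt (norm (\<psi> x))"
          using le pos by (intro divide_left_mono) auto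
        finally have "24 / sqrt (norm x) \<le> 48 / sqrt (norm (\<psi> x))" .
        moreover have "24 / sqrt (norm x) = 12 / sqrt (norm x) + 12 / sqrt (norm x)"
          by (simp flip: add_divide_distrib)
        ultimately show "logr r (\<phi> x) \<le> logr r (\<psi> x) + 48 / sqrt (norm (\<psi> x))"
          using L\<phi>[OF x16] L\<psi>[OF x16] by linarith
      qed
      also have "\<dots> = (\<Sum>x\<in>X. a (\<psi> x) * logr r (\<psi> x)) + 48 * (\<Sum>x\<in>X. a (\<psi> x) / sqrt (norm (\<psi> x)))"
        by (simp add: distrib_left sum.distrib sum_distrib_left mult_ac)
      also have "(\<Sum>x\<in>X. a (\<psi> x) * logr r (\<psi> x)) = (\<Sum>u\<in>\<psi> ` X. a u * logr r u)"
        using inj(2) by (subst sum.reindex) (auto simp: inj_on_def inj_def)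
      also have "\<dots> \<le> lcount a r"
        by (rule sum_le_lcount[OF a(1,2) _ r]) (use X in simp)
      also have "(\<Sum>x\<in>X. a (\<psi> x) / sqrt (norm (\<psi> x))) = (\<Sum>u\<in>\<psi> ` X. a u / sqrt (norm u))"
        using inj(2) by (subst sum.reindex) (auto simp: inj_on_def inj_def)
      also have "\<dots> \<le> rsum a (8 * r)"
      proof (rule sum_le_rsum[OF a(1,2)])
        fix u assume "u \<in> \<psi> ` X"
        then obtain x where x: "x \<in> X" "u = \<psi> x" by blast
        then show "1 \<le> norm u \<and> norm u \<le> 8 * r"
          using \<psi>b[OF X16[OF x(1)]] X16[OF x(1)] by (auto simp: X_def)
      qed (use X in simp)
      finally show ?thesis by simp
    qed
    have F1_neg: "(\<Sum>w\<in>F1. (- D w) * logr r w) = - (\<Sum>w\<in>F1. D w * logr r w)"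
      by (simp only: mult_minus_left sum_negf)
    have "lm - ld \<le> la + lv + ((s2 + s1) + (12 * rm + 48 * ra + 12 * rv))"
      if "ld = t1 + t2" "lm \<le> s2 + m1" "- t2 + m2 \<le> e + w" "m1 \<le> m2 + 12 * rm"
        "w \<le> lv + 12 * rv" "e \<le> la + 48 * ra" "s1 = - t1"
      for lm ld la lv s1 s2 t1 t2 m1 m2 e w rm ra rv :: real
      using that by linarith
    from this[OF lD l\<mu>_le A B C E F1_neg] show ?thesis .
  qed
  have "err \<delta> (\<lambda>r. (\<Sum>x\<in>F2. \<mu> x * logr r x) + (\<Sum>w\<in>F1. (- D w) * logr r w)
      + (12 * rsum \<mu> (8 * r) + 48 * rsum a (8 * r) + 12 * rsum v (8 * r)))"
    by (rule dominated_add[OF dominated_add[OF err_finite_logr err_finite_logr]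
        dominated_add[OF dominated_add[OF dominated_cmult[OF err_rsum[OF l\<mu> \<mu>(1) g\<mu> \<delta>]] dominated_cmult[OF err_rsum[OF a \<delta>]]]
          dominated_cmult[OF err_rsum[OF v(1,2) gv \<delta>]]]]) simp_all
  then show ?thesis
  proof (rule dominated_mono)
    show "\<forall>\<^sub>F r in at_top. lcount \<mu> r - lcount (\<lambda>x. of_int (zorder (wilson f) x)) r - nevanlinna_N r f - wilson_N s r f
      \<le> (\<Sum>x\<in>F2. \<mu> x * logr r x) + (\<Sum>w\<in>F1. (- D w) * logr r w)
      + (12 * rsum \<mu> (8 * r) + 48 * rsum a (8 * r) + 12 * rsum v (8 * r))"
      using eventually_ge_at_top[of 1]
    proof eventually_elim
      case (elim r)
      then have r: "r > 0" by simp
      have "nevanlinna_N r f = lcount a r" "wilson_N s r f = lcount v r"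
        using nevanlinna_N_lcount[OF nf r] wilson_N_lcount[OF nf r, of s]
        by (simp_all only: a_def[abs_def] v_def[abs_def])
      moreover have "lcount (\<lambda>x. of_int (zorder (wilson f) x)) r = lcount D r"
        by (simp only: D_def[abs_def])
      moreover have "m - d - A - B \<le> R" if "A = la" "B = lv" "d = ld" "m - ld \<le> la + lv + R"
        for m d A B R la lv ld :: real
        using that by linarith
      ultimately show ?case
        using main[OF elim] by blast
    qed
  qed
qed

subsection \<open>The second main theorem\<close>

text \<open>Away from the \<open>y n\<close> the left sum is bounded; near \<open>y k\<close> only the \<open>k\<close>-th term is large, and it is
  split off as \<open>1 / (w - y k) = (D / (w - y k)) / D\<close>.\<close>

lemma sum_ln_plus_le:
  fixes y :: "nat \<Rightarrow> complex"
  assumes "inj_on y {1..q}"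
  obtains C where "\<And>w D :: complex. D \<noteq> 0 \<Longrightarrow> w \<noteq> 0 \<Longrightarrow> (\<forall>n\<in>{1..q}. w \<noteq> y n) \<Longrightarrow>
    (\<Sum>n=1..q. ln_plus (norm (1 / (w - y n)))) + ln (norm D) \<le>
    ln_plus (norm w) + ln_plus (norm (D / w)) + (\<Sum>n=1..q. ln_plus (norm (D / (w - y n)))) + C"
proof -
  \<comment> \<open>Inserting 1 keeps the minimum meaningful when there are no two distinct
    indices.\<close>
  define d where "d = Min (insert 1 ((\<lambda>(i, j). norm (y i - y j)) ` {(i, j). i \<in> {1..q} \<and> j \<in> {1..q} \<and> i \<noteq> j}))"
  have fin: "finite ((\<lambda>(i, j). norm (y i - y j)) ` {(i, j). i \<in> {1..q} \<and> j \<in> {1..q} \<and> i \<noteq> j})"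
    by (rule finite_imageI, rule finite_subset[of _ "{1..q} \<times> {1..q}"]) auto
  have d: "d > 0" unfolding d_def using fin assms by (subst Min_gr_iff) (auto dest: inj_onD)
  have dle: "d \<le> norm (y i - y j)" if "i \<in> {1..q}" "j \<in> {1..q}" "i \<noteq> j" for i j
    unfolding d_def using fin that by (intro Min_le) auto
  define c where "c = ln_plus (2 / d)"
  have c0: "c \<ge> 0" by (simp add: c_def ln_plus_nonneg)
  have far: "ln_plus (norm (1 / (w - y n))) \<le> c" if "norm (w - y n) \<ge> d / 2" for w n
  proof -
    have "norm (1 / (w - y n)) \<le> 1 / (d / 2)"
      using that d unfolding norm_divide by (intro frac_le) auto
    then have "norm (1 / (w - y n)) \<le> 2 / d" by simp
    then show ?thesis unfolding c_def by (rule ln_plus_mono)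
  qed
  show ?thesis
  proof (rule that[of "real q * c"])
    fix w D :: complex assume D: "D \<noteq> 0" and w: "w \<noteq> 0" "\<forall>n\<in>{1..q}. w \<noteq> y n"
    let ?S = "\<Sum>n=1..q. ln_plus (norm (1 / (w - y n)))" and ?E = "\<Sum>n=1..q. ln_plus (norm (D / (w - y n)))"
    \<comment> \<open>Writing \<open>D\<close> as \<open>w * (D / w)\<close> is the source of the
      single proximity term of \<open>f\<close> and of the extra quotient with target value
      0.\<close>
    have D2: "ln_plus (norm D) \<le> ln_plus (norm w) + ln_plus (norm (D / w))"
      using ln_plus_mult[of "norm w" "norm (D / w)"] w by (simp add: norm_divide)
    have E0: "?E \<ge> 0" by (intro sum_nonneg ln_plus_nonneg)
    show "?S + ln (norm D) \<le> ln_plus (norm w) + ln_plus (norm (D / w)) + ?E + real q * c"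
    proof (cases "\<forall>n\<in>{1..q}. norm (w - y n) \<ge> d / 2")
      case True
      then have "?S \<le> (\<Sum>n=1..q. c)" by (intro sum_mono far) auto
      then have "?S \<le> real q * c" by simp
      moreover have "ln (norm D) \<le> ln_plus (norm D)" by (simp add: ln_plus_eq)
      ultimately show ?thesis using D2 E0 by linarith
    next
      case False
      then obtain k where k: "k \<in> {1..q}" "norm (w - y k) < d / 2" by force
      have others: "norm (w - y n) \<ge> d / 2" if "n \<in> {1..q} - {k}" for n
      proof -
        have "d \<le> norm (y n - y k)" using that k by (intro dle) auto
        also have "\<dots> \<le> norm (w - y k) + norm (w - y n)"
          using norm_triangle_ineq4[of "w - y k" "w - y n"] by simp
        finally show ?thesis using k(2) by linarith
      qed
      have "?S = ln_plus (norm (1 / (w - y k))) + (\<Sum>n\<in>{1..q}-{k}. ln_plus (norm (1 / (w - y n))))"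
        using k by (subst sum.remove[of _ k]) auto
      also have "(\<Sum>n\<in>{1..q}-{k}. ln_plus (norm (1 / (w - y n)))) \<le> (\<Sum>n\<in>{1..q}-{k}. c)"
        by (intro sum_mono far others)
      also have "\<dots> \<le> (\<Sum>n=1..q. c)" using c0 by (intro sum_mono2) auto
      also have "\<dots> = real q * c" by simp
      finally have S: "?S \<le> ln_plus (norm (1 / (w - y k))) + real q * c" by simp
      have "ln_plus (norm (1 / (w - y k))) \<le> ln_plus (norm (D / (w - y k))) + ln_plus (1 / norm D)"
        using ln_plus_mult[of "norm (D / (w - y k))" "1 / norm D"] D by (simp add: norm_divide)
      moreover have "ln_plus (norm (D / (w - y k))) \<le> ?E"
        using k by (intro member_le_sum) (auto simp: ln_plus_nonneg)
      moreover have "ln (norm D) = ln_plus (norm D) - ln_plus (1 / norm D)"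
        by (rule ln_eq_ln_plus) simp
      ultimately show ?thesis using S D2 by linarith
    qed
  qed
qed

text \<open>The circle mean of \<open>sum_ln_plus_le\<close> with \<open>w = f\<close> and
  \<open>D = wilson f\<close>. The target 0 is written as \<open>f x - 0\<close> so that the bound
  for general targets covers it.\<close>

lemma proximity_inequality:
  fixes y :: "nat \<Rightarrow> complex"
  assumes f: "f meromorphic_on UNIV" "f \<notin> wilson_ker" and y: "inj_on y {1..q}"
  obtains C where "\<And>r. r > 0 \<Longrightarrow> (\<Sum>n=1..q. proximity r (\<lambda>x. 1 / (f x - y n)))
      + cavg (\<lambda>t. ln (norm (wilson f (of_real r * cis t)))) \<le>
    proximity r f + proximity r (\<lambda>x. wilson f x / (f x - 0))
      + (\<Sum>n=1..q. proximity r (\<lambda>x. wilson f x / (f x - y n))) + C"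
proof -
  obtain C where C: "\<And>w D :: complex. D \<noteq> 0 \<Longrightarrow> w \<noteq> 0 \<Longrightarrow> (\<forall>n\<in>{1..q}. w \<noteq> y n) \<Longrightarrow>
    (\<Sum>n=1..q. ln_plus (norm (1 / (w - y n)))) + ln (norm D) \<le>
    ln_plus (norm w) + ln_plus (norm (D / w)) + (\<Sum>n=1..q. ln_plus (norm (D / (w - y n)))) + C"
    using sum_ln_plus_le[OF y] by blast
  have nf: "nzmero f" using not_wilson_ker_nzmero(3)[OF f, of 0] by simp
  have ny: "nzmero (\<lambda>x. f x - c)" for c by (rule not_wilson_ker_nzmero(3)[OF f])
  note nW = not_wilson_ker_nzmero(1)[OF f]
  show ?thesis
  proof (rule that[of C])
    fix r :: real assume r: "r > 0"
    let ?z = "\<lambda>t. of_real r * cis t :: complex"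
    have i1: "cint (\<lambda>t. ln_plus (norm (1 / (f (?z t) - y n))))" for n
      using cint_ln_plus[OF nzmero_inverse[OF ny] r] .
    have i2: "cint (\<lambda>t. ln_plus (norm (wilson f (?z t) / (f (?z t) - c))))" for c
      using cint_ln_plus[OF nzmero_divide[OF nW ny] r] .
    have i3: "cint (\<lambda>t. ln (norm (wilson f (?z t))))" by (rule jensen(1)[OF nW r])
    have i4: "cint (\<lambda>t. ln_plus (norm (f (?z t))))" by (rule cint_ln_plus[OF nf r])
    define B where "B = {x \<in> cball 0 r. \<not> (wilson f x \<noteq> 0 \<and> f x \<noteq> 0)} \<union> (\<Union>n\<in>{1..q}. {x \<in> cball 0 r. \<not> f x - y n \<noteq> 0})"
    have "eventually (\<lambda>x. wilson f x \<noteq> 0 \<and> f x \<noteq> 0) (at x)" for x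
      using nzmero_at(4)[OF nW, of x] nzmero_at(4)[OF nf, of x] by eventually_elim simp
    then have "finite B"
      unfolding B_def by (intro finite_UnI finite_UN_I finite_cball_cosparse nzmero_at(4)[OF ny]) auto
    then have fB: "finite {t \<in> {0..2*pi}. ?z t \<in> B}" by (rule finite_circle_vimage[OF r])
    let ?L = "\<lambda>t. (\<Sum>n=1..q. ln_plus (norm (1 / (f (?z t) - y n)))) + ln (norm (wilson f (?z t)))"
    let ?R = "\<lambda>t. ln_plus (norm (f (?z t))) + ln_plus (norm (wilson f (?z t) / (f (?z t) - 0)))
        + (\<Sum>n=1..q. ln_plus (norm (wilson f (?z t) / (f (?z t) - y n)))) + C"
    have "cavg ?L \<le> cavg ?R"
    proof (rule cavg_mono[OF _ _ fB])
      show "cint ?L" by (intro cint_add cint_sum i1 i3)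
      show "cint ?R" by (intro cint_add cint_sum i2 i4 cint_const)
      fix t assume t: "t \<in> {0..2*pi} - {t \<in> {0..2*pi}. ?z t \<in> B}"
      have "norm (?z t) = r" using r by (simp add: norm_mult)
      then have "wilson f (?z t) \<noteq> 0" "f (?z t) \<noteq> 0" "\<forall>n\<in>{1..q}. f (?z t) \<noteq> y n"
        using t unfolding B_def by auto
      from C[OF this] show "?L t \<le> ?R t" by simp
    qed
    also have "cavg ?L = (\<Sum>n=1..q. proximity r (\<lambda>x. 1 / (f x - y n))) + cavg (\<lambda>t. ln (norm (wilson f (?z t))))"
      unfolding proximity_cavg by (subst cavg_add[OF cint_sum[OF i1] i3]) (simp only: cavg_sum[OF i1])
    also have "cavg ?R = proximity r f + proximity r (\<lambda>x. wilson f x / (f x - 0))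
      + (\<Sum>n=1..q. proximity r (\<lambda>x. wilson f x / (f x - y n))) + C"
      unfolding proximity_cavg
      by (simp only: cavg_add[OF cint_add[OF cint_add[OF i4 i2] cint_sum[OF i2]] cint_const]
          cavg_add[OF cint_add[OF i4 i2] cint_sum[OF i2]] cavg_add[OF i4 i2] cavg_sum[OF i2] cavg_const)
    finally show "(\<Sum>n=1..q. proximity r (\<lambda>x. 1 / (f x - y n)))
      + cavg (\<lambda>t. ln (norm (wilson f (?z t)))) \<le>
      proximity r f + proximity r (\<lambda>x. wilson f x / (f x - 0))
      + (\<Sum>n=1..q. proximity r (\<lambda>x. wilson f x / (f x - y n))) + C" .
  qed
qed

lemma lcount_sum:
  assumes "r > 0" "finite A" "\<And>n. n \<in> A \<Longrightarrow> lfin (w n)"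
  shows "lcount (\<lambda>x. \<Sum>n\<in>A. w n x) r = (\<Sum>n\<in>A. lcount (w n) r)"
proof -
  let ?T = "\<Union>n\<in>A. {x. x \<in> cball 0 r \<and> w n x \<noteq> 0}"
  have T: "finite ?T" using assms(2,3) lfinD by blast
  have "lcount (\<lambda>x. \<Sum>n\<in>A. w n x) r = (\<Sum>x\<in>?T. (\<Sum>n\<in>A. w n x) * logr r x)"
    by (rule lcount_eq[OF assms(1) T]) (auto dest: sum.not_neutral_contains_not_neutral)
  also have "\<dots> = (\<Sum>n\<in>A. \<Sum>x\<in>?T. w n x * logr r x)"
    unfolding sum_distrib_right by (rule sum.swap)
  also have "\<dots> = (\<Sum>n\<in>A. lcount (w n) r)"
    by (intro sum.cong refl lcount_eq[OF assms(1) T, symmetric]) auto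
  finally show ?thesis .
qed

text \<open>Summing the first main theorem over \<open>n\<close> and inserting
  \<open>proximity_inequality\<close>, Jensen's formula turns the mean of
  \<open>ln (norm (wilson f))\<close> into the counting term \<open>Z\<close>. The
  \<open>N(r, f)\<close> subtracted in \<open>wilson_counting\<close> is the one that comes from
  replacing \<open>m(r, f)\<close> by \<open>T(r, f) - N(r, f)\<close>, which leaves the factor
  \<open>q - 1\<close>.\<close>

lemma second_main_theorem_err:
  fixes y :: "nat \<Rightarrow> complex"
  assumes s: "wilson_branch s" and f: "f meromorphic_on UNIV" "f \<notin> wilson_ker" and y: "inj_on y {1..q}"
    and g: "grow \<beta> (\<lambda>r. nevanlinna_T r f)" and \<alpha>: "0 < \<alpha>" "\<alpha> < 1" "\<beta> - \<alpha> / 2 \<le> \<delta>"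
  shows "err \<delta> (\<lambda>r. (real q - 1) * nevanlinna_T r f
    - wilson_N s r f - (\<Sum>n=1..q. wilson_N s r (\<lambda>x. 1 / (f x - y n))))"
proof -
  have nf: "nzmero f" using not_wilson_ker_nzmero(3)[OF f, of 0] by simp
  have ny: "nzmero (\<lambda>x. f x - c)" for c by (rule not_wilson_ker_nzmero(3)[OF f])
  note nW = not_wilson_ker_nzmero(1)[OF f]
  define \<mu> where "\<mu> x = (\<Sum>n=1..q. real_of_int (wilson_excess s f (y n) x))" for x
  define Z where "Z r = lcount (\<lambda>x. of_int (zorder (wilson f) x)) r" for r
  obtain C where C: "\<And>r. r > 0 \<Longrightarrow> (\<Sum>n=1..q. proximity r (\<lambda>x. 1 / (f x - y n)))
      + cavg (\<lambda>t. ln (norm (wilson f (of_real r * cis t)))) \<le>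
    proximity r f + proximity r (\<lambda>x. wilson f x / (f x - 0))
      + (\<Sum>n=1..q. proximity r (\<lambda>x. wilson f x / (f x - y n))) + C"
    using proximity_inequality[OF f y] by blast
  define c where "c n = ln_plus (norm (y n)) + ln 2 + \<bar>log_lead (\<lambda>x. f x - y n)\<bar>" for n
  have "\<beta> - 1 / 2 < \<delta>" using \<alpha> by linarith
  from wilson_counting[OF s f y g this]
  have cnt: "err \<delta> (\<lambda>r. lcount \<mu> r - Z r - nevanlinna_N r f - wilson_N s r f)"
    unfolding \<mu>_def[abs_def] Z_def .
  have "err \<delta> (\<lambda>r. (lcount \<mu> r - Z r - nevanlinna_N r f - wilson_N s r f)
      + (proximity r (\<lambda>x. wilson f x / (f x - 0)) + (\<Sum>n=1..q. proximity r (\<lambda>x. wilson f x / (f x - y n))))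
      + (C - log_lead (wilson f) + (\<Sum>n=1..q. c n)))"
    by (intro dominated_add dominated_sum err_const cnt err_proximity_wilson_quot[OF f g \<alpha>])
  then show ?thesis
  proof (rule dominated_mono)
    show "\<forall>\<^sub>F r in at_top. (real q - 1) * nevanlinna_T r f - wilson_N s r f - (\<Sum>n=1..q. wilson_N s r (\<lambda>x. 1 / (f x - y n)))
      \<le> (lcount \<mu> r - Z r - nevanlinna_N r f - wilson_N s r f)
      + (proximity r (\<lambda>x. wilson f x / (f x - 0)) + (\<Sum>n=1..q. proximity r (\<lambda>x. wilson f x / (f x - y n))))
      + (C - log_lead (wilson f) + (\<Sum>n=1..q. c n))"
      using eventually_gt_at_top[of 0]
    proof eventually_elim
      case (elim r)
      have J: "cavg (\<lambda>t. ln (norm (wilson f (of_real r * cis t)))) = log_lead (wilson f) + Z r"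
        unfolding Z_def by (rule jensen_lcount[OF nW elim])
      have "real q * nevanlinna_T r f = (\<Sum>n=1..q. nevanlinna_T r f)" by simp
      also have "\<dots> \<le> (\<Sum>n=1..q. proximity r (\<lambda>x. 1 / (f x - y n)) + nevanlinna_N r (\<lambda>x. 1 / (f x - y n)) + c n)"
      proof (rule sum_mono)
        fix n
        show "nevanlinna_T r f \<le> proximity r (\<lambda>x. 1 / (f x - y n)) + nevanlinna_N r (\<lambda>x. 1 / (f x - y n)) + c n"
          using first_main_theorem[OF nf ny elim, of "y n"] unfolding c_def nevanlinna_T_def[of r "\<lambda>x. 1 / (f x - y n)"] by linarith
      qed
      also have "\<dots> = (\<Sum>n=1..q. proximity r (\<lambda>x. 1 / (f x - y n))) + (\<Sum>n=1..q. nevanlinna_N r (\<lambda>x. 1 / (f x - y n))) + (\<Sum>n=1..q. c n)"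
        by (simp add: sum.distrib)
      finally have T: "real q * nevanlinna_T r f \<le> \<dots>" .
      have M: "lcount \<mu> r = (\<Sum>n=1..q. nevanlinna_N r (\<lambda>x. 1 / (f x - y n))) - (\<Sum>n=1..q. wilson_N s r (\<lambda>x. 1 / (f x - y n)))"
      proof -
        have lf: "lfin (\<lambda>x. of_int (pole_order (\<lambda>v. 1 / (f v - c)) x))"
          "lfin (\<lambda>x. of_int (wilson_weight s (\<lambda>v. 1 / (f v - c)) x))" for c
          by (rule lfin_pole_order[OF nzmero_inverse[OF ny]], rule lfin_wilson_weight[OF nzmero_inverse[OF ny]])
        have "lcount \<mu> r = (\<Sum>n=1..q. lcount (\<lambda>x. real_of_int (wilson_excess s f (y n) x)) r)"
          unfolding \<mu>_def[abs_def]
        proof (rule lcount_sum[OF elim])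
          fix n
          show "lfin (\<lambda>x. real_of_int (wilson_excess s f (y n) x))"
            unfolding wilson_excess_def by (rule lfin_Un[OF lf(1)[of "y n"] lf(2)[of "y n"]]) simp
        qed simp
        also have "\<dots> = (\<Sum>n=1..q. nevanlinna_N r (\<lambda>x. 1 / (f x - y n)) - wilson_N s r (\<lambda>x. 1 / (f x - y n)))"
          unfolding wilson_excess_def of_int_diff lcount_diff[OF elim lf]
          by (simp add: nevanlinna_N_lcount[OF nzmero_inverse[OF ny] elim] wilson_N_lcount[OF nzmero_inverse[OF ny] elim])
        finally show ?thesis by (simp add: sum_subtractf)
      qed
      have NT: "nevanlinna_T r f = proximity r f + nevanlinna_N r f" by (simp only: nevanlinna_T_def)
      have QT: "(real q - 1) * nevanlinna_T r f = real q * nevanlinna_T r f - nevanlinna_T r f"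
        by (simp add: left_diff_distrib)
      have "(Q - T) - W - WS \<le> (m - Z - N - W) + (p0 + ps) + (C - l + cs)"
        if "ip + J \<le> P + p0 + ps + C" "J = l + Z" "Q \<le> ip + NS + cs" "m = NS - WS" "T = P + N"
        for Q T W WS m Z N p0 ps C l cs ip J P NS :: real
        using that by linarith
      from this[OF C[OF elim] J T M NT] show ?case
        unfolding QT .
    qed
  qed
qed

theorem theorem3p2:
  fixes f :: "complex \<Rightarrow> complex" and s :: "complex \<Rightarrow> complex"
    and \<sigma> \<epsilon> :: real and q :: nat and y :: "nat \<Rightarrow> complex"
  assumes "wilson_branch s"
    and "f meromorphic_on UNIV"
    and "nevanlinna_order f = ereal \<sigma>"
    and "f \<notin> wilson_ker"
    and "q \<ge> 1"
    and "inj_on y {1..q}"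
    and "\<epsilon> > 0"
  shows "\<exists>E1 E2 :: real \<Rightarrow> real.
      E1 \<in> O[at_top](\<lambda>r. r powr (\<sigma> - 1 / 2 + \<epsilon>)) \<and>
      E2 \<in> O[at_top](\<lambda>r. ln r) \<and>
      (\<forall>\<^sub>F r in at_top.
         (real q - 1) * nevanlinna_T r f
           \<le> wilson_N s r f + (\<Sum>n = 1..q. wilson_N s r (\<lambda>x. 1 / (f x - y n))) + E1 r + E2 r)"
proof -
  \<comment> \<open>Half of \<epsilon> raises the order to \<beta> and at most a quarter is lost
    through \<alpha> < 1, so \<open>\<beta> - \<alpha> / 2 \<le> \<sigma> - 1 / 2 + 3 / 4 *
    \<epsilon>\<close>. The maximum with 1/2 keeps \<alpha> positive when \<epsilon> is
    large.\<close>
  define \<alpha> where "\<alpha> = max (1 / 2) (1 - \<epsilon> / 2)"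
  define \<beta> where "\<beta> = \<sigma> + \<epsilon> / 2"
  define \<delta> where "\<delta> = \<sigma> - 1 / 2 + \<epsilon>"
  have "1 - \<epsilon> / 2 \<le> \<alpha>" and \<alpha>01: "0 < \<alpha>" "\<alpha> < 1"
    using \<open>\<epsilon> > 0\<close> by (auto simp: \<alpha>_def)
  then have \<alpha>: "\<beta> - \<alpha> / 2 \<le> \<delta>"
    unfolding \<beta>_def \<delta>_def using \<open>\<epsilon> > 0\<close> by linarith
  have "\<forall>\<^sub>F r in at_top. nevanlinna_T r f \<le> r powr \<beta>"
    by (rule nevanlinna_order_bound[OF assms(3)]) (use \<open>\<epsilon> > 0\<close> in \<open>simp add: \<beta>_def\<close>)
  then have "grow \<beta> (\<lambda>r. nevanlinna_T r f)"
    by (intro growI[of _ 1 _ 0]) simp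
  from second_main_theorem_err[OF assms(1,2,4,6) this \<alpha>01 \<alpha>]
  obtain C where C: "\<forall>\<^sub>F r in at_top. (real q - 1) * nevanlinna_T r f - wilson_N s r f
      - (\<Sum>n=1..q. wilson_N s r (\<lambda>x. 1 / (f x - y n))) \<le> C * (r powr \<delta> + ln r)"
    by (auto simp: dominated_def)
  show ?thesis
  proof (intro exI conjI)
    show "(\<lambda>r. C * r powr \<delta>) \<in> O(\<lambda>r. r powr (\<sigma> - 1 / 2 + \<epsilon>))"
      unfolding \<delta>_def by simp
    show "(\<lambda>r. C * ln r) \<in> O(ln)"
      by simp
    show "\<forall>\<^sub>F r in at_top. (real q - 1) * nevanlinna_T r f
        \<le> wilson_N s r f + (\<Sum>n = 1..q. wilson_N s r (\<lambda>x. 1 / (f x - y n))) + C * r powr \<delta> + C * ln r"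
      using C by eventually_elim (simp add: distrib_left)
  qed
qed

end
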